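(* Let $\Omega$ and $\omega$ be bounded domains in $\mathbb{R}^2$ containing the origin $O$, such that the minimum distance between the origin and the points of $\partial\Omega$ and the maximum distance between the origin and the points of $\partial\omega$ are both equal to $1$. For small $\varepsilon>0$ put $\omega_\varepsilon=\{\mathbf{x}:\varepsilon^{-1}\mathbf{x}\in\omega\}$ and $\Omega_\varepsilon=\Omega\setminus\overline{\omega}_\varepsilon$. Let $G_\varepsilon$, $G$ and $\mathfrak{G}$ be Green's functions of the Dirichlet problem for the Laplace operator in $\Omega_\varepsilon$, $\Omega$ and $\mathbb{R}^2\setminus\overline{\omega}$, respectively, and let $H$ be the regular part of $G$. Let $$ \zeta(\boldsymbol{\eta})=\lim_{|\boldsymbol{\xi}|\to\infty}\mathfrak{G}(\boldsymbol{\xi},\boldsymbol{\eta})\quad\text{and}\quad \zeta_\infty=\lim_{|\boldsymbol{\eta}|\to\infty}\{\zeta(\boldsymbol{\eta})-(2\pi)^{-1}\log|\boldsymbol{\eta}|\}. $$ Then, as $\varepsilon\to0$, the following asymptotic representation holds, uniformly with respect to $\mathbf{x},\mathbf{y}\in\Omega_\varepsilon$: $$ G_\varepsilon(\mathbf{x},\mathbf{y})=G(\mathbf{x},\mathbf{y})+\mathfrak{G}(\varepsilon^{-1}\mathbf{x},\varepsilon^{-1}\mathbf{y})+(2\pi)^{-1}\log(\varepsilon^{-1}|\mathbf{x}-\mathbf{y}|) $$ $$ +\frac{\Big((2\pi)^{-1}\log\varepsilon+\zeta(\frac{\mathbf{x}}{\varepsilon})-\zeta_\infty+H(\mathbf{x},0)\Big)\Big((2\pi)^{-1}\log\varepsilon+\zeta(\frac{\mathbf{y}}{\varepsilon})-\zeta_\infty+H(0,\mathbf{y})\Big)}{(2\pi)^{-1}\log\varepsilon+H(0,0)-\zeta_\infty}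 $$ $$ -\zeta(\varepsilon^{-1}\mathbf{x})-\zeta(\varepsilon^{-1}\mathbf{y})+\zeta_\infty+O(\varepsilon). $$
   Context: Green's functions are normalised by $-\Delta_x G(\mathbf{x},\mathbf{y})=\delta(\mathbf{x}-\mathbf{y})$ with zero Dirichlet boundary values; in the exterior domain $\mathbb{R}^2\setminus\overline{\omega}$, $\mathfrak{G}(\boldsymbol{\xi},\boldsymbol{\eta})$ is bounded as $|\boldsymbol{\xi}|\to\infty$. The regular part of $G$ is $H(\mathbf{x},\mathbf{y})=(2\pi)^{-1}\log|\mathbf{x}-\mathbf{y}|^{-1}-G(\mathbf{x},\mathbf{y})$. "Uniformly" means that the constant in the $O$-term is independent of $\mathbf{x},\mathbf{y}$ and $\varepsilon$. *)

theory Defs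
  imports "HOL-Complex_Analysis.Complex_Analysis"
begin

text \<open>
  The plane $R^2$ is represented by the type \<^typ>\<open>complex\<close>, whose norm, inner product and
  \<^const>\<open>lborel\<close> are the Euclidean ones; \<^term>\<open>Basis :: complex set\<close> consists of 1 and i.
\<close>

definition partial :: "complex \<Rightarrow> (complex \<Rightarrow> real) \<Rightarrow> complex \<Rightarrow> real" where
  "partial b f x = frechet_derivative f (at x) b"

definition laplacian :: "(complex \<Rightarrow> real) \<Rightarrow> complex \<Rightarrow> real" where
  "laplacian f x = (\<Sum>b\<in>Basis. partial b (partial b f) x)"

definition twice_cont_diff :: "(complex \<Rightarrow> real) \<Rightarrow> bool" where
  "twice_cont_diff f \<longleftrightarrow>
     (\<forall>x. f differentiable at x) \<and>
     (\<forall>b\<in>Basis. (\<forall>x. partial b f differentiable at x) \<and>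
        (\<forall>c\<in>Basis. continuous_on UNIV (partial c (partial b f))))"

definition test_function :: "complex set \<Rightarrow> (complex \<Rightarrow> real) \<Rightarrow> bool" where
  "test_function D \<phi> \<longleftrightarrow>
     twice_cont_diff \<phi> \<and> (\<exists>K. compact K \<and> K \<subseteq> D \<and> (\<forall>x. x \<notin> K \<longrightarrow> \<phi> x = 0))"

text \<open>
  The equation $-\Delta u = \delta_y$ in \<open>D\<close> in the sense of distributions, for a locally
  integrable \<open>u\<close>.  As \<open>u\<close> is locally integrable, $C^2$ and $C^\infty$ test functions of compact
  support give the same condition.  Values of \<open>u\<close> outside \<open>D\<close> do not matter, since the
  Laplacian of a test function vanishes there.
\<close>

definition minus_laplacian_eq_delta :: "complex set \<Rightarrow> (complex \<Rightarrow> real) \<Rightarrow> complex \<Rightarrow> bool" where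
  "minus_laplacian_eq_delta D u y \<longleftrightarrow>
     (\<forall>K. compact K \<and> K \<subseteq> D \<longrightarrow> set_integrable lborel K u) \<and>
     (\<forall>\<phi>. test_function D \<phi> \<longrightarrow> - (LINT x|lborel. u x * laplacian \<phi> x) = \<phi> y)"

text \<open>
  Polar sets: sets on which the logarithmic potential of some finite Borel measure is infinite.
  \<^const>\<open>ennreal\<close> cuts the kernel off at 0, i.e. only its part over $|x-y| < 1$ is used.  This
  changes the potential of a compactly supported measure by a locally bounded function, so it
  does not affect where the potential is infinite; and it keeps the potential well defined when
  the support is unbounded, so that unbounded polar sets are covered too.  The kernel is set to infinity on the diagonal
  by hand, because \<^term>\<open>ln (1 / 0 :: real) = 0\<close>.
\<close>

definition log_potential :: "complex measure \<Rightarrow> complex \<Rightarrow> ennreal" where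
  "log_potential \<mu> x =
     (\<integral>\<^sup>+ y. (if y = x then \<infinity> else ennreal (ln (1 / dist x y))) \<partial>\<mu>)"

definition polar :: "complex set \<Rightarrow> bool" where
  "polar E \<longleftrightarrow>
     (\<exists>\<mu>. finite_measure \<mu> \<and> sets \<mu> = sets borel \<and> (\<forall>x\<in>E. log_potential \<mu> x = \<infinity>))"

text \<open>
  Green's function of the Dirichlet problem for the Laplacian in an open set \<open>D\<close>, which may be
  unbounded, disconnected, or have irregular boundary points.  The boundary is not assumed
  smooth, so the zero boundary values are required in the generalized sense of potential theory:
  \<open>G(\<cdot>,y)\<close> is bounded away from its pole and tends to 0 at every boundary point outside a polar
  set.  If \<open>D\<close> is bounded and \<open>G(\<cdot>,y)\<close> tends to 0 at every boundary point, then boundedness away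
  from the pole is automatic; if \<open>D\<close> is an exterior domain, it includes boundedness at infinity.
  Continuity off the pole selects the representative of the distributional solution.  Nothing is
  required of the values of \<open>G\<close> on the diagonal or outside \<open>D\<close>.
\<close>

definition green_function :: "complex set \<Rightarrow> (complex \<Rightarrow> complex \<Rightarrow> real) \<Rightarrow> bool" where
  "green_function D G \<longleftrightarrow>
     (\<forall>y\<in>D.
        continuous_on (D - {y}) (\<lambda>x. G x y) \<and>
        minus_laplacian_eq_delta D (\<lambda>x. G x y) y \<and>
        (\<forall>r>0. bounded ((\<lambda>x. G x y) ` (D - ball y r))) \<and>
        polar {z \<in> frontier D. \<not> ((\<lambda>x. G x y) \<longlongrightarrow> 0) (at z within D)})"

text \<open>On the diagonal the regular part is understood by continuous extension.\<close>

definition regular_part :: "(complex \<Rightarrow> complex \<Rightarrow> real) \<Rightarrow> complex \<Rightarrow> complex \<Rightarrow> real" where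
  "regular_part G x y =
     (let h = (\<lambda>z. 1 / (2 * pi) * ln (1 / dist z y) - G z y)
      in if x = y then Lim (at y) h else h x)"

definition scaled_set :: "real \<Rightarrow> complex set \<Rightarrow> complex set" where
  "scaled_set \<epsilon> \<omega> = {x. x /\<^sub>R \<epsilon> \<in> \<omega>}"

definition perforated :: "complex set \<Rightarrow> complex set \<Rightarrow> real \<Rightarrow> complex set" where
  "perforated \<Omega> \<omega> \<epsilon> = \<Omega> - closure (scaled_set \<epsilon> \<omega>)"

end

theory Submission imports Defs begin


text \<open>
  The error of the approximation is estimated as a function of \<open>x\<close> for fixed \<open>y\<close>.  It is harmonic
  and bounded in the perforated domain away from \<open>y\<close>, and it is of order $\varepsilon$ at the
  outer boundary and at the boundary of the hole, so the maximum principle gives the claim.  At the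
  outer boundary this rests on the behaviour of $\mathfrak{G}$ and $\zeta$ at infinity,
  $$\zeta(\xi) = (2\pi)^{-1}\ln|\xi| + \zeta_\infty + O(1/|\xi|), \qquad
    \mathfrak{G}(\xi,\eta) + (2\pi)^{-1}\ln|\xi-\eta| = \zeta(\xi) + \zeta(\eta) - \zeta_\infty + O(1/|\xi|),$$
  uniformly in $\eta$.  At the boundary of the hole it rests on $H(x,y) = H(0,y) + O(|x|)$ and
  $H(x,0) = H(0,0) + O(|x|)$, after which the product term is designed to cancel what remains
  (\<open>remainder_fixed\<close>, \<open>uniform_remainder\<close>).

  Both expansions come from the symmetry of $\mathfrak{G}$.  Cancel the pole of $\mathfrak{G}(\cdot,p)$
  by adding $(2\pi)^{-1}\ln(|x-p|/|p|)$.  The result has boundary values of order $1/|p|$, so by the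
  maximum principle it converges at this rate, uniformly in \<open>x\<close>, as $p \to \infty$
  (\<open>pole_free_diff\<close>).  Symmetry identifies the limit with $\zeta$ (\<open>zeta_limit\<close>), and exchanging the
  two points gives the expansion of $\zeta$ itself (\<open>zeta_inf_limit\<close>, \<open>regular_part_far\<close>).  Symmetry
  holds for every Green's function of the kind considered here (\<open>green_symmetric_le\<close>): averaging is
  self-adjoint, Green's functions are nonnegative, and the positive part of a Green's function minus a
  small barrier is a compactly supported function that can be paired with another Green's function.

  Harmonic functions are handled throughout by averages against a bump.  The bump is $(2\pi)^{-1}$ times
  the Laplacian of a $C^2$ function that agrees with $\ln|x|$ outside a disc, and differences of such
  functions are test functions.  Testing $-\Delta G = \delta_y$ with them gives the mean value property
  off the pole, the continuous extension of the regular part across the pole, and, since the bump is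
  Lipschitz, all the gradient bounds that are needed (\<open>green_eq_avg\<close>, \<open>regular_part_lipschitz\<close>).

  The boundary values are attained only off polar sets.  Therefore the maximum principle
  (\<open>max_principle\<close>) is proved by subtracting a small multiple of a positive superharmonic function
  that is large near the exceptional boundary points and bounded at a given interior point
  (\<open>polar_barrier\<close>).
\<close>

section \<open>A smoothed logarithm\<close>

text \<open>
  The $C^2$ continuation of \<open>ln\<close> below 1 by its Taylor polynomial of order two at 1, followed by
  its first two derivatives.
\<close>

definition ell :: "real \<Rightarrow> real" where
  "ell t = (if t \<ge> 1 then ln t else (t - 1) - (t - 1)\<^sup>2 / 2)"

definition ell' :: "real \<Rightarrow> real" where
  "ell' t = (if t \<ge> 1 then 1 / t else 2 - t)"

definition ell'' :: "real \<Rightarrow> real" where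
  "ell'' t = (if t \<ge> 1 then - 1 / t\<^sup>2 else - 1)"

text \<open>
  $\ln|x|$ with its singularity smoothed inside the disc of radius \<open>r\<close>.  Its Laplacian is
  $2\pi$ times the following bump, which is a probability density; \<open>smooth_log r\<close> is the
  convolution of $\ln|x|$ with it.
\<close>

definition smooth_log :: "real \<Rightarrow> complex \<Rightarrow> real" where
  "smooth_log r x = (ell ((norm x)\<^sup>2 / r\<^sup>2) + ln (r\<^sup>2)) / 2"

definition bump :: "real \<Rightarrow> complex \<Rightarrow> real" where
  "bump r x = 2 / (pi * r\<^sup>2) * max 0 (1 - (norm x)\<^sup>2 / r\<^sup>2)"

lemma DERIV_glue:
  fixes f g :: "real \<Rightarrow> real"
  assumes "(f has_real_derivative D) (at a)" "(g has_real_derivative D) (at a)" "f a = g a"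
  shows "((\<lambda>t. if t \<ge> a then f t else g t) has_real_derivative D) (at a)"
proof -
  have f: "((\<lambda>y. (f y - f a) / (y - a)) \<longlongrightarrow> D) (at a)"
    and g: "((\<lambda>y. (g y - g a) / (y - a)) \<longlongrightarrow> D) (at a)"
    using assms by (auto simp: has_field_derivative_iff)
  have "((\<lambda>y. if y \<ge> a then (f y - f a) / (y - a) else (g y - g a) / (y - a)) \<longlongrightarrow> D) (at a)"
    by (rule filterlim_If) (auto intro: filterlim_mono[OF f] filterlim_mono[OF g])
  then have "((\<lambda>y. ((if y \<ge> a then f y else g y) - f a) / (y - a)) \<longlongrightarrow> D) (at a)"
    by (rule Lim_transform_eventually) (use assms(3) in \<open>auto intro!: always_eventually\<close>)
  then show ?thesis by (simp add: has_field_derivative_iff)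
qed

lemma DERIV_ell: "(ell has_real_derivative ell' t) (at t)"
proof -
  consider "t > 1" | "t < 1" | "t = 1" by linarith
  then show ?thesis
  proof cases
    case 1
    then have "(ln has_real_derivative 1 / t) (at t)"
      by (auto intro!: derivative_eq_intros)
    moreover have "eventually (\<lambda>s. s > 1) (nhds t)"
      using 1 by (auto intro: order_tendstoD filterlim_ident)
    then have "eventually (\<lambda>s. ell s = ln s) (nhds t)"
      by eventually_elim (simp add: ell_def)
    ultimately show ?thesis using 1 by (simp add: ell'_def DERIV_cong_ev)
  next
    case 2
    then have "((\<lambda>t. (t - 1) - (t - 1)\<^sup>2 / 2) has_real_derivative 2 - t) (at t)"
      by (auto intro!: derivative_eq_intros simp: field_simps)
    moreover have "eventually (\<lambda>s. s < 1) (nhds t)"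
      using 2 by (auto intro: order_tendstoD filterlim_ident)
    then have "eventually (\<lambda>s. ell s = (s - 1) - (s - 1)\<^sup>2 / 2) (nhds t)"
      by eventually_elim (simp add: ell_def)
    ultimately show ?thesis using 2 by (simp add: ell'_def DERIV_cong_ev)
  next
    case 3
    have "((\<lambda>t. if t \<ge> 1 then ln t else (t - 1) - (t - 1)\<^sup>2 / 2) has_real_derivative 1) (at 1)"
      by (rule DERIV_glue) (auto intro!: derivative_eq_intros)
    then show ?thesis using 3 by (simp add: ell_def[abs_def] ell'_def)
  qed
qed

lemma DERIV_ell': "(ell' has_real_derivative ell'' t) (at t)"
proof -
  consider "t > 1" | "t < 1" | "t = 1" by linarith
  then show ?thesis
  proof cases
    case 1
    then have "((\<lambda>t. 1 / t) has_real_derivative - 1 / t\<^sup>2) (at t)"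
      by (auto intro!: derivative_eq_intros simp: power2_eq_square)
    moreover have "eventually (\<lambda>s. s > 1) (nhds t)"
      using 1 by (auto intro: order_tendstoD filterlim_ident)
    then have "eventually (\<lambda>s. ell' s = 1 / s) (nhds t)"
      by eventually_elim (simp add: ell'_def)
    ultimately show ?thesis using 1 by (simp add: ell''_def DERIV_cong_ev)
  next
    case 2
    then have "((\<lambda>t. 2 - t) has_real_derivative - 1) (at t)"
      by (auto intro!: derivative_eq_intros simp: field_simps)
    moreover have "eventually (\<lambda>s. s < 1) (nhds t)"
      using 2 by (auto intro: order_tendstoD filterlim_ident)
    then have "eventually (\<lambda>s. ell' s = 2 - s) (nhds t)"
      by eventually_elim (simp add: ell'_def)
    ultimately show ?thesis using 2 by (simp add: ell''_def DERIV_cong_ev)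
  next
    case 3
    have "((\<lambda>t. if t \<ge> 1 then 1 / t else 2 - t) has_real_derivative - 1) (at 1)"
      by (rule DERIV_glue) (auto intro!: derivative_eq_intros)
    then show ?thesis using 3 by (simp add: ell'_def[abs_def] ell''_def)
  qed
qed

lemma has_derivative_ell [derivative_intros]:
  "(f has_derivative f') (at x) \<Longrightarrow> ((\<lambda>x. ell (f x)) has_derivative (\<lambda>h. f' h * ell' (f x))) (at x)"
  by (rule DERIV_compose_FDERIV[OF DERIV_ell])

lemma has_derivative_ell' [derivative_intros]:
  "(f has_derivative f') (at x) \<Longrightarrow> ((\<lambda>x. ell' (f x)) has_derivative (\<lambda>h. f' h * ell'' (f x))) (at x)"
  by (rule DERIV_compose_FDERIV[OF DERIV_ell'])

lemma continuous_ell'': "continuous_on UNIV ell''"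
proof -
  have "continuous_on ({1..} \<union> {..1}) (\<lambda>t::real. if 1 \<le> t then - 1 / t\<^sup>2 else - 1)"
    by (rule continuous_on_If) (auto intro!: continuous_intros)
  moreover have "{1..} \<union> {..1::real} = UNIV" by auto
  ultimately show ?thesis by (simp add: ell''_def[abs_def])
qed

lemma has_derivative_smooth_log:
  assumes "r > 0"
  shows "((\<lambda>x. smooth_log r (x - y)) has_derivative
           (\<lambda>h. ell' ((norm (x - y))\<^sup>2 / r\<^sup>2) * ((x - y) \<bullet> h) / r\<^sup>2)) (at x)"
proof -
  have "((\<lambda>x. (ell (((x - y) \<bullet> (x - y)) / r\<^sup>2) + ln (r\<^sup>2)) / 2) has_derivative
     (\<lambda>h. (ell' (((x - y) \<bullet> (x - y)) / r\<^sup>2) * ((2 * ((x - y) \<bullet> h)) / r\<^sup>2)) / 2)) (at x)"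
    using assms by (auto intro!: derivative_eq_intros ext simp: inner_commute field_simps power2_eq_square power4_eq_xxxx)
  then show ?thesis
    by (simp add: smooth_log_def[abs_def] power2_norm_eq_inner field_simps)
qed

lemma partial_smooth_log:
  assumes "r > 0"
  shows "partial b (\<lambda>x. smooth_log r (x - y)) = (\<lambda>x. ell' ((norm (x - y))\<^sup>2 / r\<^sup>2) * ((x - y) \<bullet> b) / r\<^sup>2)"
  using frechet_derivative_at[OF has_derivative_smooth_log[OF assms, of y]]
  by (auto simp: partial_def fun_eq_iff dest: fun_cong)

lemma has_derivative_partial_smooth_log:
  assumes "r > 0"
  shows "(partial b (\<lambda>x. smooth_log r (x - y)) has_derivative
     (\<lambda>h. ell'' ((norm (x - y))\<^sup>2 / r\<^sup>2) * (2 * ((x - y) \<bullet> h)) * ((x - y) \<bullet> b) / r^4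
          + ell' ((norm (x - y))\<^sup>2 / r\<^sup>2) * (h \<bullet> b) / r\<^sup>2)) (at x)"
proof -
  have "((\<lambda>x. ell' (((x - y) \<bullet> (x - y)) / r\<^sup>2) * ((x - y) \<bullet> b) / r\<^sup>2) has_derivative
     (\<lambda>h. (ell'' (((x - y) \<bullet> (x - y)) / r\<^sup>2) * ((2 * ((x - y) \<bullet> h)) / r\<^sup>2) * ((x - y) \<bullet> b)
        + ell' (((x - y) \<bullet> (x - y)) / r\<^sup>2) * (h \<bullet> b)) / r\<^sup>2)) (at x)"
    using assms by (auto intro!: derivative_eq_intros ext simp: inner_commute field_simps power2_eq_square)
  moreover have "(ell'' (((x - y) \<bullet> (x - y)) / r\<^sup>2) * ((2 * ((x - y) \<bullet> h)) / r\<^sup>2) * ((x - y) \<bullet> b)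
        + ell' (((x - y) \<bullet> (x - y)) / r\<^sup>2) * (h \<bullet> b)) / r\<^sup>2
      = ell'' ((norm (x - y))\<^sup>2 / r\<^sup>2) * (2 * ((x - y) \<bullet> h)) * ((x - y) \<bullet> b) / r^4
          + ell' ((norm (x - y))\<^sup>2 / r\<^sup>2) * (h \<bullet> b) / r\<^sup>2" for h
    unfolding power2_norm_eq_inner by (simp add: add_divide_distrib power4_eq_xxxx power2_eq_square mult.assoc)
  ultimately show ?thesis
    by (simp add: partial_smooth_log[OF assms] power2_norm_eq_inner)
qed

lemma partial_partial_smooth_log:
  assumes "r > 0"
  shows "partial c (partial b (\<lambda>x. smooth_log r (x - y))) =
     (\<lambda>x. ell'' ((norm (x - y))\<^sup>2 / r\<^sup>2) * (2 * ((x - y) \<bullet> c)) * ((x - y) \<bullet> b) / r^4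
          + ell' ((norm (x - y))\<^sup>2 / r\<^sup>2) * (c \<bullet> b) / r\<^sup>2)"
  using frechet_derivative_at[OF has_derivative_partial_smooth_log[OF assms, of b y]]
  by (auto simp: partial_def[of c] fun_eq_iff dest: fun_cong)

lemma twice_cont_diff_smooth_log:
  assumes "r > 0"
  shows "twice_cont_diff (\<lambda>x. smooth_log r (x - y))"
proof -
  have c': "continuous_on UNIV ell'"
    using DERIV_ell' by (meson DERIV_isCont continuous_at_imp_continuous_on)
  have "continuous_on UNIV (\<lambda>x::complex. ell' ((norm (x - y))\<^sup>2 / r\<^sup>2))"
       "continuous_on UNIV (\<lambda>x::complex. ell'' ((norm (x - y))\<^sup>2 / r\<^sup>2))"
    using assms
    by (auto intro!: continuous_intros continuous_on_compose2[OF c'] continuous_on_compose2[OF continuous_ell''])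
  then show ?thesis using assms
    unfolding twice_cont_diff_def partial_partial_smooth_log[OF assms]
    by (auto intro!: continuous_intros differentiableI[OF has_derivative_smooth_log]
        differentiableI[OF has_derivative_partial_smooth_log])
qed

lemma laplacian_smooth_log:
  assumes "r > 0"
  shows "laplacian (\<lambda>x. smooth_log r (x - y)) x = 2 * pi * bump r (x - y)"
proof -
  define t where "t = (norm (x - y))\<^sup>2 / r\<^sup>2"
  have n: "(norm (x - y))\<^sup>2 = t * r\<^sup>2" using assms by (simp add: t_def)
  have n': "(Re x - Re y)\<^sup>2 + (Im x - Im y)\<^sup>2 = t * r\<^sup>2"
    using n by (simp add: cmod_power2)
  have "laplacian (\<lambda>x. smooth_log r (x - y)) x = ell'' t * 2 * ((Re x - Re y)\<^sup>2 + (Im x - Im y)\<^sup>2) / r^4 + ell' t * 2 / r\<^sup>2"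
    using assms unfolding laplacian_def partial_partial_smooth_log[OF assms] t_def[symmetric]
    by (simp add: Basis_complex_def inner_complex_def field_simps power2_eq_square)
  also have "\<dots> = (2 * t * ell'' t + 2 * ell' t) / r\<^sup>2"
    unfolding n' using assms by (simp add: field_simps power4_eq_xxxx power2_eq_square)
  also have "\<dots> = 4 / r\<^sup>2 * max 0 (1 - t)"
    by (auto simp: ell''_def ell'_def field_simps power2_eq_square max_def)
  finally show ?thesis using assms by (simp add: bump_def t_def field_simps)
qed

lemma smooth_log_eq_ln: "0 < r \<Longrightarrow> r \<le> norm x \<Longrightarrow> smooth_log r x = ln (norm x)"
proof -
  assume "0 < r" "r \<le> norm x"
  then have "1 \<le> (norm x)\<^sup>2 / r\<^sup>2" "norm x > 0" by (auto simp: field_simps power_mono)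
  then show ?thesis using \<open>0 < r\<close>
    by (simp add: smooth_log_def ell_def ln_div ln_realpow)
qed

lemma bump_nonneg: "0 < r \<Longrightarrow> 0 \<le> bump r x" by (simp add: bump_def)

lemma bump_eq_0: "0 < r \<Longrightarrow> r \<le> norm x \<Longrightarrow> bump r x = 0"
  by (simp add: bump_def field_simps power_mono)

lemma bump_pos: "0 < r \<Longrightarrow> norm x < r \<Longrightarrow> bump r x > 0"
  by (simp add: bump_def field_simps power_strict_mono less_max_iff_disj)

lemma bump_minus: "bump r (x - y) = bump r (y - x)"
  by (simp add: bump_def norm_minus_commute)

lemma smooth_log_minus: "smooth_log r (x - y) = smooth_log r (y - x)"
  by (simp add: smooth_log_def norm_minus_commute)

lemma continuous_bump: "continuous_on A (bump r)"
  unfolding bump_def by (auto simp: divide_inverse intro!: continuous_intros)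

lemma continuous_smooth_log: "r > 0 \<Longrightarrow> continuous_on A (smooth_log r)"
  using has_derivative_smooth_log[of r 0]
  by (auto intro!: continuous_at_imp_continuous_on dest: has_derivative_continuous)

text \<open>
  The bump is a function of $\min(|x|, r)$, which is 1-Lipschitz; hence averages against it are
  Lipschitz in the centre.  This replaces gradient estimates for harmonic functions.
\<close>

lemma bump_lipschitz:
  assumes "r > 0"
  shows "\<bar>bump r x - bump r y\<bar> \<le> 4 / (pi * r ^ 3) * norm (x - y)"
proof -
  define m where "m x = min (norm x) r" for x :: complex
  have b: "bump r x = 2 / (pi * r ^ 4) * (r\<^sup>2 - (m x)\<^sup>2)" for x
  proof (cases "norm x \<le> r")
    case True
    then have "(norm x)\<^sup>2 \<le> r\<^sup>2" by (simp add: power_mono)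
    then show ?thesis using True assms
      by (simp add: bump_def m_def field_simps power4_eq_xxxx power2_eq_square)
  next
    case False
    then show ?thesis using assms bump_eq_0[of r x] by (simp add: m_def)
  qed
  have m: "\<bar>m x - m y\<bar> \<le> norm (x - y)" "0 \<le> m x" "m x \<le> r" "0 \<le> m y" "m y \<le> r"
    using assms norm_triangle_ineq3[of x y] by (auto simp: m_def)
  have "bump r x - bump r y = - (2 / (pi * r ^ 4) * ((m x - m y) * (m x + m y)))"
    unfolding b using assms by (simp add: field_simps power2_eq_square)
  then have "\<bar>bump r x - bump r y\<bar> = 2 / (pi * r ^ 4) * \<bar>(m x - m y) * (m x + m y)\<bar>"
    using assms by (simp add: abs_mult)
  also have "\<dots> \<le> 2 / (pi * r ^ 4) * (norm (x - y) * (2 * r))"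
    using m assms by (intro mult_left_mono) (auto simp: abs_mult intro!: mult_mono)
  also have "\<dots> = 4 / (pi * r ^ 3) * norm (x - y)"
    using assms by (simp add: field_simps eval_nat_numeral)
  finally show ?thesis .
qed

lemma smooth_log_lipschitz:
  assumes "r > 0"
  shows "\<bar>smooth_log r x - smooth_log r y\<bar> \<le> 2 / r * norm (x - y)"
proof -
  have "norm (smooth_log r x - smooth_log r y) \<le> 2 / r * norm (x - y)"
  proof (rule differentiable_bound[where S = UNIV])
    fix x :: complex
    show "(smooth_log r has_derivative (\<lambda>h. ell' ((norm x)\<^sup>2 / r\<^sup>2) * (x \<bullet> h) / r\<^sup>2)) (at x within UNIV)"
      using has_derivative_smooth_log[OF assms, of 0 x] by simp
    show "onorm (\<lambda>h. ell' ((norm x)\<^sup>2 / r\<^sup>2) * (x \<bullet> h) / r\<^sup>2) \<le> 2 / r"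
    proof (rule onorm_bound)
      fix h :: complex
      have a: "\<bar>ell' ((norm x)\<^sup>2 / r\<^sup>2)\<bar> * norm x / r\<^sup>2 \<le> 2 / r"
      proof (cases "norm x \<ge> r")
        case True
        then have "1 \<le> (norm x)\<^sup>2 / r\<^sup>2" "norm x > 0" using assms by (auto simp: field_simps power_mono)
        then show ?thesis using True assms
          by (simp add: ell'_def field_simps power2_eq_square)
      next
        case False
        then have "(norm x)\<^sup>2 / r\<^sup>2 < 1" using assms by (simp add: power_strict_mono)
        then have "\<bar>ell' ((norm x)\<^sup>2 / r\<^sup>2)\<bar> \<le> 2" by (simp add: ell'_def)
        then have "\<bar>ell' ((norm x)\<^sup>2 / r\<^sup>2)\<bar> * norm x \<le> 2 * r"
          using False by (intro mult_mono) auto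
        then show ?thesis using assms by (simp add: field_simps power2_eq_square)
      qed
      have "norm (ell' ((norm x)\<^sup>2 / r\<^sup>2) * (x \<bullet> h) / r\<^sup>2) \<le> \<bar>ell' ((norm x)\<^sup>2 / r\<^sup>2)\<bar> * (norm x * norm h) / r\<^sup>2"
        by (auto simp: abs_mult intro!: divide_right_mono mult_left_mono Cauchy_Schwarz_ineq2)
      also have "\<dots> = (\<bar>ell' ((norm x)\<^sup>2 / r\<^sup>2)\<bar> * norm x / r\<^sup>2) * norm h" by simp
      also have "\<dots> \<le> 2 / r * norm h" using a by (rule mult_right_mono) simp
      finally show "norm (ell' ((norm x)\<^sup>2 / r\<^sup>2) * (x \<bullet> h) / r\<^sup>2) \<le> 2 / r * norm h" .
    qed (use assms in simp)
  qed auto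
  then show ?thesis by simp
qed

text \<open>
  The derivative of $\ell(t) - \ln t$ is $-(1-t)^2/t$.
\<close>

lemma ln_less_ell: "0 < t \<Longrightarrow> t < 1 \<Longrightarrow> ln t < ell t"
proof -
  assume t: "0 < t" "t < 1"
  have "\<exists>s>t. s < 1 \<and> (ell 1 - ln 1) - (ell t - ln t) = (1 - t) * (ell' s - 1 / s)"
    using t by (intro MVT2) (auto intro!: derivative_eq_intros DERIV_ell)
  then obtain s where s: "t < s" "s < 1" "- (ell t - ln t) = (1 - t) * (ell' s - 1 / s)"
    by (auto simp: ell_def)
  have "ell' s - 1 / s = - ((1 - s)\<^sup>2 / s)"
    using s t by (simp add: ell'_def field_simps power2_eq_square)
  then have "ell' s - 1 / s < 0" using s t by simp
  then have "(1 - t) * (ell' s - 1 / s) < 0" using t by (simp add: mult_pos_neg)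
  then show ?thesis using s(3) by simp
qed

lemma ln_less_smooth_log: "0 < r \<Longrightarrow> x \<noteq> 0 \<Longrightarrow> norm x < r \<Longrightarrow> ln (norm x) < smooth_log r x"
proof -
  assume a: "0 < r" "x \<noteq> 0" "norm x < r"
  have "ln ((norm x)\<^sup>2 / r\<^sup>2) < ell ((norm x)\<^sup>2 / r\<^sup>2)"
    using a by (intro ln_less_ell) (auto simp: power_strict_mono)
  then show ?thesis using a by (simp add: smooth_log_def ln_div ln_realpow)
qed

lemma ln_le_smooth_log: "0 < r \<Longrightarrow> x \<noteq> 0 \<Longrightarrow> ln (norm x) \<le> smooth_log r x"
  using ln_less_smooth_log[of r x] smooth_log_eq_ln[of r x] by (cases "norm x < r") auto

lemma smooth_log_le_ln_max: "0 < r \<Longrightarrow> smooth_log r x \<le> ln (max r (norm x))"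
proof -
  assume r: "0 < r"
  show ?thesis
  proof (cases "norm x < r")
    case True
    then have t: "(norm x)\<^sup>2 / r\<^sup>2 < 1" using r by (simp add: power_strict_mono)
    have "ell t \<le> 0" if "t < 1" for t
    proof -
      have "0 \<le> (t - 1)\<^sup>2" by simp
      moreover have "ell t = (t - 1) - (t - 1)\<^sup>2 / 2" using that by (simp add: ell_def)
      ultimately show ?thesis using that by linarith
    qed
    then have "ell ((norm x)\<^sup>2 / r\<^sup>2) \<le> 0" using t by blast
    then show ?thesis using True r by (simp add: smooth_log_def ln_realpow max_def)
  qed (use smooth_log_eq_ln[OF r] in \<open>simp add: max_def\<close>)
qed

lemma smooth_log_ge: "0 < r \<Longrightarrow> ln r - 1 \<le> smooth_log r x"
proof -
  assume r: "0 < r"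
  show ?thesis
  proof (cases "norm x < r")
    case True
    define t where "t = (norm x)\<^sup>2 / r\<^sup>2"
    have t: "t < 1" "t \<ge> 0" using r True by (auto simp: power_strict_mono t_def)
    then have "(1 - t)\<^sup>2 \<le> 1\<^sup>2" by (intro power_mono) auto
    then have "ell t \<ge> -2" using t by (simp add: ell_def power2_commute[of t])
    then show ?thesis using True r by (simp add: smooth_log_def ln_realpow t_def)
  next
    case False
    then have "ln r \<le> ln (norm x)" using r by (intro ln_mono) auto
    then show ?thesis using smooth_log_eq_ln[OF r, of x] False by simp
  qed
qed

text \<open>
  With $s=|x|^2$ and $T=r^2$, the derivative in \<open>T\<close> of \<open>2 * smooth_log r x\<close> is $(1-s/T)^2/T$
  for $s \le T$; for $s \ge T$ the value does not depend on \<open>r\<close>.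
\<close>

lemma smooth_log_mono:
  assumes "0 < r" "r \<le> R"
  shows "smooth_log r x \<le> smooth_log R x"
proof -
  define s where "s = (norm x)\<^sup>2"
  define F where "F T = ln T + (s / T - 1) - (s / T - 1)\<^sup>2 / 2" for T
  have mono: "F T \<le> F T'" if "0 < T" "T \<le> T'" for T T'
  proof (rule DERIV_nonneg_imp_nondecreasing[OF that(2)])
    fix u assume "T \<le> u" "u \<le> T'"
    then have u: "u > 0" using that by simp
    have "(F has_real_derivative (1 / u * (1 - s / u)\<^sup>2)) (at u)"
      unfolding F_def using u
      by (auto intro!: derivative_eq_intros simp: field_simps power2_eq_square)
    moreover have "1 / u * (1 - s / u)\<^sup>2 \<ge> 0" using u by simp
    ultimately show "\<exists>y. (F has_real_derivative y) (at u) \<and> 0 \<le> y" by blast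
  qed
  have S: "smooth_log r x = (if r\<^sup>2 \<le> s then ln s else F (r\<^sup>2)) / 2" if "r > 0" for r
  proof -
    have "s / r\<^sup>2 \<ge> 1 \<longleftrightarrow> r\<^sup>2 \<le> s" using that by (simp add: field_simps)
    moreover have "ln (s / r\<^sup>2) + ln (r\<^sup>2) = ln s" if "r\<^sup>2 \<le> s"
    proof -
      have "r\<^sup>2 > 0" using \<open>r > 0\<close> by simp
      then show ?thesis using that by (subst ln_div) auto
    qed
    ultimately show ?thesis by (auto simp: smooth_log_def ell_def F_def s_def)
  qed
  have sq: "r\<^sup>2 \<le> R\<^sup>2" using assms by (intro power_mono) auto
  have Fs: "ln s = F s" if "s > 0" using that by (simp add: F_def)
  have r2: "0 < r\<^sup>2" using assms by simp
  have "R > 0" using assms by simp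
  have "(if r\<^sup>2 \<le> s then ln s else F (r\<^sup>2)) \<le> (if R\<^sup>2 \<le> s then ln s else F (R\<^sup>2))"
  proof (cases "r\<^sup>2 \<le> s")
    case True
    then have "s > 0" using r2 by linarith
    then show ?thesis using True mono[of s "R\<^sup>2"] Fs by auto
  next
    case False
    then show ?thesis using sq mono[OF r2 sq] by auto
  qed
  then show ?thesis using S[OF \<open>0 < r\<close>] S[OF \<open>R > 0\<close>] by simp
qed



section \<open>Averages and Green's identity\<close>

definition avg :: "real \<Rightarrow> (complex \<Rightarrow> real) \<Rightarrow> complex \<Rightarrow> real" where
  "avg r f z = (LINT x|lborel. bump r (x - z) * f x)"

lemma integral_translate:
  fixes f :: "complex \<Rightarrow> real"
  assumes "f \<in> borel_measurable borel"
  shows "(LINT x|lborel. f (x + c)) = (LINT x|lborel. f x)"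
proof -
  have "(LINT x|lborel. f x) = (LINT x|distr lborel borel ((+) c). f x)"
    by (simp add: lborel_distr_plus)
  also have "\<dots> = (LINT x|lborel. f (c + x))"
    using assms by (subst integral_distr) auto
  finally show ?thesis by (simp add: add.commute)
qed

lemma integrable_compact_support:
  fixes h :: "complex \<Rightarrow> real"
  assumes "continuous_on UNIV h" "\<And>x. norm x > M \<Longrightarrow> h x = 0"
  shows "integrable lborel h"
proof -
  have "integrable lborel (\<lambda>x. indicator (cball 0 M) x *\<^sub>R h x)"
    by (rule borel_integrable_compact) (auto intro: continuous_on_subset[OF assms(1)])
  moreover have "(\<lambda>x. indicator (cball 0 M) x *\<^sub>R h x) = h"
    using assms(2) by (force simp: indicator_def fun_eq_iff)
  ultimately show ?thesis by simp
qed

lemma has_derivative_line: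
  assumes "\<forall>x. g differentiable at x"
  shows "((\<lambda>t. g (x + t *\<^sub>R b)) has_real_derivative partial b g (x + t *\<^sub>R b)) (at t)"
proof -
  have g: "(g has_derivative frechet_derivative g (at (x + t *\<^sub>R b))) (at (x + t *\<^sub>R b))"
    using assms frechet_derivative_works by blast
  have l: "linear (frechet_derivative g (at (x + t *\<^sub>R b)))"
    using g has_derivative_linear by blast
  have "((\<lambda>t. g (x + t *\<^sub>R b)) has_derivative (\<lambda>s. frechet_derivative g (at (x + t *\<^sub>R b)) (s *\<^sub>R b))) (at t)"
    by (rule has_derivative_compose[where g = g and f = "\<lambda>t. x + t *\<^sub>R b", OF _ g]) (auto intro!: derivative_eq_intros)
  then show ?thesis
    by (simp add: has_field_derivative_def partial_def linear_scale[OF l] mult.commute[of _ "frechet_derivative g _ b"])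
qed

text \<open>
  Difference quotients of \<open>g\<close> have integral 0 by translation invariance, and they converge
  boundedly to the partial derivative.
\<close>

lemma integral_partial_eq_0:
  fixes g :: "complex \<Rightarrow> real"
  assumes diff: "\<forall>x. g differentiable at x" and cont: "continuous_on UNIV (partial b g)"
    and supp: "\<And>x. norm x > M \<Longrightarrow> g x = 0"
  shows "(LINT x|lborel. partial b g x) = 0"
proof -
  define f where "f n x = (g (x + (1 / real (Suc n)) *\<^sub>R b) - g x) * real (Suc n)" for n x
  have gc: "continuous_on UNIV g"
    using diff by (meson continuous_at_imp_continuous_on differentiable_imp_continuous_within)
  have gm: "g \<in> borel_measurable borel"
    using gc by (rule borel_measurable_continuous_onI)
  have gi: "integrable lborel g"
    using gc supp by (rule integrable_compact_support)
  have gi': "integrable lborel (\<lambda>x. g (x + c))" for c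
  proof (rule integrable_compact_support[where M = "M + norm c"])
    show "continuous_on UNIV (\<lambda>x. g (x + c))"
      by (auto intro!: continuous_intros continuous_on_compose2[OF gc])
    show "M + norm c < norm x \<Longrightarrow> g (x + c) = 0" for x
      using norm_triangle_ineq4[of "x + c" c] by (intro supp) simp
  qed
  have fint: "(LINT x|lborel. f n x) = 0" for n
    using gi gi' by (simp add: f_def integral_translate[OF gm])
  obtain B where B: "\<And>x. norm x \<le> M + 2 * norm b \<Longrightarrow> \<bar>partial b g x\<bar> \<le> B"
  proof -
    have "compact (partial b g ` cball 0 (M + 2 * norm b))"
      by (intro compact_continuous_image continuous_on_subset[OF cont]) auto
    then have "bounded (partial b g ` cball 0 (M + 2 * norm b))" by (rule compact_imp_bounded)
    then obtain a where "\<forall>x\<in>cball 0 (M + 2 * norm b). \<bar>partial b g x\<bar> \<le> a"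
      by (auto simp: bounded_iff)
    then show ?thesis by (intro that[of a]) auto
  qed
  have bound: "\<bar>f n x\<bar> \<le> indicator (cball 0 (M + norm b)) x * B" for n x
  proof (cases "norm x \<le> M + norm b")
    case True
    define h where "h = 1 / real (Suc n)"
    have h: "0 < h" "h \<le> 1" by (auto simp: h_def)
    have "\<exists>s>0. s < h \<and> g (x + h *\<^sub>R b) - g (x + 0 *\<^sub>R b) = (h - 0) * partial b g (x + s *\<^sub>R b)"
      using h by (intro MVT2) (auto intro: has_derivative_line[OF diff])
    then obtain s where s: "0 < s" "s < h" "g (x + h *\<^sub>R b) - g x = h * partial b g (x + s *\<^sub>R b)"
      by auto
    have "s \<le> 1" using s h by simp
    then have "norm (s *\<^sub>R b) \<le> 1 * norm b"
      using s unfolding norm_scaleR by (intro mult_right_mono) auto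
    then have "norm (x + s *\<^sub>R b) \<le> M + 2 * norm b"
      using True norm_triangle_ineq[of x "s *\<^sub>R b"] by linarith
    then have "\<bar>partial b g (x + s *\<^sub>R b)\<bar> \<le> B" by (rule B)
    moreover have "f n x = partial b g (x + s *\<^sub>R b)"
      using s(3) by (simp add: f_def h_def field_simps)
    ultimately show ?thesis using True by simp
  next
    case False
    have "norm ((1 / real (Suc n)) *\<^sub>R b) \<le> 1 * norm b"
      unfolding norm_scaleR by (rule mult_right_mono) auto
    then have "norm (x + (1 / real (Suc n)) *\<^sub>R b) > M"
      using False norm_triangle_ineq4[of "x + (1 / real (Suc n)) *\<^sub>R b" "(1 / real (Suc n)) *\<^sub>R b"]
      by simp
    moreover have "norm x > M" using False norm_ge_zero[of b] by linarith
    ultimately show ?thesis using False by (simp add: f_def supp)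
  qed
  have lim: "(\<lambda>n. f n x) \<longlonglongrightarrow> partial b g x" for x
  proof -
    have "((\<lambda>t. g (x + t *\<^sub>R b)) has_real_derivative partial b g (x + 0 *\<^sub>R b)) (at 0)"
      by (rule has_derivative_line[OF diff])
    then have "((\<lambda>h. (g (x + h *\<^sub>R b) - g x) / h) \<longlongrightarrow> partial b g x) (at 0)"
      by (simp add: DERIV_def)
    moreover have "filterlim (\<lambda>n. 1 / real (Suc n)) (at 0) sequentially"
      using LIMSEQ_inverse_real_of_nat by (auto simp: filterlim_at inverse_eq_divide)
    ultimately have "((\<lambda>n. (g (x + (1 / real (Suc n)) *\<^sub>R b) - g x) / (1 / real (Suc n))) \<longlongrightarrow> partial b g x) sequentially"
      by (rule filterlim_compose)
    then show ?thesis by (simp add: f_def)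
  qed
  have "(\<lambda>n. LINT x|lborel. f n x) \<longlonglongrightarrow> (LINT x|lborel. partial b g x)"
  proof (rule integral_dominated_convergence)
    show "partial b g \<in> borel_measurable lborel"
      using borel_measurable_continuous_onI[OF cont] by simp
    show "f n \<in> borel_measurable lborel" for n
      unfolding f_def using gm by simp
    show "integrable lborel (\<lambda>x. indicator (cball 0 (M + norm b)) x * B)"
      by (auto intro!: emeasure_compact_finite integrable_mult_left)
  qed (use lim bound in auto)
  then show ?thesis using fint by (simp add: LIMSEQ_const_iff)
qed

lemma partial_eq_0_outside:
  assumes "\<And>x. norm x > M \<Longrightarrow> \<phi> x = 0" "norm x > M"
  shows "partial b \<phi> x = 0"
proof -
  have "eventually (\<lambda>y. norm y > M) (nhds x)"
    using assms(2) by (intro order_tendstoD[OF tendsto_norm[OF filterlim_ident]])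
  then have "eventually (\<lambda>y. \<phi> y = 0) (nhds x)" by eventually_elim (rule assms(1))
  then have ev: "eventually (\<lambda>y. 0 = \<phi> y) (at x)"
    by (auto simp: eventually_at_filter elim: eventually_mono)
  have "(\<phi> has_derivative (\<lambda>h. 0)) (at x)"
    by (rule has_derivative_transform_eventually[OF has_derivative_const[of 0] ev])
      (use assms in simp_all)
  then have "frechet_derivative \<phi> (at x) = (\<lambda>h. 0)" by (simp add: frechet_derivative_at[symmetric])
  then show ?thesis by (simp add: partial_def)
qed

lemma twice_cont_diff_continuous: "twice_cont_diff f \<Longrightarrow> continuous_on A f"
  unfolding twice_cont_diff_def
  by (meson continuous_at_imp_continuous_on differentiable_imp_continuous_within)

lemma laplacian_continuous: "twice_cont_diff f \<Longrightarrow> continuous_on A (laplacian f)"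
  unfolding twice_cont_diff_def laplacian_def[abs_def]
  by (intro continuous_intros) (blast intro: continuous_on_subset)

text \<open>
  $f\,\partial_b\phi - \phi\,\partial_b f$ has compact support, so its derivative in direction
  \<open>b\<close> integrates to 0; summing over \<open>b\<close> gives the identity.
\<close>

lemma Green_identity:
  assumes f: "twice_cont_diff f" and p: "twice_cont_diff \<phi>" and supp: "\<And>x. norm x > M \<Longrightarrow> \<phi> x = 0"
  shows "(LINT x|lborel. f x * laplacian \<phi> x) = (LINT x|lborel. \<phi> x * laplacian f x)"
proof -
  have fd: "(f has_derivative frechet_derivative f (at x)) (at x)" for x
    using f frechet_derivative_works by (auto simp: twice_cont_diff_def)
  have pd: "(\<phi> has_derivative frechet_derivative \<phi> (at x)) (at x)" for x
    using p frechet_derivative_works by (auto simp: twice_cont_diff_def)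
  note fc = twice_cont_diff_continuous[OF f] and pc = twice_cont_diff_continuous[OF p]
  define G where "G b x = f x * partial b (partial b \<phi>) x - \<phi> x * partial b (partial b f) x" for b x
  have *: "integrable lborel (G b) \<and> (LINT x|lborel. G b x) = 0" if b: "b \<in> Basis" for b
  proof -
    define g where "g x = f x * partial b \<phi> x - \<phi> x * partial b f x" for x
    have fb: "(partial b f has_derivative frechet_derivative (partial b f) (at x)) (at x)" for x
      using f b frechet_derivative_works[of "partial b f"] by (auto simp: twice_cont_diff_def)
    have pb: "(partial b \<phi> has_derivative frechet_derivative (partial b \<phi>) (at x)) (at x)" for x
      using p b frechet_derivative_works[of "partial b \<phi>"] by (auto simp: twice_cont_diff_def)
    have gd: "(g has_derivative (\<lambda>h. (f x * frechet_derivative (partial b \<phi>) (at x) h + frechet_derivative f (at x) h * partial b \<phi> x)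
       - (\<phi> x * frechet_derivative (partial b f) (at x) h + frechet_derivative \<phi> (at x) h * partial b f x))) (at x)" for x
      unfolding g_def by (intro has_derivative_diff has_derivative_mult fd pd fb pb)
    have gG: "partial b g = G b"
    proof
      fix x
      show "partial b g x = G b x"
        using fun_cong[OF frechet_derivative_at[OF gd], of x b]
        by (simp add: partial_def[of b g] G_def partial_def[of b "partial b f"] partial_def[of b "partial b \<phi>"]
          partial_def[of b f] partial_def[of b \<phi>])
    qed
    have cG: "continuous_on UNIV (G b)"
      unfolding G_def using f p b by (auto simp: twice_cont_diff_def intro!: continuous_intros fc pc)
    have pz: "norm x > M \<Longrightarrow> partial b \<phi> x = 0" for x
      by (rule partial_eq_0_outside[OF supp])
    have "integrable lborel (G b)"
      by (rule integrable_compact_support[OF cG, of M])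
         (auto simp: G_def supp partial_eq_0_outside[OF pz])
    moreover have "(LINT x|lborel. partial b g x) = 0"
    proof (rule integral_partial_eq_0)
      show "\<forall>x. g differentiable at x" using gd differentiable_def by blast
      show "continuous_on UNIV (partial b g)" using cG gG by simp
      show "norm x > M \<Longrightarrow> g x = 0" for x by (simp add: g_def pz supp)
    qed
    ultimately show ?thesis by (simp add: gG)
  qed
  have "(LINT x|lborel. (\<Sum>b\<in>Basis. G b x)) = 0"
    using * by (subst Bochner_Integration.integral_sum) auto
  then have 0: "(LINT x|lborel. f x * laplacian \<phi> x - \<phi> x * laplacian f x) = 0"
    by (simp add: G_def laplacian_def sum_subtractf sum_distrib_left)
  have lz: "norm x > M \<Longrightarrow> laplacian \<phi> x = 0" for x
    unfolding laplacian_def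
    by (intro sum.neutral ballI partial_eq_0_outside[of M] ) (auto intro: partial_eq_0_outside[of M] supp)
  have "integrable lborel (\<lambda>x. f x * laplacian \<phi> x)" "integrable lborel (\<lambda>x. \<phi> x * laplacian f x)"
    by (rule integrable_compact_support[of _ M], intro continuous_intros fc pc laplacian_continuous f p, simp add: lz supp)+
  then show ?thesis using 0 by simp
qed

lemma partial_diff:
  assumes "f differentiable at x" "g differentiable at x"
  shows "partial b (\<lambda>x. f x - g x) x = partial b f x - partial b g x"
proof -
  have "((\<lambda>x. f x - g x) has_derivative (\<lambda>h. frechet_derivative f (at x) h - frechet_derivative g (at x) h)) (at x)"
    using assms by (intro has_derivative_diff) (auto simp: frechet_derivative_works[symmetric])
  from fun_cong[OF frechet_derivative_at[OF this], of b] show ?thesis by (simp add: partial_def)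
qed

lemma
  assumes f: "twice_cont_diff f" and g: "twice_cont_diff g"
  shows twice_cont_diff_diff: "twice_cont_diff (\<lambda>x. f x - g x)"
    and laplacian_diff: "laplacian (\<lambda>x. f x - g x) x = laplacian f x - laplacian g x"
proof -
  have 1: "partial b (\<lambda>x. f x - g x) = (\<lambda>x. partial b f x - partial b g x)" for b
    using f g by (auto simp: twice_cont_diff_def partial_diff)
  have 2: "partial c (\<lambda>x. partial b f x - partial b g x) = (\<lambda>x. partial c (partial b f) x - partial c (partial b g) x)"
    if "b \<in> Basis" for b c
    using f g that by (auto simp: twice_cont_diff_def partial_diff)
  show "twice_cont_diff (\<lambda>x. f x - g x)"
    using f g unfolding twice_cont_diff_def 1 by (auto simp: 2 intro!: continuous_intros)
  show "laplacian (\<lambda>x. f x - g x) x = laplacian f x - laplacian g x"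
    by (simp add: laplacian_def 1 2 sum_subtractf)
qed

text \<open>
  The region below the cap is sliced horizontally: the slice at height \<open>t\<close> is a disc of area
  $\pi r^2 (1-t)$.
\<close>

lemma nn_integral_cap:
  assumes "r > 0"
  shows "(\<integral>\<^sup>+x. ennreal (max 0 (1 - (norm (x::complex))\<^sup>2 / r\<^sup>2)) \<partial>lborel) = ennreal (pi * r\<^sup>2 / 2)"
proof -
  define S where "S = {(x::complex, t::real). 0 \<le> t \<and> t \<le> 1 - (norm x)\<^sup>2 / r\<^sup>2}"
  have "closed S" unfolding S_def case_prod_beta divide_inverse
    by (intro closed_Collect_conj closed_Collect_le continuous_intros)
  then have [measurable]: "S \<in> sets (borel \<Otimes>\<^sub>M borel)" by (metis borel_prod borel_closed)
  have a: "ennreal (max 0 (1 - (norm x)\<^sup>2 / r\<^sup>2)) = (\<integral>\<^sup>+t. indicator S (x, t) \<partial>lborel)" for x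
  proof -
    have "(\<lambda>t. indicator S (x, t) :: ennreal) = indicator {0 .. 1 - (norm x)\<^sup>2 / r\<^sup>2}"
      by (auto simp: S_def fun_eq_iff indicator_def)
    then have "(\<integral>\<^sup>+t. indicator S (x, t) \<partial>lborel) = (\<integral>\<^sup>+t. indicator {0 .. 1 - (norm x)\<^sup>2 / r\<^sup>2} t \<partial>lborel)"
      by (simp only:)
    then show ?thesis by (auto simp: max_def)
  qed
  have b: "(\<integral>\<^sup>+x. indicator S (x, t) \<partial>lborel) = ennreal (pi * r\<^sup>2 * (1 - t)) * indicator {0..1} t" for t
  proof (cases "0 \<le> t \<and> t \<le> 1")
    case True
    have "(\<lambda>x. indicator S (x, t) :: ennreal) = indicator (cball 0 (r * sqrt (1 - t)))"
    proof
      fix x :: complex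
      have "t \<le> 1 - (norm x)\<^sup>2 / r\<^sup>2 \<longleftrightarrow> (norm x)\<^sup>2 \<le> r\<^sup>2 * (1 - t)"
        using assms by (auto simp: field_simps)
      also have "\<dots> \<longleftrightarrow> (norm x)\<^sup>2 \<le> (r * sqrt (1 - t))\<^sup>2"
        using True by (simp add: power_mult_distrib)
      also have "\<dots> \<longleftrightarrow> norm x \<le> r * sqrt (1 - t)"
        using True assms by (subst power2_le_iff_abs_le) auto
      finally show "indicator S (x, t) = (indicator (cball 0 (r * sqrt (1 - t))) x :: ennreal)"
        using True by (auto simp: S_def indicator_def)
    qed
    then show ?thesis using True assms
      by (simp add: emeasure_cball unit_ball_vol_2 power_mult_distrib mult.assoc)
  next
    case False
    then have "(\<lambda>x. indicator S (x, t)) = (\<lambda>x. 0 :: ennreal)"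
      using assms by (auto simp: S_def fun_eq_iff indicator_def)
         (smt (verit) divide_nonneg_nonneg zero_le_power2)
    then show ?thesis using False by auto
  qed
  have "(\<integral>\<^sup>+x. ennreal (max 0 (1 - (norm (x::complex))\<^sup>2 / r\<^sup>2)) \<partial>lborel)
     = (\<integral>\<^sup>+t. (\<integral>\<^sup>+x. indicator S (x, t) \<partial>lborel) \<partial>lborel)"
    unfolding a by (subst lborel_pair.Fubini') auto
  also have "\<dots> = (\<integral>\<^sup>+t. ennreal (pi * r\<^sup>2 * (1 - t)) * indicator {0..1} t \<partial>lborel)"
    unfolding b ..
  also have "\<dots> = ennreal (pi * r\<^sup>2 * (1 - 1 / 2) - 0)"
    by (subst nn_integral_FTC_Icc[where F = "\<lambda>t. pi * r\<^sup>2 * (t - t\<^sup>2 / 2)"])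
       (auto intro!: derivative_eq_intros continuous_intros mult_left_le_one_le simp: field_simps)
  finally show ?thesis by simp
qed

lemma integral_bump: "r > 0 \<Longrightarrow> (LINT x|lborel. bump r (x - z)) = 1"
proof -
  assume r: "r > 0"
  have m: "bump r \<in> borel_measurable borel"
    by (rule borel_measurable_continuous_onI[OF continuous_bump])
  have "(LINT x|lborel. bump r (x - z)) = (LINT x|lborel. bump r x)"
    using integral_translate[OF m, of "- z"] by simp
  also have "\<dots> = 2 / (pi * r\<^sup>2) * (LINT x|lborel. max 0 (1 - (norm (x::complex))\<^sup>2 / r\<^sup>2))"
    by (simp add: bump_def)
  also have "(LINT x|lborel. max 0 (1 - (norm (x::complex))\<^sup>2 / r\<^sup>2)) = pi * r\<^sup>2 / 2"
    by (subst integral_eq_nn_integral) (auto simp: nn_integral_cap[OF r])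
  finally show ?thesis using r by simp
qed

lemma integrable_bump_mult':
  assumes "r > 0" "set_integrable lborel (cball z r) f"
  shows "integrable lborel (\<lambda>x. bump r (x - z) * f x)"
proof -
  have eq: "(\<lambda>x. bump r (x - z) * f x) = (\<lambda>x. bump r (x - z) * (indicator (cball z r) x *\<^sub>R f x))"
    using bump_eq_0[OF assms(1)] by (auto simp: fun_eq_iff indicator_def dist_norm norm_minus_commute)
  have m: "bump r \<in> borel_measurable borel"
    by (rule borel_measurable_continuous_onI[OF continuous_bump])
  show ?thesis unfolding eq
  proof (rule Bochner_Integration.integrable_bound)
    show "integrable lborel (\<lambda>x. 2 / (pi * r\<^sup>2) * (indicator (cball z r) x *\<^sub>R f x))"
      using assms(2) unfolding set_integrable_def by (rule integrable_mult_right)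
    show "(\<lambda>x. bump r (x - z) * (indicator (cball z r) x *\<^sub>R f x)) \<in> borel_measurable lborel"
      using m borel_measurable_integrable[OF assms(2)[unfolded set_integrable_def]] by measurable
    have "bump r (x - z) \<le> 2 / (pi * r\<^sup>2) * 1" for x
      unfolding bump_def using assms(1) by (intro mult_left_mono) auto
    then have le: "\<bar>bump r (x - z)\<bar> \<le> 2 / (pi * r\<^sup>2)" for x
      using bump_nonneg[OF assms(1)] by simp
    show "AE x in lborel. norm (bump r (x - z) * (indicator (cball z r) x *\<^sub>R f x)) \<le> norm (2 / (pi * r\<^sup>2) * (indicator (cball z r) x *\<^sub>R f x))"
    proof (rule AE_I2)
      fix x
      have "\<bar>bump r (x - z)\<bar> * \<bar>f x\<bar> \<le> 2 / (pi * r\<^sup>2) * \<bar>f x\<bar>"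
        by (rule mult_right_mono[OF le]) simp
      then show "norm (bump r (x - z) * (indicator (cball z r) x *\<^sub>R f x)) \<le> norm (2 / (pi * r\<^sup>2) * (indicator (cball z r) x *\<^sub>R f x))"
        using assms(1) by (auto simp: indicator_def abs_mult)
    qed
  qed
qed

lemma set_integrable_continuous_cball:
  "continuous_on (cball z r) f \<Longrightarrow> set_integrable lborel (cball z r) (f :: complex \<Rightarrow> real)"
  unfolding set_integrable_def by (rule borel_integrable_compact) auto

lemmas integrable_bump_mult = integrable_bump_mult'[OF _ set_integrable_continuous_cball]

lemma avg_const: "r > 0 \<Longrightarrow> avg r (\<lambda>_. c) z = c"
  by (simp add: avg_def integral_bump)

lemma avg_cmult: "avg r (\<lambda>x. c * f x) z = c * avg r f z"
  unfolding avg_def by (simp add: mult.left_commute[of _ c])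

lemma avg_add:
  assumes "r > 0" "set_integrable lborel (cball z r) f" "set_integrable lborel (cball z r) g"
  shows "avg r (\<lambda>x. f x + g x) z = avg r f z + avg r g z"
  unfolding avg_def using integrable_bump_mult'[OF assms(1,2)] integrable_bump_mult'[OF assms(1,3)]
  by (simp add: distrib_left)

lemma avg_cong:
  assumes "r > 0" "\<And>x. x \<in> ball z r \<Longrightarrow> f x = g x"
  shows "avg r f z = avg r g z"
  unfolding avg_def using assms bump_eq_0[OF assms(1)]
  by (intro Bochner_Integration.integral_cong refl) (force simp: dist_norm norm_minus_commute)

lemma avg_mono:
  assumes "r > 0" "set_integrable lborel (cball z r) f" "set_integrable lborel (cball z r) g"
    "\<And>x. x \<in> cball z r \<Longrightarrow> x \<noteq> a \<Longrightarrow> f x \<le> g x"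
  shows "avg r f z \<le> avg r g z"
  unfolding avg_def
proof (rule integral_mono_AE)
  show "AE x in lborel. bump r (x - z) * f x \<le> bump r (x - z) * g x"
    using AE_lborel_singleton[of a]
  proof eventually_elim
    case (elim x)
    show ?case
    proof (cases "x \<in> cball z r")
      case True
      then show ?thesis using assms elim bump_nonneg[OF assms(1)] by (intro mult_left_mono) auto
    next
      case False
      then show ?thesis using bump_eq_0[OF assms(1), of "x - z"] by (simp add: dist_norm norm_minus_commute)
    qed
  qed
qed (use assms integrable_bump_mult' in auto)

lemma avg_near:
  assumes "r > 0" "set_integrable lborel (cball z r) f" "\<And>x. x \<in> cball z r \<Longrightarrow> \<bar>f x - c\<bar> \<le> e"
  shows "\<bar>avg r f z - c\<bar> \<le> e"
proof -
  have c: "set_integrable lborel (cball z r) (\<lambda>x. d)" for d :: real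
    by (intro set_integrable_continuous_cball continuous_intros)
  have "avg r f z \<le> avg r (\<lambda>x. c + e) z" "avg r (\<lambda>x. c - e) z \<le> avg r f z"
    using assms(3) by (intro avg_mono[where a = 0] assms c, force)+
  then show ?thesis by (simp add: avg_const[OF assms(1)])
qed

text \<open>
  Green's identity for a smoothed logarithm at \<open>y\<close> and the difference of two smoothed logarithms
  at \<open>z\<close>, whose support is the disc of radius \<open>R\<close> about \<open>z\<close>.
\<close>

lemma avg_smooth_log_diff:
  assumes "0 < r" "r < R" "0 < s"
  shows "avg R (\<lambda>x. smooth_log s (x - y)) z - avg r (\<lambda>x. smooth_log s (x - y)) z
       = (LINT x|lborel. (smooth_log R (x - z) - smooth_log r (x - z)) * bump s (x - y))"
proof -
  let ?f = "\<lambda>x::complex. smooth_log s (x - y)"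
  let ?p = "\<lambda>x::complex. smooth_log R (x - z) - smooth_log r (x - z)"
  have R: "R > 0" using assms by simp
  note t = twice_cont_diff_smooth_log[OF R, of z] twice_cont_diff_smooth_log[OF assms(1), of z]
  have "(LINT x|lborel. ?f x * laplacian ?p x) = (LINT x|lborel. ?p x * laplacian ?f x)"
  proof (rule Green_identity[where M = "norm z + R"])
    show "twice_cont_diff ?f" by (rule twice_cont_diff_smooth_log[OF assms(3)])
    show "twice_cont_diff ?p" by (rule twice_cont_diff_diff[OF t])
    fix x :: complex assume "norm x > norm z + R"
    then have "R \<le> norm (x - z)" using norm_triangle_ineq2[of x z] by linarith
    then show "?p x = 0" using assms R by (simp add: smooth_log_eq_ln)
  qed
  moreover have "?f x * laplacian ?p x = 2 * pi * (bump R (x - z) * ?f x - bump r (x - z) * ?f x)" for x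
    by (simp add: laplacian_diff[OF t] laplacian_smooth_log R assms algebra_simps)
  moreover have "?p x * laplacian ?f x = 2 * pi * (?p x * bump s (x - y))" for x
    by (simp add: laplacian_smooth_log assms)
  moreover have "integrable lborel (\<lambda>x. bump R (x - z) * ?f x)" "integrable lborel (\<lambda>x. bump r (x - z) * ?f x)"
    by (intro integrable_bump_mult R assms continuous_on_compose2[OF continuous_smooth_log[OF assms(3), of UNIV]] continuous_intros; simp)+
  ultimately show ?thesis unfolding avg_def by simp
qed

lemma avg_limit:
  fixes f :: "complex \<Rightarrow> real"
  assumes "continuous_on (cball z R) f" "R > 0" "e > 0"
  shows "\<exists>d>0. \<forall>r. 0 < r \<and> r < d \<longrightarrow> \<bar>avg r f z - f z\<bar> \<le> e"
proof -
  have "\<exists>d>0. \<forall>x\<in>cball z R. dist x z < d \<longrightarrow> dist (f x) (f z) < e"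
    using assms by (auto simp: continuous_on_iff)
  then obtain d where d: "d > 0" "\<And>x. x \<in> cball z R \<Longrightarrow> dist x z < d \<Longrightarrow> dist (f x) (f z) < e" by blast
  show ?thesis
  proof (intro exI[of _ "min d R"] conjI allI impI)
    fix r assume r: "0 < r \<and> r < min d R"
    then have sub: "cball z r \<subseteq> cball z R" by auto
    show "\<bar>avg r f z - f z\<bar> \<le> e"
    proof (rule avg_near)
      show "set_integrable lborel (cball z r) f"
        by (rule set_integrable_continuous_cball[OF continuous_on_subset[OF assms(1) sub]])
      fix x assume "x \<in> cball z r"
      then show "\<bar>f x - f z\<bar> \<le> e" using d(2)[of x] r by (force simp: dist_real_def dist_commute)
    qed (use r in auto)
  qed (use d assms in auto)
qed

text \<open>
  The integral in the preceding identity is nonnegative; as the inner radius tends to 0 the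
  corresponding average tends to the value at the centre.
\<close>

lemma smooth_log_le_avg:
  assumes "0 < R" "0 < s"
  shows "smooth_log s (z - y) \<le> avg R (\<lambda>x. smooth_log s (x - y)) z"
proof (rule field_le_epsilon)
  fix e :: real assume e: "e > 0"
  let ?f = "\<lambda>x. smooth_log s (x - y)"
  have c: "continuous_on (cball z R) ?f"
    by (intro continuous_on_compose2[OF continuous_smooth_log[OF assms(2), of UNIV]] continuous_intros) auto
  from avg_limit[OF c assms(1) e] obtain d where d: "d > 0" "\<And>r. 0 < r \<Longrightarrow> r < d \<Longrightarrow> \<bar>avg r ?f z - ?f z\<bar> \<le> e"
    by blast
  define r where "r = min d R / 2"
  have r: "0 < r" "r < d" "r < R" using d assms by (auto simp: r_def)
  have "0 \<le> (LINT x|lborel. (smooth_log R (x - z) - smooth_log r (x - z)) * bump s (x - y))"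
    using smooth_log_mono[of r R] r bump_nonneg[OF assms(2)]
    by (intro Bochner_Integration.integral_nonneg mult_nonneg_nonneg) auto
  then show "smooth_log s (z - y) \<le> avg R ?f z + e"
    using avg_smooth_log_diff[OF r(1,3) assms(2), of y z] d(2)[OF r(1,2)] by linarith
qed

text \<open>
  Smoothing \<open>ln\<close> inside a small disc about \<open>y\<close> does not change it on the disc of
  radius \<open>R\<close>, and then the integral in the preceding identity vanishes because the two supports
  are disjoint.
\<close>

lemma avg_ln:
  assumes "0 < R" "R < norm (z - y)"
  shows "avg R (\<lambda>x. ln (norm (x - y))) z = ln (norm (z - y))"
proof -
  define s where "s = norm (z - y) - R"
  have s: "s > 0" using assms by (simp add: s_def)
  let ?f = "\<lambda>x. smooth_log s (x - y)"
  have far: "s \<le> norm (x - y)" if "x \<in> cball z R" for x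
    using that norm_triangle_ineq[of "z - x" "x - y"] by (simp add: s_def dist_norm)
  have c: "continuous_on (cball z R) ?f"
    by (intro continuous_on_compose2[OF continuous_smooth_log[OF s, of UNIV]] continuous_intros) auto
  have "\<bar>avg R ?f z - ?f z\<bar> \<le> e" if e: "e > 0" for e
  proof -
    from avg_limit[OF c assms(1) e] obtain d where d: "d > 0" "\<And>r. 0 < r \<Longrightarrow> r < d \<Longrightarrow> \<bar>avg r ?f z - ?f z\<bar> \<le> e"
      by blast
    define r where "r = min d R / 2"
    have r: "0 < r" "r < d" "r < R" using d assms by (auto simp: r_def)
    have 0: "(smooth_log R (x - z) - smooth_log r (x - z)) * bump s (x - y) = 0" for x
    proof (cases "x \<in> cball z R")
      case True
      then show ?thesis using bump_eq_0[OF s far[OF True]] by simp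
    next
      case False
      then have "R \<le> norm (x - z)" by (simp add: dist_norm norm_minus_commute)
      then show ?thesis using r assms(1) smooth_log_eq_ln[of R "x - z"] smooth_log_eq_ln[of r "x - z"] by simp
    qed
    have "(LINT x|lborel. (smooth_log R (x - z) - smooth_log r (x - z)) * bump s (x - y)) = (LINT x|(lborel::complex measure). 0)"
      by (rule Bochner_Integration.integral_cong[OF refl 0])
    then have "(LINT x|lborel. (smooth_log R (x - z) - smooth_log r (x - z)) * bump s (x - y)) = 0"
      by simp
    then show ?thesis using avg_smooth_log_diff[OF r(1,3) s, of y z] d(2)[OF r(1,2)] by linarith
  qed
  then have "\<bar>avg R ?f z - ?f z\<bar> \<le> 0"
    by (rule field_le_epsilon) simp
  then have "avg R ?f z = ?f z" by simp
  moreover have "?f z = ln (norm (z - y))" using far[of z] assms by (intro smooth_log_eq_ln s) auto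
  moreover have "avg R ?f z = avg R (\<lambda>x. ln (norm (x - y))) z"
  proof (rule avg_cong[OF assms(1)])
    fix x assume "x \<in> ball z R"
    then have "s \<le> norm (x - y)" using far[of x] by simp
    then show "smooth_log s (x - y) = ln (norm (x - y))" by (rule smooth_log_eq_ln[OF s])
  qed
  ultimately show ?thesis by simp
qed



section \<open>Harmonic and subharmonic functions\<close>

text \<open>
  Mean value properties with respect to the bumps describe the usual classes of continuous subharmonic
  and harmonic functions without derivatives, and they pass at once to sums, potentials and rescaled
  functions.
\<close>

definition subharmonic :: "complex set \<Rightarrow> (complex \<Rightarrow> real) \<Rightarrow> bool" where
  "subharmonic D f \<longleftrightarrow> continuous_on D f \<and> (\<forall>z r. 0 < r \<longrightarrow> cball z r \<subseteq> D \<longrightarrow> f z \<le> avg r f z)"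

definition harmonic :: "complex set \<Rightarrow> (complex \<Rightarrow> real) \<Rightarrow> bool" where
  "harmonic D f \<longleftrightarrow> continuous_on D f \<and> (\<forall>z r. 0 < r \<longrightarrow> cball z r \<subseteq> D \<longrightarrow> avg r f z = f z)"

lemma set_integrable_cball: "continuous_on D f \<Longrightarrow> cball z r \<subseteq> D \<Longrightarrow> set_integrable lborel (cball z r) (f :: complex \<Rightarrow> real)"
  by (rule set_integrable_continuous_cball[OF continuous_on_subset])

lemma harmonic_imp_subharmonic: "harmonic D f \<Longrightarrow> subharmonic D f"
  by (simp add: harmonic_def subharmonic_def)

lemma harmonic_subset: "harmonic D f \<Longrightarrow> D' \<subseteq> D \<Longrightarrow> harmonic D' f"
  unfolding harmonic_def by (blast intro: continuous_on_subset)

lemma subharmonic_subset: "subharmonic D f \<Longrightarrow> D' \<subseteq> D \<Longrightarrow> subharmonic D' f"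
  unfolding subharmonic_def by (blast intro: continuous_on_subset)

lemma harmonic_add: "harmonic D f \<Longrightarrow> harmonic D g \<Longrightarrow> harmonic D (\<lambda>x. f x + g x)"
  unfolding harmonic_def by (auto intro!: continuous_intros simp: avg_add set_integrable_cball)

lemma harmonic_cmult: "harmonic D f \<Longrightarrow> harmonic D (\<lambda>x. c * f x)"
  unfolding harmonic_def by (auto intro!: continuous_intros simp: avg_cmult)

lemma harmonic_const: "harmonic D (\<lambda>x. c)"
  unfolding harmonic_def by (auto intro!: continuous_intros simp: avg_const)

lemma harmonic_minus: "harmonic D f \<Longrightarrow> harmonic D (\<lambda>x. - f x)"
  using harmonic_cmult[of D f "-1"] by simp

lemma harmonic_diff: "harmonic D f \<Longrightarrow> harmonic D g \<Longrightarrow> harmonic D (\<lambda>x. f x - g x)"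
  using harmonic_add[OF _ harmonic_minus, of D f g] by simp

lemma harmonic_ln_norm: "y \<notin> D \<Longrightarrow> harmonic D (\<lambda>x. ln (norm (x - y)))"
proof -
  assume y: "y \<notin> D"
  show ?thesis unfolding harmonic_def
  proof (intro conjI allI impI)
    show "continuous_on D (\<lambda>x. ln (norm (x - y)))"
      using y by (auto intro!: continuous_intros)
    fix z r assume r: "0 < r" "cball z r \<subseteq> D"
    then have "y \<notin> cball z r" using y by auto
    then show "avg r (\<lambda>x. ln (norm (x - y))) z = ln (norm (z - y))"
      by (intro avg_ln r) (simp add: dist_norm)
  qed
qed

lemma subharmonic_add: "subharmonic D f \<Longrightarrow> subharmonic D g \<Longrightarrow> subharmonic D (\<lambda>x. f x + g x)"
  unfolding subharmonic_def by (auto intro!: continuous_intros add_mono simp: avg_add set_integrable_cball)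

lemma subharmonic_cmult: "subharmonic D f \<Longrightarrow> 0 \<le> c \<Longrightarrow> subharmonic D (\<lambda>x. c * f x)"
  unfolding subharmonic_def by (auto intro!: continuous_intros mult_left_mono simp: avg_cmult)

text \<open>
  Among the points where the maximum is attained take one of largest norm.  The mean value inequality
  forces the function to be constant on a disc about it, and this disc contains points of larger
  norm.
\<close>

lemma subharmonic_max_principle_compact:
  assumes D: "open D" and w: "subharmonic D w" and K: "compact K" "K \<subseteq> D"
    and out: "\<And>x. x \<in> D - K \<Longrightarrow> w x \<le> 0" and x: "x \<in> D"
  shows "w x \<le> 0"
proof (rule ccontr)
  assume "\<not> w x \<le> 0"
  then have wx: "w x > 0" by simp
  have xK: "x \<in> K" using out x wx by force
  have cK: "continuous_on K w" using w K by (auto simp: subharmonic_def intro: continuous_on_subset)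
  obtain m where m: "m \<in> K" "\<And>y. y \<in> K \<Longrightarrow> w y \<le> w m"
    using continuous_attains_sup[OF K(1) _ cK] xK by blast
  have wm: "w m > 0" using m(2)[OF xK] wx by simp
  have le: "w y \<le> w m" if "y \<in> D" for y
    using m(2) out[of y] that wm by (cases "y \<in> K") auto
  define A where "A = {y\<in>K. w m \<le> w y}"
  have "closed A" unfolding A_def
    by (rule continuous_on_closed_Collect_le[OF _ cK]) (use K in \<open>auto intro: compact_imp_closed continuous_intros\<close>)
  then have "compact A" using K(1) by (metis A_def Int_absorb2 closed_Int_compact mem_Collect_eq subsetI)
  moreover have "A \<noteq> {}" using m by (auto simp: A_def)
  ultimately obtain a where a: "a \<in> A" "\<And>y. y \<in> A \<Longrightarrow> norm y \<le> norm a"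
    using continuous_attains_sup[of A norm] continuous_on_norm_id by blast
  have aD: "a \<in> D" and wa: "w a = w m" using a(1) K le by (auto simp: A_def intro: antisym)
  obtain r where r: "r > 0" "cball a r \<subseteq> D" using D aD by (auto simp: open_contains_cball)
  have cr: "continuous_on (cball a r) w" using w r by (auto simp: subharmonic_def intro: continuous_on_subset)
  define g where "g x = bump r (x - a) * (w m - w x)" for x
  have i: "integrable lborel g"
    unfolding g_def by (intro integrable_bump_mult r continuous_intros cr)
  have "(LINT x|lborel. g x) = avg r (\<lambda>x. w m + (-1) * w x) a" by (simp add: g_def avg_def)
  also have "\<dots> = w m - avg r w a"
    using r cr by (subst avg_add) (auto simp: avg_const avg_cmult[of r "-1", simplified] intro!: set_integrable_continuous_cball continuous_intros)
  also have "\<dots> \<le> 0"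
  proof -
    have "w a \<le> avg r w a" using w r unfolding subharmonic_def by blast
    then show ?thesis using wa by simp
  qed
  finally have "(LINT x|lborel. g x) \<le> 0" .
  moreover have pos: "0 \<le> g x" for x
  proof (cases "x \<in> cball a r")
    case True
    then show ?thesis using r le bump_nonneg[OF r(1)] by (auto simp: g_def)
  next
    case False
    then show ?thesis using bump_eq_0[OF r(1), of "x - a"] by (simp add: g_def dist_norm norm_minus_commute)
  qed
  ultimately have "(LINT x|lborel. g x) = 0" by (simp add: antisym)
  then have "AE x in lborel. g x = 0"
    using integral_nonneg_eq_0_iff_AE[OF i] pos by auto
  then have ae: "AE x in lborel. x \<in> ball a r \<longrightarrow> w x = w m"
  proof eventually_elim
    case (elim x)
    show ?case
    proof
      assume "x \<in> ball a r"
      then have "bump r (x - a) > 0" by (intro bump_pos r) (simp add: dist_norm norm_minus_commute)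
      then show "w x = w m" using elim by (simp add: g_def)
    qed
  qed
  define u where "u = (if a = 0 then 1 else a /\<^sub>R norm a)"
  define b where "b = a + (r/2) *\<^sub>R u"
  have nu: "norm u = 1" by (auto simp: u_def)
  have bb: "b \<in> ball a r" using r by (simp add: b_def dist_norm nu)
  have nb: "norm b > norm a"
  proof (cases "a = 0")
    case True
    then show ?thesis using r by (simp add: b_def u_def)
  next
    case False
    then have "b = a + (r / 2) *\<^sub>R (a /\<^sub>R norm a)" by (simp only: b_def u_def if_False)
    then have "b = (1 + r / 2 / norm a) *\<^sub>R a"
      by (simp only: scaleR_add_left scaleR_one scaleR_scaleR divide_inverse)
    then have "norm b = (1 + r / 2 / norm a) * norm a" using r False by (simp add: abs_of_pos add_pos_pos)
    also have "\<dots> = norm a + r / 2" using False by (simp add: field_simps)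
    finally show ?thesis using r by simp
  qed
  have "w b = w m"
  proof (rule ccontr)
    assume "w b \<noteq> w m"
    define O' where "O' = {x\<in>ball a r. w x \<noteq> w m}"
    have "open O'"
    proof -
      have "continuous_on (ball a r) w" using cr by (rule continuous_on_subset) auto
      then have "open (ball a r \<inter> w -` (- {w m}))"
        by (intro continuous_open_preimage) auto
      moreover have "O' = ball a r \<inter> w -` (- {w m})" by (auto simp: O'_def)
      ultimately show ?thesis by simp
    qed
    have "b \<in> {}"
    proof (rule mem_closed_if_AE_lebesgue_open[OF \<open>open O'\<close>])
      show "AE x\<in>O' in lebesgue. x \<in> {}"
        using AE_completion[OF ae] by eventually_elim (auto simp: O'_def)
      show "b \<in> O'" using bb \<open>w b \<noteq> w m\<close> by (auto simp: O'_def)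
    qed auto
    then show False by simp
  qed
  moreover have "b \<in> D" using bb r by auto
  ultimately have "b \<in> A" using out[of b] wm by (force simp: A_def)
  then show False using a(2) nb by force
qed

section \<open>Polar sets\<close>

lemma polar_subset: "polar E \<Longrightarrow> E' \<subseteq> E \<Longrightarrow> polar E'"
  unfolding polar_def by blast

text \<open>
  The supremum of two measures is finite and dominates both.
\<close>

lemma polar_Un:
  assumes "polar E" "polar F"
  shows "polar (E \<union> F)"
proof -
  obtain \<mu> where m: "finite_measure \<mu>" "sets \<mu> = sets borel" "\<And>x. x \<in> E \<Longrightarrow> log_potential \<mu> x = \<infinity>"
    using assms(1) by (auto simp: polar_def)
  obtain \<nu> where n: "finite_measure \<nu>" "sets \<nu> = sets borel" "\<And>x. x \<in> F \<Longrightarrow> log_potential \<nu> x = \<infinity>"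
    using assms(2) by (auto simp: polar_def)
  define \<kappa> where "\<kappa> = sup_measure' \<mu> \<nu>"
  have s: "sets \<nu> = sets \<mu>" using m n by simp
  have sk: "sets \<kappa> = sets borel" using m(2) s by (simp add: \<kappa>_def)
  have le: "\<mu> \<le> \<kappa>" "\<nu> \<le> \<kappa>"
    using s by (auto simp: \<kappa>_def le_measure le_emeasure_sup_measure'1 le_emeasure_sup_measure'2)
  have "finite_measure \<kappa>"
  proof
    have "emeasure \<kappa> (space \<kappa>) = (SUP Y\<in>sets \<mu>. emeasure \<mu> (space \<kappa> \<inter> Y) + emeasure \<nu> (space \<kappa> \<inter> - Y))"
      unfolding \<kappa>_def using s by (subst emeasure_sup_measure') auto
    also have "\<dots> \<le> emeasure \<mu> (space \<mu>) + emeasure \<nu> (space \<nu>)"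
      by (intro SUP_least add_mono emeasure_space)
    also have "\<dots> < \<infinity>"
      using finite_measure.emeasure_finite[OF m(1)] finite_measure.emeasure_finite[OF n(1)]
      by (simp add: less_top)
    finally show "emeasure \<kappa> (space \<kappa>) \<noteq> \<infinity>" by simp
  qed
  moreover have "log_potential \<mu> x \<le> log_potential \<kappa> x" "log_potential \<nu> x \<le> log_potential \<kappa> x" for x
    unfolding log_potential_def using m n sk le by (auto intro!: nn_integral_mono_measure)
  then have "log_potential \<kappa> x = \<infinity>" if "x \<in> E \<union> F" for x
    using that m(3) n(3) by (metis UnE infinity_ennreal_def top.extremum_unique)
  ultimately show ?thesis using sk unfolding polar_def by blast
qed

lemma polar_empty: "polar {}"
  unfolding polar_def by (intro exI[of _ "null_measure borel"]) (auto intro!: finite_measureI)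

lemma polar_singleton: "polar {a}"
  unfolding polar_def
proof (intro exI conjI ballI)
  let ?m = "distr (count_space {a}) borel (\<lambda>x. x)"
  have fc: "finite_measure (count_space {a})" by (rule finite_measure_count_space) simp
  show "finite_measure ?m"
    by (rule finite_measure.finite_measure_distr[OF fc]) simp
  fix x assume "x \<in> {a}"
  then show "log_potential ?m x = \<infinity>"
    unfolding log_potential_def by (subst nn_integral_distr) (auto simp: nn_integral_count_space_finite)
qed simp

lemma polar_finite: "finite F \<Longrightarrow> polar F"
proof (induction F rule: finite_induct)
  case (insert x F)
  then show ?case using polar_Un[OF polar_singleton[of x]] by simp
qed (rule polar_empty)

text \<open>
  Contracting the measure along with the set only decreases distances.
\<close>

lemma polar_shrink:
  assumes "polar E" "0 < c" "c \<le> 1"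
  shows "polar ((\<lambda>x. c *\<^sub>R x) ` E)"
proof -
  obtain \<mu> where m: "finite_measure \<mu>" "sets \<mu> = sets borel" "\<And>x. x \<in> E \<Longrightarrow> log_potential \<mu> x = \<infinity>"
    using assms(1) by (auto simp: polar_def)
  define \<nu> where "\<nu> = distr \<mu> borel (\<lambda>x. c *\<^sub>R x)"
  have meas: "(\<lambda>x. c *\<^sub>R x) \<in> measurable \<mu> borel" using m(2) by (simp cong: measurable_cong_sets)
  have "log_potential \<nu> (c *\<^sub>R x) = \<infinity>" if "x \<in> E" for x
  proof -
    have "log_potential \<mu> x \<le> (\<integral>\<^sup>+ y. (if c *\<^sub>R y = c *\<^sub>R x then \<infinity> else ennreal (ln (1 / dist (c *\<^sub>R x) (c *\<^sub>R y)))) \<partial>\<mu>)"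
      unfolding log_potential_def
    proof (rule nn_integral_mono)
      fix y
      show "(if y = x then \<infinity> else ennreal (ln (1 / dist x y)))
         \<le> (if c *\<^sub>R y = c *\<^sub>R x then \<infinity> else ennreal (ln (1 / dist (c *\<^sub>R x) (c *\<^sub>R y))))"
      proof (cases "y = x")
        case False
        have "dist (c *\<^sub>R x) (c *\<^sub>R y) = c * dist x y"
          using assms by (simp add: dist_norm flip: scaleR_diff_right)
        moreover have "c * dist x y \<le> 1 * dist x y" using assms by (intro mult_right_mono) auto
        ultimately have "1 / dist x y \<le> 1 / dist (c *\<^sub>R x) (c *\<^sub>R y)"
          using False assms by (intro frac_le) auto
        then have "ln (1 / dist x y) \<le> ln (1 / dist (c *\<^sub>R x) (c *\<^sub>R y))"
          using False by (intro ln_mono) auto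
        then show ?thesis using False assms by (simp add: ennreal_leI)
      qed simp
    qed
    also have "\<dots> = log_potential \<nu> (c *\<^sub>R x)"
      unfolding log_potential_def \<nu>_def by (subst nn_integral_distr[OF meas]) auto
    finally show ?thesis using m(3)[OF that] by (simp add: top_unique)
  qed
  moreover have "finite_measure \<nu>" unfolding \<nu>_def
    by (rule finite_measure.finite_measure_distr[OF m(1) meas])
  ultimately show ?thesis unfolding polar_def by (intro exI[of _ \<nu>]) (auto simp: \<nu>_def)
qed



section \<open>Barriers at polar sets\<close>

lemma integrable_smooth_log_potential:
  assumes "finite_measure \<mu>" "sets \<mu> = sets borel" "compact S" "s > 0"
  shows "integrable \<mu> (\<lambda>y. indicator S y * smooth_log s (x - y))"
proof -
  interpret finite_measure \<mu> by fact
  note [measurable_cong] = assms(2)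
  have [measurable]: "S \<in> sets borel" using assms(3) by (rule borel_compact)
  have [measurable]: "smooth_log s \<in> borel_measurable borel"
    by (rule borel_measurable_continuous_onI[OF continuous_smooth_log[OF assms(4)]])
  have "bounded ((\<lambda>y. smooth_log s (x - y)) ` S)"
    using assms(3) by (intro compact_imp_bounded compact_continuous_image continuous_intros
        continuous_on_compose2[OF continuous_smooth_log[OF assms(4), of UNIV]]) auto
  then obtain B where "\<And>y. y \<in> S \<Longrightarrow> \<bar>smooth_log s (x - y)\<bar> \<le> B" by (auto simp: bounded_iff)
  then show ?thesis
    by (intro integrable_const_bound[where B = "\<bar>B\<bar>"]) (force simp: indicator_def)+
qed

definition smooth_log_potential :: "complex measure \<Rightarrow> complex set \<Rightarrow> real \<Rightarrow> complex \<Rightarrow> real" where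
  "smooth_log_potential \<mu> S s x = (LINT y|\<mu>. indicator S y * smooth_log s (x - y))"

text \<open>
  The kernel is Lipschitz, which gives continuity; the mean value inequality is inherited from the
  kernel by Fubini's theorem.
\<close>

lemma subharmonic_smooth_log_potential:
  assumes "finite_measure \<mu>" "sets \<mu> = sets borel" "compact S" "s > 0"
  shows "subharmonic UNIV (smooth_log_potential \<mu> S s)"
  unfolding subharmonic_def
proof (intro conjI allI impI)
  interpret finite_measure \<mu> by fact
  note [measurable_cong] = assms(2)
  have [measurable]: "S \<in> sets borel" using assms(3) by (rule borel_compact)
  have [measurable]: "smooth_log s \<in> borel_measurable borel"
    by (rule borel_measurable_continuous_onI[OF continuous_smooth_log[OF assms(4)]])
  note int = integrable_smooth_log_potential[OF assms]
  let ?U = "smooth_log_potential \<mu> S s"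
  have lip: "\<bar>?U x - ?U x'\<bar> \<le> (measure \<mu> S * (2 / s)) * norm (x - x')" for x x'
  proof -
    have Si: "integrable \<mu> (indicator S :: _ \<Rightarrow> real)"
      using assms(2) by (auto intro!: integrable_real_indicator simp: less_top[symmetric])
    have "?U x - ?U x' = (LINT y|\<mu>. indicator S y * smooth_log s (x - y) - indicator S y * smooth_log s (x' - y))"
      unfolding smooth_log_potential_def using int by simp
    also have "\<bar>\<dots>\<bar> \<le> (LINT y|\<mu>. \<bar>indicator S y * smooth_log s (x - y) - indicator S y * smooth_log s (x' - y)\<bar>)"
      by (rule integral_abs_bound)
    also have "\<dots> \<le> (LINT y|\<mu>. indicator S y * (2 / s * norm (x - x')))"
    proof (rule integral_mono)
      show "integrable \<mu> (\<lambda>y. indicator S y * (2 / s * norm (x - x')))" using Si by (rule integrable_mult_left)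
      show "\<bar>indicator S y * smooth_log s (x - y) - indicator S y * smooth_log s (x' - y)\<bar>
          \<le> indicator S y * (2 / s * norm (x - x'))" for y
        using smooth_log_lipschitz[OF assms(4), of "x - y" "x' - y"] by (auto simp: indicator_def)
    qed (use int in auto)
    also have "\<dots> = (measure \<mu> S * (2 / s)) * norm (x - x')"
      by simp
    finally show ?thesis .
  qed
  show "continuous_on UNIV ?U"
  proof (rule lipschitz_on_continuous_on)
    show "(measure \<mu> S * (2 / s))-lipschitz_on UNIV ?U"
      using lip assms(4) by (auto intro!: lipschitz_onI simp: dist_norm)
  qed
  fix z :: complex and r :: real assume r: "0 < r"
  have emeasure_lt_top: "emeasure \<mu> X < top" for X by (simp add: less_top[symmetric])
  interpret P: pair_sigma_finite lborel \<mu>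
    by (intro pair_sigma_finite.intro sigma_finite_lborel sigma_finite_measure_axioms)
  have [measurable]: "bump r \<in> borel_measurable borel"
    by (rule borel_measurable_continuous_onI[OF continuous_bump])
  define f where "f x y = bump r (x - z) * (indicator S y * smooth_log s (x - y))" for x y
  have fi: "integrable (lborel \<Otimes>\<^sub>M \<mu>) (case_prod f)"
  proof -
    have "bounded ((\<lambda>p. smooth_log s (fst p - snd p)) ` (cball z r \<times> S))"
      using assms(3) by (intro compact_imp_bounded compact_continuous_image continuous_intros compact_Times
          continuous_on_compose2[OF continuous_smooth_log[OF assms(4), of UNIV]]) auto
    then obtain B where B: "\<And>x y. x \<in> cball z r \<Longrightarrow> y \<in> S \<Longrightarrow> \<bar>smooth_log s (x - y)\<bar> \<le> B"
      by (force simp: bounded_iff)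
    have "bounded ((\<lambda>x. bump r (x - z)) ` cball z r)"
      by (intro compact_imp_bounded compact_continuous_image continuous_intros
          continuous_on_compose2[OF continuous_bump[of UNIV]]) auto
    then obtain B' where B': "\<And>x. x \<in> cball z r \<Longrightarrow> \<bar>bump r (x - z)\<bar> \<le> B'"
      by (force simp: bounded_iff)
    show ?thesis
    proof (rule integrableI_bounded_set[where A = "cball z r \<times> S" and B = "B' * B"])
      show "cball z r \<times> S \<in> sets (lborel \<Otimes>\<^sub>M \<mu>)" by measurable
      show "case_prod f \<in> borel_measurable (lborel \<Otimes>\<^sub>M \<mu>)" unfolding f_def by measurable
      have "emeasure lborel (cball z r) < \<infinity>" by (rule emeasure_bounded_finite) simp
      have "emeasure (lborel \<Otimes>\<^sub>M \<mu>) (cball z r \<times> S) = emeasure lborel (cball z r) * emeasure \<mu> S"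
        using assms(2) by (intro emeasure_pair_measure_Times) auto
      also have "\<dots> < \<infinity>"
        using \<open>emeasure lborel (cball z r) < \<infinity>\<close> emeasure_lt_top by (simp add: ennreal_mult_less_top)
      finally show "emeasure (lborel \<Otimes>\<^sub>M \<mu>) (cball z r \<times> S) < \<infinity>" .
      show "AE x in lborel \<Otimes>\<^sub>M \<mu>. x \<in> cball z r \<times> S \<longrightarrow> norm (case x of (x, xa) \<Rightarrow> f x xa) \<le> B' * B"
      proof (rule AE_I2, clarify)
        fix x y assume xy: "x \<in> cball z r" "y \<in> S"
        have "\<bar>bump r (x - z)\<bar> * \<bar>smooth_log s (x - y)\<bar> \<le> B' * B"
          using B[OF xy] B'[OF xy(1)] by (intro mult_mono) auto
        then show "norm (f x y) \<le> B' * B" using xy by (simp add: f_def abs_mult)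
      qed
      show "AE x in lborel \<Otimes>\<^sub>M \<mu>. x \<notin> cball z r \<times> S \<longrightarrow> (case x of (x, xa) \<Rightarrow> f x xa) = 0"
      proof (rule AE_I2, rule impI)
        fix p assume p: "p \<notin> cball z r \<times> S"
        obtain x y where xy: "p = (x, y)" by (cases p)
        have "f x y = 0"
        proof (cases "x \<in> cball z r")
          case False
          then have "bump r (x - z) = 0" by (intro bump_eq_0 r) (simp add: dist_norm norm_minus_commute)
          then show ?thesis by (simp add: f_def)
        qed (use p xy in \<open>simp add: f_def\<close>)
        then show "(case p of (x, xa) \<Rightarrow> f x xa) = 0" by (simp add: xy)
      qed
    qed
  qed
  have "?U z \<le> (LINT y|\<mu>. LINT x|lborel. f x y)"
    unfolding smooth_log_potential_def
  proof (rule integral_mono[OF int P.integrable_snd[OF fi]])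
    fix y
    have "(LINT x|lborel. f x y) = indicator S y * avg r (\<lambda>x. smooth_log s (x - y)) z"
      by (simp add: f_def avg_def mult.left_commute)
    then show "indicator S y * smooth_log s (z - y) \<le> (LINT x|lborel. f x y)"
      using smooth_log_le_avg[OF r assms(4), of z y] by (simp add: mult_left_mono)
  qed
  also have "\<dots> = (LINT x|lborel. LINT y|\<mu>. f x y)" by (rule P.Fubini_integral[OF fi])
  also have "\<dots> = avg r ?U z" by (simp add: f_def avg_def smooth_log_potential_def)
  finally show "?U z \<le> avg r ?U z" .
qed

text \<open>
  Positive superharmonic functions that stay below \<open>C\<close> at the point \<open>x0\<close> where an estimate is
  sought, while they may be arbitrarily large at exceptional boundary points.
\<close>

definition barrier :: "complex set \<Rightarrow> complex \<Rightarrow> real \<Rightarrow> (complex \<Rightarrow> real) \<Rightarrow> bool" where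
  "barrier D x0 C P \<longleftrightarrow> subharmonic D (\<lambda>x. - P x) \<and> (\<forall>x\<in>D. 0 \<le> P x) \<and> P x0 \<le> C"

text \<open>
  The barrier is the logarithmic potential of the measure that shows \<open>E\<close> to be polar, with three
  changes.  The kernel is smoothed at scale \<open>t\<close>, so that everything is continuous; the value at a
  point of \<open>E\<close> tends to infinity as \<open>t\<close> decreases, and by monotonicity in \<open>t\<close> and compactness a
  single \<open>t\<close> serves a neighbourhood of \<open>F\<close>.  The mass near \<open>x0\<close>, which does not contribute to
  the infinite values on the boundary, is removed, so the value at \<open>x0\<close> stays bounded in \<open>t\<close>.
  A multiple of $\ln|x-q|$, harmonic in \<open>D\<close> because \<open>q\<close> is exterior, and a constant make the sum
  positive and let it grow at infinity, so that unbounded domains are covered.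
\<close>

lemma polar_barrier:
  assumes D: "open D" "bounded (frontier D)" and q: "q \<notin> closure D"
    and E: "polar E" "E \<subseteq> frontier D" and x0: "x0 \<in> D"
  obtains C where "\<And>N F. compact F \<Longrightarrow> F \<subseteq> E \<Longrightarrow>
     \<exists>P. barrier D x0 C P \<and> (\<exists>V. open V \<and> F \<subseteq> V \<and> (\<forall>x\<in>V \<inter> D. N < P x)) \<and> (\<exists>R. \<forall>x\<in>D. R < norm x \<longrightarrow> N < P x)"
proof -
  obtain \<mu> where m: "finite_measure \<mu>" "sets \<mu> = sets borel" "\<And>x. x \<in> E \<Longrightarrow> log_potential \<mu> x = \<infinity>"
    using E(1) by (auto simp: polar_def)
  interpret finite_measure \<mu> by fact
  have emeasure_lt_top: "emeasure \<mu> X < top" for X by (simp add: less_top[symmetric])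
  have sp: "space \<mu> = UNIV" using sets_eq_imp_space_eq[OF m(2)] by simp
  obtain \<rho> where \<rho>: "\<rho> > 0" "\<And>x. x \<in> closure D \<Longrightarrow> \<rho> \<le> norm (x - q)"
  proof -
    have "open (- closure D)" "q \<in> - closure D" using q by auto
    then obtain e where "e > 0" "ball q e \<subseteq> - closure D" using open_contains_ball by blast
    then show ?thesis
      by (intro that[of e]) (auto simp: subset_eq dist_norm norm_minus_commute not_less[symmetric])
  qed
  obtain M where M: "M \<ge> 0" "\<And>x. x \<in> frontier D \<Longrightarrow> norm x \<le> M"
  proof -
    obtain M where "\<And>x. x \<in> frontier D \<Longrightarrow> norm x \<le> M" using D(2) by (auto simp: bounded_iff)
    then show ?thesis by (intro that[of "max M 0"]) (auto simp: le_max_iff_disj)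
  qed
  obtain s where s: "s > 0" "ball x0 (2 * s) \<subseteq> D"
  proof -
    obtain e where "e > 0" "ball x0 e \<subseteq> D" using D(1) x0 open_contains_ball by blast
    then show ?thesis by (intro that[of "e / 2"]) auto
  qed
  have x0E: "2 * s \<le> norm (z - x0)" if "z \<in> E" for z
  proof -
    have "z \<notin> D" using that E(2) D(1) by (auto simp: frontier_def interior_open)
    then show ?thesis using s by (auto simp: subset_eq dist_norm norm_minus_commute not_less[symmetric])
  qed
  have clE: "z \<in> closure D" if "z \<in> E" for z using that E(2) by (auto simp: frontier_def)
  have clD: "z \<in> closure D" if "z \<in> D" for z using that closure_subset by blast
  (* Mass at distance more than 1 from the boundary does not contribute to the potential there. *)
  define S where "S = cball 0 (M + 1) - ball x0 s"
  have S: "compact S" unfolding S_def by (intro compact_diff) auto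
  then have [measurable]: "S \<in> sets \<mu>" using m(2) borel_compact by simp
  have Si: "integrable \<mu> (indicator S :: _ \<Rightarrow> real)"
    by (auto intro!: integrable_real_indicator simp: less_top[symmetric])
  (* A is chosen so that max t |x - y| <= A |x - q| for x in D, y in S and t <= 1. *)
  define A where "A = 1 / \<rho> + 1 + (norm q + M + 1) / \<rho>"
  have A: "A \<ge> 1" using \<rho> M by (auto simp: A_def)
  define k where "k t x y = ln A + ln (norm (x - q)) - smooth_log t (x - y)" for t x y
  define U where "U t = smooth_log_potential \<mu> S t" for t
  define m0 where "m0 = measure \<mu> S"
  define P where "P t x = (m0 + 1) * ln (norm (x - q)) + (m0 * ln A - ln \<rho>) - U t x" for t x
  have m0: "m0 \<ge> 0" by (simp add: m0_def)
  define t0 where "t0 = min 1 s"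
  have t0: "0 < t0" "t0 \<le> 1" "t0 \<le> s" using s by (auto simp: t0_def)
  note int = integrable_smooth_log_potential[OF m(1,2) S]
  have kint: "integrable \<mu> (\<lambda>y. indicator S y * k t x y)" if "t > 0" for t x
    using int[OF that, of x] Si by (simp add: k_def algebra_simps)
  have Pk: "P t x = (LINT y|\<mu>. indicator S y * k t x y) + (ln (norm (x - q)) - ln \<rho>)" if "t > 0" for t x
  proof -
    have "(LINT y|\<mu>. indicator S y * k t x y)
      = (LINT y|\<mu>. indicator S y * (ln A + ln (norm (x - q))) - indicator S y * smooth_log t (x - y))"
      by (simp add: k_def right_diff_distrib)
    also have "\<dots> = m0 * (ln A + ln (norm (x - q))) - U t x"
      using int[OF that, of x] Si
      by (subst Bochner_Integration.integral_diff) (auto simp: U_def smooth_log_potential_def m0_def sp)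
    finally show ?thesis by (simp add: P_def algebra_simps)
  qed
  have k_nonneg: "0 \<le> k t x y" if "0 < t" "t \<le> t0" "x \<in> closure D" "y \<in> S" for t x y
  proof -
    have xq: "\<rho> \<le> norm (x - q)" by (rule \<rho>(2)[OF that(3)])
    have y: "norm y \<le> M + 1" using that(4) by (simp add: S_def)
    have 1: "1 \<le> 1 / \<rho> * norm (x - q)" using xq \<rho>(1) by (simp add: field_simps)
    then have "(norm q + M + 1) * 1 \<le> (norm q + M + 1) * (1 / \<rho> * norm (x - q))"
      using M by (intro mult_left_mono) auto
    then have 2: "norm q + M + 1 \<le> (norm q + M + 1) / \<rho> * norm (x - q)" by simp
    have "norm (x - y) \<le> norm (x - q) + norm q + norm y"
      using norm_triangle_ineq4[of "x - q" "y - q"] norm_triangle_ineq4[of y q] by simp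
    moreover have "A * norm (x - q) = 1 / \<rho> * norm (x - q) + norm (x - q) + (norm q + M + 1) / \<rho> * norm (x - q)"
      by (simp add: A_def distrib_right)
    moreover have "0 \<le> (norm q + M + 1) / \<rho> * norm (x - q)" using M \<rho>(1) by simp
    ultimately have "max t (norm (x - y)) \<le> A * norm (x - q)"
      using 1 2 y that(2) t0 norm_ge_zero[of "x - q"] by linarith
    then have "ln (max t (norm (x - y))) \<le> ln (A * norm (x - q))"
      using that(1) by (intro ln_mono) (auto simp: less_max_iff_disj)
    also have "\<dots> = ln A + ln (norm (x - q))" using A xq \<rho>(1) by (intro ln_mult_pos) auto
    finally show ?thesis using smooth_log_le_ln_max[OF that(1), of "x - y"] by (simp add: k_def)
  qed
  have ik_nonneg: "0 \<le> (LINT y|\<mu>. indicator S y * k t x y)" if "0 < t" "t \<le> t0" "x \<in> closure D" for t x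
    using k_nonneg[OF that] by (intro Bochner_Integration.integral_nonneg) (auto simp: indicator_def)
  have ln_q: "ln \<rho> \<le> ln (norm (x - q))" if "x \<in> closure D" for x
    using \<rho>(1) \<rho>(2)[OF that] by (intro ln_mono) auto
  have P_nonneg: "0 \<le> P t x" if "0 < t" "t \<le> t0" "x \<in> D" for t x
    using ik_nonneg[OF that(1,2)] ln_q[of x] clD[OF that(3)] Pk[OF that(1)] by fastforce
  have P_super: "subharmonic D (\<lambda>x. - P t x)" if "t > 0" for t
  proof -
    have "q \<notin> D" using clD q by blast
    have "subharmonic D (U t)"
      unfolding U_def by (rule subharmonic_subset[OF subharmonic_smooth_log_potential[OF m(1,2) S that]]) simp
    moreover have "harmonic D (\<lambda>x. (- (m0 + 1)) * ln (norm (x - q)) + (- (m0 * ln A - ln \<rho>)))"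
      by (intro harmonic_add harmonic_cmult harmonic_const harmonic_ln_norm \<open>q \<notin> D\<close>)
    ultimately have "subharmonic D (\<lambda>x. U t x + ((- (m0 + 1)) * ln (norm (x - q)) + (- (m0 * ln A - ln \<rho>))))"
      by (rule subharmonic_add[OF _ harmonic_imp_subharmonic])
    moreover have "(\<lambda>x. U t x + ((- (m0 + 1)) * ln (norm (x - q)) + (- (m0 * ln A - ln \<rho>)))) = (\<lambda>x. - P t x)"
      by (simp add: P_def fun_eq_iff algebra_simps)
    ultimately show ?thesis by simp
  qed
  define C where "C = (m0 + 1) * ln (norm (x0 - q)) + (m0 * ln A - ln \<rho>) - ln s * m0"
  have P_x0: "P t x0 \<le> C" if "0 < t" "t \<le> t0" for t
  proof -
    have "ln s * m0 = (LINT y|\<mu>. indicator S y * ln s)" using Si by (simp add: m0_def sp)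
    also have "\<dots> \<le> U t x0"
      unfolding U_def smooth_log_potential_def
    proof (rule integral_mono[OF _ int[OF that(1)]])
      fix y
      show "indicator S y * ln s \<le> indicator S y * smooth_log t (x0 - y)"
      proof (cases "y \<in> S")
        case True
        then have "s \<le> norm (x0 - y)" by (simp add: S_def dist_norm not_less)
        then have "ln s \<le> ln (norm (x0 - y))" using s(1) by (intro ln_mono) auto
        moreover have "smooth_log t (x0 - y) = ln (norm (x0 - y))"
          using \<open>s \<le> norm (x0 - y)\<close> that t0 by (intro smooth_log_eq_ln) auto
        ultimately show ?thesis using True by simp
      qed simp
    qed (use Si in simp)
    finally show ?thesis by (simp add: P_def C_def)
  qed
  have P_mono: "P t' x \<le> P t x" if "0 < t" "t \<le> t'" for t t' x
  proof -
    have "U t x \<le> U t' x"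
      unfolding U_def smooth_log_potential_def using that smooth_log_mono[OF that]
      by (intro integral_mono int) (auto intro!: mult_left_mono)
    then show ?thesis by (simp add: P_def)
  qed
  have P_far: "N < P t x" if "0 < t" "t \<le> t0" "x \<in> D" "norm q + exp (N + ln \<rho>) < norm x" for N t x
  proof -
    have "exp (N + ln \<rho>) < norm (x - q)" using that(4) norm_triangle_ineq2[of x q] by linarith
    then have "ln (exp (N + ln \<rho>)) < ln (norm (x - q))"
      by (subst ln_less_cancel_iff) (auto intro: less_trans[OF exp_gt_zero])
    then show ?thesis using ik_nonneg[OF that(1,2) clD[OF that(3)]] Pk[OF that(1), of x] by simp
  qed
  have P_E: "\<exists>t. 0 < t \<and> t \<le> t0 \<and> N < P t z" if z: "z \<in> E" for N z
  proof (rule ccontr)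
    assume "\<not> ?thesis"
    then have bnd: "P t z \<le> N" if "0 < t" "t \<le> t0" for t using that not_less by blast
    (* If the barriers stayed bounded at z, monotone convergence along T would make the potential of the
       measure finite there. *)
    define T where "T n = t0 / real (Suc n)" for n
    have T: "0 < T n" "T n \<le> t0" for n using t0 by (auto simp: T_def field_simps)
    have Tdec: "T n \<le> T m" if "m \<le> n" for m n
      unfolding T_def using t0 that by (intro divide_left_mono) auto
    have Tsmall: "\<exists>n. T n < e" if "e > 0" for e
    proof -
      have "0 < e / t0" using that t0 by simp
      then obtain n where "inverse (real (Suc n)) < e / t0" using reals_Archimedean by blast
      then show ?thesis using t0 by (intro exI[of _ n]) (simp add: T_def field_simps)
    qed
    define f where "f n y = ennreal (indicator S y * k (T n) z y)" for n y
    define g where "g y = (SUP n. f n y)" for y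
    define N' where "N' = N - (ln (norm (z - q)) - ln \<rho>)"
    have fm[measurable]: "f n \<in> borel_measurable \<mu>" for n
      unfolding f_def using borel_measurable_integrable[OF kint[OF T(1)[of n], of z]] by simp
    have fle: "(\<integral>\<^sup>+ y. f n y \<partial>\<mu>) \<le> ennreal N'" for n
    proof -
      have "(\<integral>\<^sup>+ y. f n y \<partial>\<mu>) = ennreal (LINT y|\<mu>. indicator S y * k (T n) z y)"
        unfolding f_def using k_nonneg[OF T(1) T(2) clE[OF z]]
        by (intro nn_integral_eq_integral kint T) (auto simp: indicator_def)
      also have "\<dots> \<le> ennreal N'"
        using bnd[OF T(1,2), of n] Pk[OF T(1)[of n], of z] by (intro ennreal_leI) (simp add: N'_def)
      finally show ?thesis .
    qed
    have inc: "incseq f"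
    proof (rule incseq_SucI, rule le_funI)
      fix n y
      show "f n y \<le> f (Suc n) y"
        using smooth_log_mono[OF T(1)[of "Suc n"] Tdec[of n "Suc n"], of "z - y"]
        by (auto simp: f_def k_def intro!: ennreal_leI mult_left_mono)
    qed
    have "(\<integral>\<^sup>+ y. g y \<partial>\<mu>) = (SUP n. \<integral>\<^sup>+ y. f n y \<partial>\<mu>)"
      unfolding g_def by (rule nn_integral_monotone_convergence_SUP[OF inc fm])
    also have "\<dots> \<le> ennreal N'" by (rule SUP_least[OF fle])
    finally have gfin: "(\<integral>\<^sup>+ y. g y \<partial>\<mu>) < \<infinity>" by (simp add: le_less_trans[OF _ ennreal_less_top])
    define c where "c = max \<bar>ln A + ln (norm (z - q))\<bar> \<bar>ln s\<bar>"
    have gm[measurable]: "g \<in> borel_measurable \<mu>" unfolding g_def by measurable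
    have key: "(if y = z then \<infinity> else ennreal (ln (1 / dist z y))) \<le> g y + ennreal c" for y
    proof (cases "y \<in> S")
      case False
      show ?thesis
      proof (cases "dist x0 y < s")
        case True
        have "s \<le> dist z y" using x0E[OF z] True dist_triangle[of z x0 y] dist_commute[of y x0]
          by (simp add: dist_norm norm_minus_commute)
        then have d: "dist z y > 0" using s(1) by linarith
        then have "ln (1 / dist z y) = - ln (dist z y)" by (subst ln_div) auto
        also have "\<dots> \<le> - ln s" using ln_mono[OF \<open>s \<le> dist z y\<close> s(1)] by simp
        also have "\<dots> \<le> c" by (simp add: c_def)
        finally have "ennreal (ln (1 / dist z y)) \<le> ennreal c" by (rule ennreal_leI)
        then show ?thesis using d by (auto intro: add_increasing)
      next
        case False
        then have "norm y > M + 1" using \<open>y \<notin> S\<close> by (simp add: S_def)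
        moreover have "norm z \<le> M" using M(2) z E(2) by blast
        ultimately have "dist z y > 1" using norm_triangle_ineq2[of y z] by (simp add: dist_norm norm_minus_commute)
        moreover have "ln (1 / dist z y) \<le> 0" using \<open>dist z y > 1\<close> by (simp add: ln_div)
        ultimately show ?thesis by (auto simp: ennreal_neg)
      qed
    next
      case True
      show ?thesis
      proof (cases "y = z")
        case False
        then have "dist z y > 0" by simp
        then obtain n where n: "T n < dist z y" using Tsmall by blast
        have "k (T n) z y = ln A + ln (norm (z - q)) - ln (dist z y)"
          using n T(1)[of n] by (simp add: k_def smooth_log_eq_ln dist_norm)
        then have e: "f n y = ennreal (ln A + ln (norm (z - q)) - ln (dist z y))"
          and nn: "0 \<le> ln A + ln (norm (z - q)) - ln (dist z y)"
          using True k_nonneg[OF T(1,2) clE[OF z] True, of n] by (auto simp: f_def)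
        have "ln (1 / dist z y) = - ln (dist z y)" using \<open>dist z y > 0\<close> by (subst ln_div) auto
        then have "ennreal (ln (1 / dist z y)) \<le> ennreal (ln A + ln (norm (z - q)) - ln (dist z y) + c)"
          by (intro ennreal_leI) (simp add: c_def)
        also have "\<dots> = f n y + ennreal c" unfolding e using nn by (intro ennreal_plus) (auto simp: c_def)
        also have "\<dots> \<le> g y + ennreal c" unfolding g_def by (intro add_right_mono SUP_upper) simp
        finally show ?thesis using False by simp
      next
        case True
        have "g y = \<infinity>"
        proof (rule ccontr)
          assume "g y \<noteq> \<infinity>"
          then obtain b where b: "g y = ennreal b" "b \<ge> 0" by (cases "g y") auto
          obtain n where n: "T n < exp (ln A + ln (norm (z - q)) - b - 1)" using Tsmall[OF exp_gt_zero] by blast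
          have "ln (T n) < ln A + ln (norm (z - q)) - b - 1"
            using n T(1)[of n] by (metis exp_less_cancel_iff exp_ln)
          moreover have "smooth_log (T n) 0 \<le> ln (T n)"
            using smooth_log_le_ln_max[OF T(1), of n 0] T(1)[of n] by (simp add: max_def)
          ultimately have "b < k (T n) z y" using True by (simp add: k_def)
          then have "ennreal b < f n y" using b \<open>y \<in> S\<close> by (simp add: f_def ennreal_lessI)
          also have "f n y \<le> g y" unfolding g_def by (rule SUP_upper) simp
          finally show False using b by simp
        qed
        then show ?thesis by simp
      qed
    qed
    have "log_potential \<mu> z \<le> (\<integral>\<^sup>+ y. g y + ennreal c \<partial>\<mu>)"
      unfolding log_potential_def by (intro nn_integral_mono key)
    also have "\<dots> = (\<integral>\<^sup>+ y. g y \<partial>\<mu>) + ennreal c * emeasure \<mu> UNIV"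
      by (subst nn_integral_add) (auto simp: sp)
    also have "\<dots> < \<infinity>" using gfin emeasure_lt_top by (simp add: ennreal_mult_less_top)
    finally show False using m(3)[OF z] by simp
  qed
  have P_cont: "continuous_on (- {q}) (P t)" if "t > 0" for t
  proof -
    have "continuous_on UNIV (U t)"
      using subharmonic_smooth_log_potential[OF m(1,2) S that] by (simp add: subharmonic_def U_def)
    then show ?thesis unfolding P_def by (auto intro!: continuous_intros intro: continuous_on_subset)
  qed
  show ?thesis
  proof (rule that[of C])
    fix N F assume F: "compact F" "F \<subseteq> E"
    define W where "W t = {x \<in> - {q}. N < P t x}" for t
    have Wo: "open (W t)" if "t > 0" for t
    proof -
      have "open (- {q} \<inter> P t -` {N<..})"
        by (rule continuous_open_preimage[OF P_cont[OF that]]) auto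
      moreover have "W t = - {q} \<inter> P t -` {N<..}" by (auto simp: W_def)
      ultimately show ?thesis by simp
    qed
    have Wmono: "W t' \<subseteq> W t" if "0 < t" "t \<le> t'" for t t'
      using P_mono[OF that] by (auto simp: W_def intro: less_le_trans)
    have cover: "F \<subseteq> (\<Union>t\<in>{0<..t0}. W t)"
    proof
      fix z assume "z \<in> F"
      then have z: "z \<in> E" using F by blast
      then have "z \<noteq> q" using clE q by blast
      with P_E[OF z, of N] show "z \<in> (\<Union>t\<in>{0<..t0}. W t)" by (auto simp: W_def)
    qed
    obtain TT where TT: "TT \<subseteq> {0<..t0}" "finite TT" "F \<subseteq> (\<Union>t\<in>TT. W t)"
      by (rule compactE_image[OF F(1) _ cover]) (use Wo in auto)
    define t where "t = Min (insert t0 TT)"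
    have "t \<in> insert t0 TT" unfolding t_def by (rule Min_in) (use TT in auto)
    then have t: "0 < t" "t \<le> t0" using TT t0 by auto
    have "t \<le> t'" if "t' \<in> TT" for t' unfolding t_def using TT that by (intro Min_le) auto
    then have FW: "F \<subseteq> W t" using TT(3) Wmono[OF t(1)] by blast
    show "\<exists>P. barrier D x0 C P \<and> (\<exists>V. open V \<and> F \<subseteq> V \<and> (\<forall>x\<in>V \<inter> D. N < P x)) \<and> (\<exists>R. \<forall>x\<in>D. R < norm x \<longrightarrow> N < P x)"
    proof (intro exI[of _ "P t"] conjI ballI)
      show "\<exists>V. open V \<and> F \<subseteq> V \<and> (\<forall>x\<in>V \<inter> D. N < P t x)"
        using Wo[OF t(1)] FW by (intro exI[of _ "W t"]) (auto simp: W_def)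
      show "\<exists>R. \<forall>x\<in>D. R < norm x \<longrightarrow> N < P t x"
        using P_far[OF t] by blast
    qed (use P_super P_nonneg P_x0 t in \<open>auto simp: barrier_def\<close>)
  qed
qed



section \<open>The maximum principle with polar exceptional sets\<close>

text \<open>
  Each boundary point has a neighbourhood where \<open>u\<close> is small or, at exceptional points, where the
  barrier is large; a compact part of \<open>D\<close> remains.
\<close>

lemma polar_exhaustion:
  assumes D: "open D" "bounded (frontier D)" and q: "q \<notin> closure D"
    and E: "polar E" and x0: "x0 \<in> D"
    and K0: "compact K0" "K0 \<subseteq> D" and B: "\<And>x. x \<in> D - K0 \<Longrightarrow> u x \<le> B"
    and lim: "\<And>z c. z \<in> frontier D - E \<Longrightarrow> 0 < c \<Longrightarrow> \<forall>\<^sub>F x in at z within D. u x < c"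
  obtains C where "\<And>d. 0 < d \<Longrightarrow>
      \<exists>P K. barrier D x0 C P \<and> compact K \<and> K0 \<subseteq> K \<and> K \<subseteq> D \<and> (\<forall>x\<in>D - K. u x \<le> d + d * P x)"
proof -
  have E': "polar (E \<inter> frontier D)" using E by (rule polar_subset) auto
  obtain C where C: "\<And>N F. compact F \<Longrightarrow> F \<subseteq> E \<inter> frontier D \<Longrightarrow>
     \<exists>P. barrier D x0 C P \<and> (\<exists>V. open V \<and> F \<subseteq> V \<and> (\<forall>x\<in>V \<inter> D. N < P x)) \<and>
       (\<exists>R. \<forall>x\<in>D. R < norm x \<longrightarrow> N < P x)"
    using polar_barrier[OF D q E' _ x0] by blast
  show ?thesis
  proof (rule that)
    fix d :: real assume d: "0 < d"
    define V0 where "V0 = \<Union>{S. open S \<and> (\<forall>x\<in>S \<inter> D. u x \<le> d)}"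
    have V0: "open V0" unfolding V0_def by blast
    have V0u: "u x \<le> d" if "x \<in> V0" "x \<in> D" for x using that by (auto simp: V0_def)
    have disj: "z \<notin> D" if "z \<in> frontier D" for z
      using that D(1) by (simp add: frontier_def interior_open)
    have sub: "frontier D - E \<subseteq> V0"
    proof
      fix z assume z: "z \<in> frontier D - E"
      from lim[OF z d] obtain S where "open S" "z \<in> S" "\<And>x. x \<in> S \<Longrightarrow> x \<noteq> z \<Longrightarrow> x \<in> D \<Longrightarrow> u x < d"
        by (auto simp: eventually_at_topological)
      moreover have "z \<notin> D" using z disj by blast
      ultimately show "z \<in> V0" unfolding V0_def by (intro UnionI[of S]) (auto intro: less_imp_le)
    qed
    have "compact (frontier D - V0)"
      using D(2) V0 by (intro compact_diff) (auto simp: compact_eq_bounded_closed)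
    moreover have "frontier D - V0 \<subseteq> E \<inter> frontier D" using sub by auto
    ultimately have "\<exists>P. barrier D x0 C P \<and>
       (\<exists>V. open V \<and> frontier D - V0 \<subseteq> V \<and> (\<forall>x\<in>V \<inter> D. B / d < P x)) \<and> (\<exists>R. \<forall>x\<in>D. R < norm x \<longrightarrow> B / d < P x)"
      by (rule C)
    then obtain P V R where
      P: "barrier D x0 C P"
      and V: "open V" "frontier D - V0 \<subseteq> V" "\<And>x. x \<in> V \<inter> D \<Longrightarrow> B / d < P x"
      and R: "\<And>x. x \<in> D \<Longrightarrow> R < norm x \<Longrightarrow> B / d < P x" by blast
    define K where "K = K0 \<union> ((closure D - (V \<union> V0)) \<inter> cball 0 R)"
    have "compact ((closure D - (V \<union> V0)) \<inter> cball 0 R)"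
      using V V0 by (intro closed_Int_compact closed_Diff open_Un) auto
    then have K: "compact K" unfolding K_def using K0 by (intro compact_Un)
    have KD: "K \<subseteq> D"
      using V(2) K0 closure_Un_frontier[of D] by (auto simp: K_def)
    have "u x \<le> d + d * P x" if x: "x \<in> D - K" for x
    proof -
      have x': "x \<in> D" "x \<notin> K0" "x \<in> closure D" using x closure_subset by (auto simp: K_def)
      have P0: "0 \<le> d * P x" using P x'(1) d by (simp add: barrier_def)
      consider "x \<in> V0" | "B / d < P x" using x x' V(3) R by (auto simp: K_def not_le)
      then show ?thesis
      proof cases
        case 1
        then show ?thesis using V0u[OF 1 x'(1)] P0 by simp
      next
        case 2
        then have "B < d * P x" using d by (simp add: field_simps)
        then show ?thesis using B[of x] x' d by simp
      qed
    qed
    then show "\<exists>P K. barrier D x0 C P \<and> compact K \<and> K0 \<subseteq> K \<and> K \<subseteq> D \<and> (\<forall>x\<in>D - K. u x \<le> d + d * P x)"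
      using P K KD by (intro exI[of _ P] exI[of _ K]) (auto simp: K_def)
  qed
qed

lemma frontier_diff_finite:
  assumes "open D" "finite (F :: complex set)"
  shows "frontier (D - F) \<subseteq> frontier D \<union> F"
proof
  fix z assume "z \<in> frontier (D - F)"
  moreover have "open (D - F)" using assms by (simp add: open_Diff finite_imp_closed)
  ultimately have "z \<in> closure (D - F)" "z \<notin> D - F" by (auto simp: frontier_def interior_open)
  moreover have "closure (D - F) \<subseteq> closure D" by (rule closure_mono) auto
  ultimately show "z \<in> frontier D \<union> F" using assms by (auto simp: frontier_def interior_open)
qed

text \<open>
  After subtraction of \<open>b\<close>, a small constant and a small multiple of a barrier, \<open>f\<close> is at most 0
  off a compact set, so the compact version applies; the constant and the multiple tend to 0.  Isolated interior singularities \<open>F\<close> of a bounded function are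
  harmless since finite sets are polar.
\<close>

theorem max_principle:
  assumes D: "open D" "bounded (frontier D)" and q: "q \<notin> closure D" and F: "finite F"
    and f: "subharmonic (D - F) f" and B: "\<And>x. x \<in> D - F \<Longrightarrow> f x \<le> B" and E: "polar E"
    and lim: "\<And>z c. z \<in> frontier D - E \<Longrightarrow> b < c \<Longrightarrow> \<forall>\<^sub>F x in at z within D - F. f x < c"
    and x: "x \<in> D - F"
  shows "f x \<le> b"
proof -
  let ?D = "D - F"
  have D': "open ?D" using D F by (simp add: open_Diff finite_imp_closed)
  have fr: "frontier ?D \<subseteq> frontier D \<union> F" by (rule frontier_diff_finite[OF D(1) F])
  then have bdd: "bounded (frontier ?D)"
    using D(2) F by (meson bounded_Un bounded_subset finite_imp_bounded)
  have q': "q \<notin> closure ?D" using q closure_mono[of ?D D] by auto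
  have E': "polar (E \<union> F)" by (rule polar_Un[OF E polar_finite[OF F]])
  have B': "f y - b \<le> B - b" if "y \<in> ?D - {}" for y using B[of y] that by simp
  have lim': "\<forall>\<^sub>F y in at z within ?D. f y - b < c" if "z \<in> frontier ?D - (E \<union> F)" "0 < c" for z c
  proof -
    have "\<forall>\<^sub>F y in at z within ?D. f y < b + c"
      using that fr by (intro lim) auto
    then show ?thesis by eventually_elim simp
  qed
  obtain C where C: "\<And>d. 0 < d \<Longrightarrow>
      \<exists>P K. barrier ?D x C P \<and> compact K \<and> {} \<subseteq> K \<and> K \<subseteq> ?D \<and> (\<forall>y\<in>?D - K. f y - b \<le> d + d * P y)"
    by (rule polar_exhaustion[OF D' bdd q' E' x compact_empty empty_subsetI B' lim' that])
  have bound: "f x - b \<le> d * (1 + C)" if d: "d > 0" for d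
  proof -
    from C[OF d] obtain P K where P: "subharmonic ?D (\<lambda>x. - P x)" "P x \<le> C"
      and K: "compact K" "K \<subseteq> ?D" "\<And>x. x \<in> ?D - K \<Longrightarrow> f x - b \<le> d + d * P x"
      by (auto simp: barrier_def)
    define w where "w x = f x + (d * (- P x) + (- b - d))" for x
    have "subharmonic ?D w" unfolding w_def
      using d by (intro subharmonic_add f subharmonic_cmult P(1) harmonic_imp_subharmonic[OF harmonic_const]) auto
    then have "w x \<le> 0"
      by (rule subharmonic_max_principle_compact[OF D' _ K(1,2) _ x]) (use K(3) in \<open>force simp: w_def\<close>)
    moreover have "d * P x \<le> d * C" using P(2) d by simp
    ultimately show ?thesis by (simp add: w_def distrib_left)
  qed
  show ?thesis
  proof (rule field_le_epsilon)
    fix e :: real assume e: "e > 0"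
    define d where "d = e / (1 + \<bar>C\<bar>)"
    have d: "d > 0" using e by (simp add: d_def add_pos_nonneg)
    have "d * (1 + C) \<le> d * (1 + \<bar>C\<bar>)" using d by (intro mult_left_mono) auto
    also have "\<dots> = e" unfolding d_def by (simp add: add_pos_nonneg less_imp_neq[symmetric])
    finally show "f x \<le> b + e" using bound[OF d] by simp
  qed
qed

section \<open>Green's functions\<close>

lemma cball_double: "w \<in> cball z r \<Longrightarrow> cball w r \<subseteq> cball z (2 * r)" for w z :: complex
proof
  fix p assume "w \<in> cball z r" "p \<in> cball w r"
  then show "p \<in> cball z (2 * r)" using dist_triangle[of z p w] by simp
qed

lemma avg_lipschitz:
  assumes "r > 0" "compact K" "set_integrable lborel K v" "cball z r \<subseteq> K" "cball z' r \<subseteq> K"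
  shows "\<bar>avg r v z - avg r v z'\<bar> \<le> 4 / (pi * r ^ 3) * (LINT x:K|lborel. \<bar>v x\<bar>) * norm (z - z')"
proof -
  have K: "K \<in> sets lborel" using assms(2) by (simp add: borel_compact)
  have sub: "set_integrable lborel (cball w r) v" if "cball w r \<subseteq> K" for w
    using set_integrable_subset[OF assms(3) _ that] by simp
  note i = integrable_bump_mult'[OF assms(1) sub[OF assms(4)]] integrable_bump_mult'[OF assms(1) sub[OF assms(5)]]
  have ab: "set_integrable lborel K (\<lambda>x. \<bar>v x\<bar>)" using set_integrable_abs[OF assms(3)] .
  have "\<bar>avg r v z - avg r v z'\<bar> = \<bar>LINT x|lborel. bump r (x - z) * v x - bump r (x - z') * v x\<bar>"
    unfolding avg_def using i by simp
  also have "\<dots> \<le> (LINT x|lborel. \<bar>bump r (x - z) * v x - bump r (x - z') * v x\<bar>)"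
    by (rule integral_abs_bound)
  also have "\<dots> \<le> (LINT x|lborel. (4 / (pi * r ^ 3) * norm (z - z')) * (indicator K x *\<^sub>R \<bar>v x\<bar>))"
  proof (rule integral_mono)
    show "integrable lborel (\<lambda>x. \<bar>bump r (x - z) * v x - bump r (x - z') * v x\<bar>)" using i by simp
    show "integrable lborel (\<lambda>x. (4 / (pi * r ^ 3) * norm (z - z')) * (indicator K x *\<^sub>R \<bar>v x\<bar>))"
      using ab unfolding set_integrable_def by (rule integrable_mult_right)
    fix x :: complex
    show "\<bar>bump r (x - z) * v x - bump r (x - z') * v x\<bar> \<le> (4 / (pi * r ^ 3) * norm (z - z')) * (indicator K x *\<^sub>R \<bar>v x\<bar>)"
    proof (cases "x \<in> K")
      case True
      have "\<bar>bump r (x - z) - bump r (x - z')\<bar> * \<bar>v x\<bar> \<le> (4 / (pi * r ^ 3) * norm (z - z')) * \<bar>v x\<bar>"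
        using bump_lipschitz[OF assms(1), of "x - z" "x - z'"] by (intro mult_right_mono) (auto simp: norm_minus_commute)
      then show ?thesis using True by (simp add: abs_mult flip: left_diff_distrib)
    next
      case False
      then have "x \<notin> cball z r" "x \<notin> cball z' r" using assms by auto
      then have "bump r (x - z) = 0" "bump r (x - z') = 0"
        by (auto intro!: bump_eq_0 assms simp: dist_norm norm_minus_commute)
      then show ?thesis using False by simp
    qed
  qed
  also have "\<dots> = 4 / (pi * r ^ 3) * (LINT x:K|lborel. \<bar>v x\<bar>) * norm (z - z')"
    by (simp add: set_lebesgue_integral_def)
  finally show ?thesis .
qed

text \<open>
  The exterior point \<open>q\<close> is the pole of the logarithm that controls the behaviour at infinity in the
  barriers.
\<close>

locale green_domain =
  fixes D :: "complex set" and q :: complex and G :: "complex \<Rightarrow> complex \<Rightarrow> real"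
  assumes open_D: "open D" and bounded_frontier: "bounded (frontier D)"
    and q_ext: "q \<notin> closure D" and green: "green_function D G"
begin

definition irregular :: "complex \<Rightarrow> complex set" where
  "irregular y = {z \<in> frontier D. \<not> ((\<lambda>x. G x y) \<longlongrightarrow> 0) (at z within D)}"

lemma polar_irregular: "y \<in> D \<Longrightarrow> polar (irregular y)"
  using green by (simp add: green_function_def irregular_def)

lemma green_tendsto_0: "z \<in> frontier D - irregular y \<Longrightarrow> ((\<lambda>x. G x y) \<longlongrightarrow> 0) (at z within D)"
  by (auto simp: irregular_def)

lemma continuous_off_pole: "y \<in> D \<Longrightarrow> continuous_on (D - {y}) (\<lambda>x. G x y)"
  using green by (simp add: green_function_def)

lemma integrable_compact: "y \<in> D \<Longrightarrow> compact K \<Longrightarrow> K \<subseteq> D \<Longrightarrow> set_integrable lborel K (\<lambda>x. G x y)"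
  using green by (simp add: green_function_def minus_laplacian_eq_delta_def)

lemma bounded_off_pole:
  assumes "y \<in> D" "r > 0"
  obtains B where "\<And>x. x \<in> D \<Longrightarrow> r \<le> dist y x \<Longrightarrow> \<bar>G x y\<bar> \<le> B"
proof -
  have "bounded ((\<lambda>x. G x y) ` (D - ball y r))"
    using green assms by (simp add: green_function_def)
  then obtain B where "\<forall>x\<in>D - ball y r. \<bar>G x y\<bar> \<le> B" by (auto simp: bounded_iff)
  then show ?thesis by (intro that[of B]) auto
qed

text \<open>
  The difference of two smoothed logarithms at \<open>z\<close> is a test function; its Laplacian is the
  difference of two bumps.
\<close>

lemma avg_change_radius:
  assumes "y \<in> D" "0 < r" "r < R" "cball z R \<subseteq> D"
  shows "avg r (\<lambda>x. G x y) z - avg R (\<lambda>x. G x y) z = (smooth_log R (z - y) - smooth_log r (z - y)) / (2 * pi)"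
proof -
  let ?p = "\<lambda>x::complex. smooth_log R (x - z) - smooth_log r (x - z)"
  have R: "R > 0" using assms by simp
  note t = twice_cont_diff_smooth_log[OF R, of z] twice_cont_diff_smooth_log[OF assms(2), of z]
  have "test_function D ?p"
    unfolding test_function_def
  proof (intro conjI exI[of _ "cball z R"] allI impI)
    show "twice_cont_diff ?p" by (rule twice_cont_diff_diff[OF t])
    fix x assume "x \<notin> cball z R"
    then have "R \<le> norm (x - z)" by (simp add: dist_norm norm_minus_commute)
    then show "?p x = 0" using assms R by (simp add: smooth_log_eq_ln)
  qed (use assms in auto)
  then have "- (LINT x|lborel. G x y * laplacian ?p x) = ?p y"
    using green assms by (simp add: green_function_def minus_laplacian_eq_delta_def)
  moreover have "G x y * laplacian ?p x = 2 * pi * (bump R (x - z) * G x y - bump r (x - z) * G x y)" for x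
    by (simp add: laplacian_diff[OF t] laplacian_smooth_log R assms algebra_simps)
  moreover have "set_integrable lborel (cball z R) (\<lambda>x. G x y)" "set_integrable lborel (cball z r) (\<lambda>x. G x y)"
    using assms by (auto intro!: integrable_compact elim: order_trans[rotated])
  then have "integrable lborel (\<lambda>x. bump R (x - z) * G x y)" "integrable lborel (\<lambda>x. bump r (x - z) * G x y)"
    using R assms by (auto intro: integrable_bump_mult')
  ultimately have "2 * pi * (avg r (\<lambda>x. G x y) z - avg R (\<lambda>x. G x y) z) = ?p y"
    unfolding avg_def by (simp add: right_diff_distrib)
  moreover have "?p y = smooth_log R (z - y) - smooth_log r (z - y)"
    by (simp add: smooth_log_minus[of _ z y])
  ultimately show ?thesis by (simp add: field_simps)
qed

text \<open>
  The limit of the preceding identity as the smaller radius tends to 0.  Off the pole it says that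
  Green's function is harmonic.  Across the pole it shows that $G + \ln|z-y|/(2\pi)$ equals a function
  that is locally Lipschitz in \<open>z\<close>, so it has a continuous extension.
\<close>

lemma green_eq_avg:
  assumes "y \<in> D" "0 < R" "cball z R \<subseteq> D" "z \<noteq> y"
  shows "G z y = avg R (\<lambda>x. G x y) z + (smooth_log R (z - y) - ln (norm (z - y))) / (2 * pi)"
proof -
  let ?u = "\<lambda>x. G x y"
  define R' where "R' = min R (norm (z - y) / 2)"
  have R': "R' > 0" using assms by (simp add: R'_def)
  have "y \<notin> cball z R'" using assms by (auto simp: R'_def dist_norm min_def split: if_splits)
  then have "cball z R' \<subseteq> D - {y}" using assms by (auto simp: R'_def)
  then have c: "continuous_on (cball z R') ?u"
    using continuous_off_pole[OF assms(1)] by (rule continuous_on_subset[rotated])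
  have "\<bar>(avg R ?u z + (smooth_log R (z - y) - ln (norm (z - y))) / (2 * pi)) - ?u z\<bar> \<le> e" if e: "e > 0" for e
  proof -
    from avg_limit[OF c R' e] obtain d where d: "d > 0" "\<And>r. 0 < r \<Longrightarrow> r < d \<Longrightarrow> \<bar>avg r ?u z - ?u z\<bar> \<le> e"
      by blast
    define r where "r = min d R' / 2"
    have r: "0 < r" "r < d" "r < R'" using d R' by (auto simp: r_def)
    then have r': "r < R" "r \<le> norm (z - y)" using assms(2) by (auto simp: R'_def)
    show ?thesis using avg_change_radius[OF assms(1) r(1) r'(1) assms(3)] d(2)[OF r(1,2)]
        smooth_log_eq_ln[OF r(1) r'(2)] by simp
  qed
  then have "\<bar>(avg R ?u z + (smooth_log R (z - y) - ln (norm (z - y))) / (2 * pi)) - ?u z\<bar> \<le> 0"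
    by (rule field_le_epsilon) simp
  then show ?thesis by simp
qed

lemma harmonic_off_pole:
  assumes "y \<in> D"
  shows "harmonic (D - {y}) (\<lambda>x. G x y)"
  unfolding harmonic_def
proof (intro conjI allI impI continuous_off_pole assms)
  fix z r assume r: "0 < r" "cball z r \<subseteq> D - {y}"
  then have "y \<notin> cball z r" by auto
  then have "r \<le> norm (z - y)" "z \<noteq> y" using r by (auto simp: dist_norm)
  then show "avg r (\<lambda>x. G x y) z = G z y"
    using green_eq_avg[OF assms r(1) _, of z] r(2) smooth_log_eq_ln[OF r(1), of "z - y"] by (auto simp: subset_Diff_insert)
qed

text \<open>
  The expression compared at \<open>z\<close> and \<open>z'\<close> is the one found in \<open>green_eq_avg\<close> for the regular
  part.  The constant depends on the pole only through the integral of $|G|$ over one disc.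
\<close>

lemma regular_part_lipschitz:
  assumes "y \<in> D" "0 < r" "cball z0 (2 * r) \<subseteq> D" "z \<in> cball z0 r" "z' \<in> cball z0 r"
  shows "\<bar>(avg r (\<lambda>x. G x y) z + smooth_log r (z - y) / (2 * pi)) - (avg r (\<lambda>x. G x y) z' + smooth_log r (z' - y) / (2 * pi))\<bar>
     \<le> (4 / (pi * r ^ 3) * (LINT x:cball z0 (2 * r)|lborel. \<bar>G x y\<bar>) + 1 / (pi * r)) * norm (z - z')"
proof -
  have "\<bar>avg r (\<lambda>x. G x y) z - avg r (\<lambda>x. G x y) z'\<bar> \<le> 4 / (pi * r ^ 3) * (LINT x:cball z0 (2 * r)|lborel. \<bar>G x y\<bar>) * norm (z - z')"
    by (rule avg_lipschitz) (use assms cball_double in \<open>auto intro!: integrable_compact\<close>)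
  moreover have "\<bar>smooth_log r (z - y) / (2 * pi) - smooth_log r (z' - y) / (2 * pi)\<bar> \<le> 1 / (pi * r) * norm (z - z')"
  proof -
    have "\<bar>smooth_log r (z - y) - smooth_log r (z' - y)\<bar> / (2 * pi) \<le> (2 / r * norm (z - z')) / (2 * pi)"
      using smooth_log_lipschitz[OF assms(2), of "z - y" "z' - y"] by (intro divide_right_mono) auto
    then show ?thesis by (simp add: field_simps flip: diff_divide_distrib)
  qed
  ultimately show ?thesis unfolding distrib_right by linarith
qed

lemma regular_part_bounded_near_pole:
  assumes "y \<in> D"
  obtains r B where "r > 0" "cball y r \<subseteq> D" "\<And>x. x \<in> cball y r \<Longrightarrow> x \<noteq> y \<Longrightarrow> \<bar>G x y + ln (norm (x - y)) / (2 * pi)\<bar> \<le> B"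
proof -
  obtain e where e: "e > 0" "cball y e \<subseteq> D" using open_D assms by (auto simp: open_contains_cball)
  define r where "r = e / 2"
  have r: "r > 0" "cball y (2 * r) \<subseteq> D" using e by (auto simp: r_def)
  define A where "A z = avg r (\<lambda>x. G x y) z + smooth_log r (z - y) / (2 * pi)" for z
  define L where "L = 4 / (pi * r ^ 3) * (LINT x:cball y (2 * r)|lborel. \<bar>G x y\<bar>) + 1 / (pi * r)"
  have Lnn: "L \<ge> 0" unfolding L_def set_lebesgue_integral_def using r
    by (intro add_nonneg_nonneg mult_nonneg_nonneg Bochner_Integration.integral_nonneg) auto
  have GA: "G x y + ln (norm (x - y)) / (2 * pi) = A x" if "x \<in> cball y r" "x \<noteq> y" for x
  proof -
    have "cball x r \<subseteq> D" using cball_double[OF that(1)] r by blast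
    from green_eq_avg[OF assms r(1) this that(2)] show ?thesis by (simp add: A_def diff_divide_distrib)
  qed
  show ?thesis
  proof (rule that[of r "\<bar>A y\<bar> + L * r"])
    show "cball y r \<subseteq> D" using r by (auto simp: subset_eq)
    fix x assume x: "x \<in> cball y r" "x \<noteq> y"
    have "\<bar>A x - A y\<bar> \<le> L * norm (x - y)"
      unfolding A_def L_def using r x by (intro regular_part_lipschitz assms) auto
    also have "\<dots> \<le> L * r" using Lnn x by (intro mult_left_mono) (auto simp: dist_norm norm_minus_commute)
    finally show "\<bar>G x y + ln (norm (x - y)) / (2 * pi)\<bar> \<le> \<bar>A y\<bar> + L * r"
      unfolding GA[OF x] by linarith
  qed (use r in auto)
qed

lemma regular_part_bounded:
  assumes "y \<in> D"
  obtains B where "\<And>x. x \<in> D \<Longrightarrow> x \<noteq> y \<Longrightarrow> norm x \<le> M \<Longrightarrow> \<bar>G x y + ln (norm (x - y)) / (2 * pi)\<bar> \<le> B"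
proof -
  obtain r B where r: "r > 0" "cball y r \<subseteq> D" and B: "\<And>x. x \<in> cball y r \<Longrightarrow> x \<noteq> y \<Longrightarrow> \<bar>G x y + ln (norm (x - y)) / (2 * pi)\<bar> \<le> B"
    by (rule regular_part_bounded_near_pole[OF assms]) blast
  obtain B' where B': "\<And>x. x \<in> D \<Longrightarrow> r \<le> dist y x \<Longrightarrow> \<bar>G x y\<bar> \<le> B'"
    by (rule bounded_off_pole[OF assms r(1)]) blast
  define L where "L = max \<bar>ln r\<bar> \<bar>ln (M + norm y)\<bar>"
  show ?thesis
  proof (rule that[of "max B (B' + L / (2 * pi))"])
    fix x assume x: "x \<in> D" "x \<noteq> y" "norm x \<le> M"
    show "\<bar>G x y + ln (norm (x - y)) / (2 * pi)\<bar> \<le> max B (B' + L / (2 * pi))"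
    proof (cases "x \<in> cball y r")
      case True
      then show ?thesis using B[of x] x by auto
    next
      case False
      then have d: "r \<le> norm (x - y)" by (simp add: dist_norm norm_minus_commute)
      have "norm (x - y) \<le> M + norm y" using norm_triangle_ineq4[of x y] x by simp
      moreover have "ln r \<le> ln (norm (x - y))" using d r by (intro ln_mono) auto
      moreover have "ln (norm (x - y)) \<le> ln (M + norm y)" using calculation(1) x(2) by (intro ln_mono) auto
      ultimately have "\<bar>ln (norm (x - y))\<bar> \<le> L" by (auto simp: L_def)
      then have "\<bar>ln (norm (x - y)) / (2 * pi)\<bar> \<le> L / (2 * pi)" by (simp add: divide_right_mono)
      moreover have "\<bar>G x y\<bar> \<le> B'" using B'[of x] x d by (simp add: dist_norm norm_minus_commute)
      ultimately show ?thesis by linarith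
    qed
  qed
qed

text \<open>
  The bound on the regular part shows that $-G$ is bounded above near the pole, so the maximum principle
  applies to $-G$ off the pole.
\<close>

lemma green_nonneg:
  assumes "x \<in> D" "y \<in> D" "x \<noteq> y"
  shows "0 \<le> G x y"
proof -
  obtain r B where r: "r > 0" "cball y r \<subseteq> D" and B: "\<And>x. x \<in> cball y r \<Longrightarrow> x \<noteq> y \<Longrightarrow> \<bar>G x y + ln (norm (x - y)) / (2 * pi)\<bar> \<le> B"
    by (rule regular_part_bounded_near_pole[OF assms(2)]) blast
  define r' where "r' = min r 1"
  have r': "r' > 0" using r by (simp add: r'_def)
  obtain B' where B': "\<And>x. x \<in> D \<Longrightarrow> r' \<le> dist y x \<Longrightarrow> \<bar>G x y\<bar> \<le> B'"
    by (rule bounded_off_pole[OF assms(2) r']) blast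
  have "- G x y \<le> 0"
  proof (rule max_principle[OF open_D bounded_frontier q_ext, where F = "{y}" and E = "irregular y" and B = "max B B'" and f = "\<lambda>x. - G x y"])
    show "subharmonic (D - {y}) (\<lambda>x. - G x y)"
      by (intro harmonic_imp_subharmonic harmonic_minus harmonic_off_pole assms)
    show "polar (irregular y)" by (rule polar_irregular[OF assms(2)])
    fix w assume w: "w \<in> D - {y}"
    show "- G w y \<le> max B B'"
    proof (cases "dist y w < r'")
      case True
      then have "norm (w - y) \<le> 1" "w \<in> cball y r" "w \<noteq> y" using w by (auto simp: r'_def dist_norm norm_minus_commute)
      then have "ln (norm (w - y)) / (2 * pi) \<le> 0" by (intro divide_nonpos_pos) auto
      then show ?thesis using B[of w] \<open>w \<in> cball y r\<close> \<open>w \<noteq> y\<close> by fastforce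
    next
      case False
      then show ?thesis using B'[of w] w by fastforce
    qed
  next
    fix z c assume "z \<in> frontier D - irregular y" "0 < (c::real)"
    from tendsto_within_subset[OF green_tendsto_0[OF this(1)], of "D - {y}"]
    have "((\<lambda>x. - G x y) \<longlongrightarrow> - 0) (at z within D - {y})" by (intro tendsto_minus) auto
    then show "\<forall>\<^sub>F x in at z within D - {y}. - G x y < c"
      using \<open>0 < c\<close> by (auto elim!: order_tendstoD)
  qed (use assms in auto)
  then show ?thesis by simp
qed

end



section \<open>Symmetry of Green's functions\<close>

text \<open>
  The amount by which Green's function exceeds its average over a disc of radius \<open>r\<close>, as a function
  of the position relative to the pole.
\<close>

definition log_defect :: "real \<Rightarrow> complex \<Rightarrow> real" where
  "log_defect r x = (smooth_log r x - ln (norm x)) / (2 * pi)"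

lemma log_defect_nonneg: "0 < r \<Longrightarrow> x \<noteq> 0 \<Longrightarrow> 0 \<le> log_defect r x"
  using ln_le_smooth_log[of r x] by (simp add: log_defect_def)

lemma log_defect_pos: "0 < r \<Longrightarrow> x \<noteq> 0 \<Longrightarrow> norm x < r \<Longrightarrow> 0 < log_defect r x"
  using ln_less_smooth_log[of r x] by (simp add: log_defect_def)

lemma log_defect_eq_0: "0 < r \<Longrightarrow> r \<le> norm x \<Longrightarrow> log_defect r x = 0"
  by (simp add: log_defect_def smooth_log_eq_ln)

lemma borel_measurable_log_defect: "0 < r \<Longrightarrow> log_defect r \<in> borel_measurable borel"
  unfolding log_defect_def
  using borel_measurable_continuous_onI[OF continuous_smooth_log[of r UNIV]] by measurable

lemma integrable_translate:
  fixes f :: "complex \<Rightarrow> real"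
  assumes "f \<in> borel_measurable borel"
  shows "integrable lborel (\<lambda>x. f (x + c)) \<longleftrightarrow> integrable lborel f"
proof -
  have "integrable lborel f \<longleftrightarrow> integrable (distr lborel borel ((+) c)) f"
    by (simp add: lborel_distr_plus)
  also have "\<dots> \<longleftrightarrow> integrable lborel (\<lambda>x. f (c + x))"
    using assms by (subst integrable_distr_eq) auto
  finally show ?thesis by (simp add: add.commute)
qed

lemma integral_log_defect_pos:
  assumes "0 < r" "integrable lborel (log_defect r)"
  shows "0 < (LINT x|lborel. log_defect r x)"
proof -
  have ae: "AE x in lborel. 0 \<le> log_defect r x"
    using AE_lborel_singleton[of 0] by eventually_elim (rule log_defect_nonneg[OF assms(1)])
  have "(LINT x|lborel. log_defect r x) \<noteq> 0"
  proof
    assume "(LINT x|lborel. log_defect r x) = 0"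
    then have "AE x in lborel. log_defect r x = 0"
      using integral_nonneg_eq_0_iff_AE[OF assms(2) ae] by simp
    then have z: "AE x in lebesgue. log_defect r x = 0" by (rule AE_completion)
    have pos: "log_defect r x = 0 \<Longrightarrow> norm x < r \<Longrightarrow> x = 0" for x
      using log_defect_pos[OF assms(1), of x] by force
    have "complex_of_real (r / 2) \<in> {}"
    proof (rule mem_closed_if_AE_lebesgue_open)
      show "open (ball 0 r - {0 :: complex})" by (intro open_Diff) auto
      show "AE x\<in>ball 0 r - {0 :: complex} in lebesgue. x \<in> {}"
        using z by eventually_elim (auto dest: pos)
    qed (use assms in auto)
    then show False by simp
  qed
  moreover have "0 \<le> (LINT x|lborel. log_defect r x)" by (rule integral_nonneg_AE[OF ae])
  ultimately show ?thesis by simp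
qed

lemma integrable_lborel_product:
  fixes f g :: "complex \<Rightarrow> real"
  assumes f: "integrable lborel f" and g: "integrable lborel g"
  shows "integrable (lborel \<Otimes>\<^sub>M lborel) (\<lambda>(x, y). f x * g y)"
proof (rule lborel_pair.Fubini_integrable)
  show "(\<lambda>(x, y). f x * g y) \<in> borel_measurable (lborel \<Otimes>\<^sub>M lborel)"
    using borel_measurable_integrable[OF f] borel_measurable_integrable[OF g] by measurable
  show "integrable lborel (\<lambda>x. LINT y|lborel. norm (case (x, y) of (x, y) \<Rightarrow> f x * g y))"
    using f g by (simp add: abs_mult)
  show "AE x in lborel. integrable lborel (\<lambda>y. case (x, y) of (x, y) \<Rightarrow> f x * g y)"
    using g by simp
qed

context green_domain
begin

lemma avg_defect:
  assumes "y \<in> D" "0 < r" "cball z r \<subseteq> D" "z \<noteq> y"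
  shows "G z y - avg r (\<lambda>x. G x y) z = log_defect r (z - y)"
  using green_eq_avg[OF assms] by (simp add: log_defect_def)

text \<open>
  Near the pole the defect is the difference of \<open>G\<close>, which is integrable by hypothesis, and of its
  continuous average.
\<close>

lemma integrable_log_defect:
  assumes "y \<in> D" "0 < r" "cball y (2 * r) \<subseteq> D"
  shows "integrable lborel (log_defect r)"
proof -
  let ?u = "\<lambda>x. G x y"
  note sub = cball_double[of _ y r]
  define L where "L = 4 / (pi * r ^ 3) * (LINT x:cball y (2 * r)|lborel. \<bar>?u x\<bar>)"
  have L: "0 \<le> L" unfolding L_def set_lebesgue_integral_def using assms
    by (intro mult_nonneg_nonneg Bochner_Integration.integral_nonneg) auto
  have "L-lipschitz_on (cball y r) (avg r ?u)"
  proof (rule lipschitz_onI[OF _ L])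
    fix p p' assume "p \<in> cball y r" "p' \<in> cball y r"
    then show "dist (avg r ?u p) (avg r ?u p') \<le> L * dist p p'"
      unfolding dist_norm real_norm_def L_def using assms sub
      by (intro avg_lipschitz) (auto intro!: integrable_compact)
  qed
  then have "continuous_on (cball y r) (avg r ?u)" by (rule lipschitz_on_continuous_on)
  then have a: "set_integrable lborel (cball y r) (avg r ?u)" by (rule set_integrable_continuous_cball)
  have "cball y r \<subseteq> D" using sub[of y] assms by auto
  then have u: "set_integrable lborel (cball y r) ?u" using assms by (intro integrable_compact) auto
  have i: "integrable lborel (\<lambda>x. indicator (cball y r) x *\<^sub>R (?u x - avg r ?u x))"
    using set_integral_diff(1)[OF u a] by (simp add: set_integrable_def)
  have m: "(\<lambda>x. log_defect r (x - y)) \<in> borel_measurable lborel"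
    using borel_measurable_log_defect[OF assms(2)] by measurable
  have "AE x in lborel. indicator (cball y r) x *\<^sub>R (?u x - avg r ?u x) = log_defect r (x - y)"
    using AE_lborel_singleton[of y]
  proof eventually_elim
    case (elim x)
    show ?case
    proof (cases "x \<in> cball y r")
      case True
      then have "cball x r \<subseteq> D" using sub[OF True] assms(3) by blast
      from avg_defect[OF assms(1,2) this elim] True show ?thesis by simp
    next
      case False
      then show ?thesis using log_defect_eq_0[OF assms(2), of "x - y"] by (simp add: dist_norm norm_minus_commute)
    qed
  qed
  then have "integrable lborel (\<lambda>x. log_defect r (x - y))"
    using integrable_cong_AE[OF borel_measurable_integrable[OF i] m] i by simp
  then show ?thesis using integrable_translate[OF borel_measurable_log_defect[OF assms(2)], of "- y"] by simp
qed

text \<open>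
  Write $u = G(\cdot,a)$, $v = G(\cdot,b)$, $k$ for the defect and \<open>avg\<close> for the average at scale
  \<open>r\<close>.  Let $U$ be the positive part of $u$ minus a small constant and a small multiple of a barrier;
  it has compact support in \<open>D\<close>.  Averaging is self-adjoint, hence
  $$\int v\,(U - \mathrm{avg}\,U) = \int (v - \mathrm{avg}\,v)\,U = \int k(x-b)\,U(x)\,dx .$$
  Apart from its pole $U$ is subharmonic, so $U - \mathrm{avg}\,U \le k(\cdot-a)$; as $v \ge 0$, this
  gives $\int k(x-b)\,U(x)\,dx \le \int k(x-a)\,v(x)\,dx$.  For small \<open>r\<close> both sides are close to
  $\int k$ times $U(b)$ and $v(a)$, so $U(b) \le v(a)$ up to a small error.  Only one inequality is
  obtained, but \<open>a\<close> and \<open>b\<close> can be interchanged.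
\<close>

lemma green_symmetric_le:
  assumes a: "a \<in> D" and b: "b \<in> D" and ab: "a \<noteq> b"
  shows "G b a \<le> G a b"
proof -
  let ?u = "\<lambda>x. G x a" and ?v = "\<lambda>x. G x b"
  obtain s1 where s1: "s1 > 0" "cball a s1 \<subseteq> D" "b \<notin> cball a s1"
  proof -
    have "open (D - {b})" "a \<in> D - {b}" using open_D a ab by auto
    then obtain s where "s > 0" "cball a s \<subseteq> D - {b}" using open_contains_cball by blast
    then show ?thesis by (intro that[of s]) auto
  qed
  obtain Bu where Bu: "\<And>x. x \<in> D \<Longrightarrow> s1 \<le> dist a x \<Longrightarrow> \<bar>?u x\<bar> \<le> Bu"
    by (rule bounded_off_pole[OF a s1(1)]) blast
  obtain C where C: "\<And>e. 0 < e \<Longrightarrow> \<exists>P K. barrier D b C P \<and> compact K \<and> cball a s1 \<subseteq> K \<and> K \<subseteq> D \<and>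
      (\<forall>x\<in>D - K. ?u x \<le> e + e * P x)"
  proof (rule polar_exhaustion[OF open_D bounded_frontier q_ext polar_irregular[OF a] b])
    fix x assume "x \<in> D - cball a s1"
    then show "?u x \<le> Bu" using Bu[of x] by auto
  next
    fix z c assume "z \<in> frontier D - irregular a" "0 < (c::real)"
    then show "\<forall>\<^sub>F x in at z within D. G x a < c" by (auto intro: order_tendstoD[OF green_tendsto_0])
  qed (use s1 in auto)
  have main: "?u b - e - e * C - e \<le> ?v a + e" if e: "e > 0" for e
  proof -
    from C[OF e] obtain P K where P: "subharmonic D (\<lambda>x. - P x)" "\<And>x. x \<in> D \<Longrightarrow> 0 \<le> P x" "P b \<le> C"
      and K: "compact K" "cball a s1 \<subseteq> K" "K \<subseteq> D" "\<And>x. x \<in> D - K \<Longrightarrow> ?u x \<le> e + e * P x"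
      by (auto simp: barrier_def)
    define w where "w x = ?u x + (- e + e * (- P x))" for x
    have P': "subharmonic D (\<lambda>x. - e + e * (- P x))"
      by (intro subharmonic_add harmonic_imp_subharmonic[OF harmonic_const] subharmonic_cmult P(1)) (use e in auto)
    then have Pc: "continuous_on D (\<lambda>x. - e + e * (- P x))" by (simp add: subharmonic_def)
    have wc: "continuous_on (D - {a}) w" unfolding w_def
      by (intro continuous_on_add continuous_off_pole a continuous_on_subset[OF Pc]) auto
    have wu: "w x \<le> ?u x" if "x \<in> D" for x
    proof -
      have "0 \<le> e * P x" using P(2)[OF that] e by simp
      then show ?thesis using e by (simp add: w_def)
    qed
    (* The value at the pole, where G is arbitrary, is replaced by 0 to keep U measurable and nonnegative. *)
    define U where "U x = indicator (D - {a}) x *\<^sub>R max (w x) 0" for x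
    have oDa: "open (D - {a})" and oDb: "open (D - {b})" using open_D by auto
    have Um: "U \<in> borel_measurable borel" unfolding U_def
      using oDa by (intro borel_measurable_continuous_on_indicator continuous_intros wc) auto
    have U0: "U x = 0" if "x \<notin> K" for x
      using K(4)[of x] that by (cases "x \<in> D") (auto simp: U_def w_def indicator_def max_def)
    have Unn: "0 \<le> U x" for x by (simp add: U_def indicator_def)
    have Uw: "w x \<le> U x" if "x \<in> D" "x \<noteq> a" for x using that by (simp add: U_def)
    have Uu: "U x \<le> ?u x" if "x \<in> D" "x \<noteq> a" for x
      using that wu green_nonneg[OF that(1) a that(2)] by (simp add: U_def)
    have Ui: "integrable lborel U"
    proof (rule Bochner_Integration.integrable_bound)
      show "integrable lborel (\<lambda>x. indicator K x *\<^sub>R ?u x)"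
        using integrable_compact[OF a K(1,3)] by (simp add: set_integrable_def)
      show "AE x in lborel. norm (U x) \<le> norm (indicator K x *\<^sub>R ?u x)"
        using AE_lborel_singleton[of a]
      proof eventually_elim
        case (elim x)
        show ?case
        proof (cases "x \<in> K")
          case True
          then have "x \<in> D" using K by auto
          then show ?thesis using True Uu[OF _ elim] Unn[of x] by simp
        qed (simp add: U0)
      qed
    qed (use Um in simp)
    (* Bounds for the averaging scale: discs about points of the support stay in D, and near b and a the
       functions w and v do not fall below, respectively exceed, their values there by more than e. *)
    obtain s2 where s2: "s2 > 0" "\<And>x y. x \<in> K \<Longrightarrow> y \<notin> D \<Longrightarrow> s2 \<le> dist x y"
    proof -
      have "K \<inter> (- D) = {}" using K by auto
      then have "\<exists>d>0. \<forall>x\<in>K. \<forall>y\<in>- D. d \<le> dist x y"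
        using K(1) open_D by (intro separate_compact_closed) auto
      then show ?thesis using that by auto
    qed
    obtain s3 where s3: "s3 > 0" "ball b s3 \<subseteq> D - {a}" "\<And>x. x \<in> ball b s3 \<Longrightarrow> w b - e \<le> w x"
    proof -
      have "b \<in> D - {a}" using b ab by auto
      have "isCont w b" using wc oDa \<open>b \<in> D - {a}\<close> by (simp add: continuous_on_eq_continuous_at)
      then obtain s where s: "s > 0" "\<And>x. dist x b < s \<Longrightarrow> dist (w x) (w b) < e"
        using e by (auto simp: continuous_at_eps_delta dist_norm)
      obtain s' where s': "s' > 0" "ball b s' \<subseteq> D - {a}" using oDa \<open>b \<in> D - {a}\<close> open_contains_ball by blast
      show ?thesis
      proof (rule that[of "min s s'"])
        fix x assume "x \<in> ball b (min s s')"
        then show "w b - e \<le> w x" using s(2)[of x] by (auto simp: dist_commute dist_real_def)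
      qed (use s s' in auto)
    qed
    obtain s4 where s4: "s4 > 0" "ball a s4 \<subseteq> D - {b}" "\<And>x. x \<in> ball a s4 \<Longrightarrow> ?v x \<le> ?v a + e"
    proof -
      have "a \<in> D - {b}" using a ab by auto
      have "isCont ?v a" using continuous_off_pole[OF b] oDb \<open>a \<in> D - {b}\<close> by (simp add: continuous_on_eq_continuous_at)
      then obtain s where s: "s > 0" "\<And>x. dist x a < s \<Longrightarrow> dist (?v x) (?v a) < e"
        using e by (auto simp: continuous_at_eps_delta dist_norm)
      obtain s' where s': "s' > 0" "ball a s' \<subseteq> D - {b}" using oDb \<open>a \<in> D - {b}\<close> open_contains_ball by blast
      show ?thesis
      proof (rule that[of "min s s'"])
        fix x assume "x \<in> ball a (min s s')"
        then show "?v x \<le> ?v a + e" using s(2)[of x] by (auto simp: dist_commute dist_real_def)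
      qed (use s s' in auto)
    qed
    define r where "r = min s2 (min s3 (min s4 s1)) / 3"
    have r: "0 < r" "2 * r < s2" "2 * r < s3" "r < s4" "r < s1" using s1 s2 s3 s4 by (auto simp: r_def)
    define K' where "K' = (\<Union>x\<in>K. \<Union>y\<in>cball 0 r. {x + y})"
    have K': "compact K'" unfolding K'_def using compact_sums'[OF K(1) compact_cball[of 0 r]] by simp
    have KK': "cball x r \<subseteq> K'" if "x \<in> K" for x
    proof
      fix p assume "p \<in> cball x r"
      then have "p - x \<in> cball 0 r" "p = x + (p - x)" by (auto simp: dist_norm norm_minus_commute)
      then show "p \<in> K'" using that unfolding K'_def by blast
    qed
    have K'D: "cball y r \<subseteq> D" if "y \<in> K'" for y
    proof
      fix p assume p: "p \<in> cball y r"
      from that obtain x z where x: "x \<in> K" "z \<in> cball 0 r" "y = x + z" by (auto simp: K'_def)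
      have "dist x y \<le> r" using x by (simp add: dist_norm)
      then have "dist x p < s2" using p dist_triangle[of x p y] r by simp
      then show "p \<in> D" using s2(2)[OF x(1), of p] by force
    qed
    then have K'sub: "K' \<subseteq> D" using r by force
    let ?k = "log_defect r"
    have ki: "integrable lborel ?k"
      by (rule integrable_log_defect[OF b r(1)]) (use s3(2) r(3) in \<open>auto simp: subset_eq\<close>)
    have kia: "integrable lborel (\<lambda>x. ?k (x - c))" for c
      using integrable_translate[OF borel_measurable_log_defect[OF r(1)], of "- c"] ki by simp
    have kint: "(LINT x|lborel. ?k (x - c)) = (LINT x|lborel. ?k x)" for c
      using integral_translate[OF borel_measurable_log_defect[OF r(1)], of "- c"] by simp
    define v where "v x = indicator K' x *\<^sub>R ?v x" for x
    have vi: "integrable lborel v"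
      using integrable_compact[OF b K' K'sub] unfolding v_def set_integrable_def .
    have va_nn: "0 \<le> ?v a" by (rule green_nonneg[OF a b ab])
    obtain Bv where Bv: "\<And>x. x \<in> cball a s1 \<Longrightarrow> \<bar>?v x\<bar> \<le> Bv"
    proof -
      have "cball a s1 \<subseteq> D - {b}" using s1 by auto
      then have "continuous_on (cball a s1) ?v" using continuous_off_pole[OF b] by (rule continuous_on_subset[rotated])
      then have "bounded (?v ` cball a s1)" by (intro compact_imp_bounded compact_continuous_image) auto
      then obtain B where "\<forall>x\<in>cball a s1. \<bar>?v x\<bar> \<le> B" by (auto simp: bounded_iff)
      then show ?thesis by (intro that[of B]) auto
    qed
    have Uvi: "integrable lborel (\<lambda>x. U x * v x)"
    proof (rule Bochner_Integration.integrable_bound)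
      show "integrable lborel (\<lambda>x. Bv * \<bar>U x\<bar> + Bu * \<bar>v x\<bar>)" using Ui vi by simp
      show "(\<lambda>x. U x * v x) \<in> borel_measurable lborel"
        using borel_measurable_integrable[OF Ui] borel_measurable_integrable[OF vi] by measurable
      have Bv0: "0 \<le> Bv" using Bv[of a] s1 by force
      show "AE x in lborel. norm (U x * v x) \<le> norm (Bv * \<bar>U x\<bar> + Bu * \<bar>v x\<bar>)"
        using AE_lborel_singleton[of a]
      proof eventually_elim
        case (elim x)
        have Bu0: "0 \<le> Bu" using Bu[OF b] s1(3) by force
        have "\<bar>U x * v x\<bar> \<le> Bv * \<bar>U x\<bar> + Bu * \<bar>v x\<bar>"
        proof (cases "x \<in> cball a s1")
          case True
          then have "\<bar>v x\<bar> \<le> Bv" using Bv[OF True] Bv0 by (auto simp: v_def indicator_def)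
          then have "\<bar>U x\<bar> * \<bar>v x\<bar> \<le> \<bar>U x\<bar> * Bv" by (rule mult_left_mono) simp
          moreover have "0 \<le> Bu * \<bar>v x\<bar>" using Bu0 by simp
          ultimately show ?thesis by (simp add: abs_mult mult.commute)
        next
          case False
          have "\<bar>U x\<bar> \<le> Bu"
          proof (cases "x \<in> D")
            case True
            then have "\<bar>?u x\<bar> \<le> Bu" using False by (intro Bu) auto
            then show ?thesis using Uu[OF True elim] Unn[of x] by simp
          qed (use Bu0 in \<open>simp add: U_def\<close>)
          then have "\<bar>U x\<bar> * \<bar>v x\<bar> \<le> Bu * \<bar>v x\<bar>" by (rule mult_right_mono) simp
          moreover have "0 \<le> Bv * \<bar>U x\<bar>" using Bv0 by simp
          ultimately show ?thesis by (simp add: abs_mult)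
        qed
        then show ?case by simp
      qed
    qed
    (* Self-adjointness of averaging: both iterated integrals of f. *)
    define f where "f x y = U x * (bump r (y - x) * v y)" for x y
    have [measurable]: "bump r \<in> borel_measurable borel"
      by (rule borel_measurable_continuous_onI[OF continuous_bump])
    have fi: "integrable (lborel \<Otimes>\<^sub>M lborel) (case_prod f)"
    proof (rule Bochner_Integration.integrable_bound)
      show "integrable (lborel \<Otimes>\<^sub>M lborel) (\<lambda>p. 2 / (pi * r\<^sup>2) * (case p of (x, y) \<Rightarrow> U x * v y))"
        by (intro integrable_mult_right integrable_lborel_product Ui vi)
      show "case_prod f \<in> borel_measurable (lborel \<Otimes>\<^sub>M lborel)"
        unfolding f_def using borel_measurable_integrable[OF Ui] borel_measurable_integrable[OF vi] by measurable
      have "bump r x \<le> 2 / (pi * r\<^sup>2) * 1" for x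
        unfolding bump_def using r by (intro mult_left_mono) auto
      then have bb: "\<bar>bump r x\<bar> \<le> 2 / (pi * r\<^sup>2)" for x using bump_nonneg[OF r(1), of x] by simp
      show "AE p in lborel \<Otimes>\<^sub>M lborel. norm (case_prod f p) \<le> norm (2 / (pi * r\<^sup>2) * (case p of (x, y) \<Rightarrow> U x * v y))"
      proof (rule AE_I2)
        fix p :: "complex \<times> complex"
        obtain x y where p: "p = (x, y)" by (cases p)
        have "\<bar>bump r (y - x)\<bar> * \<bar>U x * v y\<bar> \<le> 2 / (pi * r\<^sup>2) * \<bar>U x * v y\<bar>"
          by (rule mult_right_mono[OF bb]) simp
        then show "norm (case_prod f p) \<le> norm (2 / (pi * r\<^sup>2) * (case p of (x, y) \<Rightarrow> U x * v y))"
          by (simp add: p f_def abs_mult mult_ac)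
      qed
    qed
    have inner1: "(LINT y|lborel. f x y) = U x * avg r ?v x" for x
    proof (cases "x \<in> K")
      case True
      have eq: "bump r (y - x) * v y = bump r (y - x) * ?v y" for y
        using KK'[OF True] bump_eq_0[OF r(1), of "y - x"]
        by (cases "y \<in> cball x r") (auto simp: v_def dist_norm norm_minus_commute subset_eq)
      have "(LINT y|lborel. bump r (y - x) * v y) = avg r ?v x"
        unfolding avg_def by (rule Bochner_Integration.integral_cong[OF refl eq])
      then show ?thesis by (simp add: f_def)
    qed (simp add: f_def U0)
    have inner2: "(LINT x|lborel. f x y) = v y * avg r U y" for y
    proof -
      have "(LINT x|lborel. f x y) = (LINT x|lborel. v y * (bump r (x - y) * U x))"
        by (intro Bochner_Integration.integral_cong) (auto simp: f_def bump_minus[of r y])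
      then show ?thesis by (simp add: avg_def)
    qed
    have i1: "integrable lborel (\<lambda>x. U x * avg r ?v x)" using lborel_pair.integrable_fst[OF fi] by (simp add: inner1)
    have i2: "integrable lborel (\<lambda>y. v y * avg r U y)" using lborel_pair.integrable_snd[OF fi] by (simp add: inner2)
    have fub: "(LINT x|lborel. U x * avg r ?v x) = (LINT y|lborel. v y * avg r U y)"
      using lborel_pair.Fubini_integral[OF fi] by (simp add: inner1 inner2)
    have Uk: "AE x in lborel. U x * v x - U x * avg r ?v x = U x * ?k (x - b)"
      using AE_lborel_singleton[of b]
    proof eventually_elim
      case (elim x)
      show ?case
      proof (cases "x \<in> K")
        case True
        then have "x \<in> K'" using KK'[OF True] r by auto
        then show ?thesis using avg_defect[OF b r(1) K'D elim] by (simp add: v_def flip: right_diff_distrib)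
      qed (simp add: U0)
    qed
    have Usub: "U y - avg r U y \<le> ?k (y - a)" if y: "y \<in> K'" "y \<noteq> a" for y
    proof -
      have yD: "cball y r \<subseteq> D" "y \<in> D" using K'D[OF y(1)] r by auto
      have sU: "set_integrable lborel (cball y r) U"
        unfolding set_integrable_def by (rule integrable_mult_indicator[OF _ Ui]) simp
      have su: "set_integrable lborel (cball y r) ?u" by (rule integrable_compact[OF a _ yD(1)]) simp
      have sP: "set_integrable lborel (cball y r) (\<lambda>x. - e + e * (- P x))"
        by (rule set_integrable_cball[OF Pc yD(1)])
      have sw: "set_integrable lborel (cball y r) w" unfolding w_def by (rule set_integral_add(1)[OF su sP])
      show ?thesis
      proof (cases "w y > 0")
        case True
        have "avg r w y \<le> avg r U y"
          by (rule avg_mono[OF r(1) sw sU, of a]) (use Uw yD in auto)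
        moreover have "avg r w y = avg r ?u y + avg r (\<lambda>x. - e + e * (- P x)) y"
          unfolding w_def by (rule avg_add[OF r(1) su sP])
        moreover have "- e + e * (- P y) \<le> avg r (\<lambda>x. - e + e * (- P x)) y"
          using P' r(1) yD(1) unfolding subharmonic_def by blast
        moreover have "U y = w y" using True yD y by (simp add: U_def)
        moreover have "?u y - avg r ?u y = ?k (y - a)" by (rule avg_defect[OF a r(1) yD(1) y(2)])
        ultimately show ?thesis by (simp add: w_def)
      next
        case False
        have "avg r (\<lambda>x. 0) y \<le> avg r U y"
          by (rule avg_mono[OF r(1) _ sU, of _ a]) (auto intro!: Unn set_integrable_continuous_cball)
        moreover have "U y = 0" using False by (simp add: U_def)
        moreover have "0 \<le> ?k (y - a)" using y r by (intro log_defect_nonneg) auto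
        ultimately show ?thesis by (simp add: avg_const[OF r(1)])
      qed
    qed
    have upper: "AE y in lborel. U y * v y - v y * avg r U y \<le> (?v a + e) * ?k (y - a)"
      using AE_lborel_singleton[of a] AE_lborel_singleton[of b]
    proof eventually_elim
      case (elim y)
      have k0: "0 \<le> ?k (y - a)" using elim r by (intro log_defect_nonneg) auto
      show ?case
      proof (cases "y \<in> K'")
        case True
        then have yD: "y \<in> D" using K'sub by auto
        have vy: "v y = ?v y" using True by (simp add: v_def)
        have vnn: "0 \<le> ?v y" by (rule green_nonneg[OF yD b elim(2)])
        have "?v y * (U y - avg r U y) \<le> ?v y * ?k (y - a)"
          by (rule mult_left_mono[OF Usub[OF True elim(1)] vnn])
        also have "\<dots> \<le> (?v a + e) * ?k (y - a)"
        proof (cases "norm (y - a) < r")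
          case True
          then have "y \<in> ball a s4" using r by (simp add: dist_norm norm_minus_commute)
          then show ?thesis using s4(3) k0 by (intro mult_right_mono) auto
        next
          case False
          then show ?thesis using log_defect_eq_0[OF r(1), of "y - a"] by simp
        qed
        finally show ?thesis by (simp add: vy algebra_simps)
      next
        case False
        then show ?thesis using k0 va_nn e by (simp add: v_def)
      qed
    qed
    have lower: "AE x in lborel. (w b - e) * ?k (x - b) \<le> U x * v x - U x * avg r ?v x"
      using Uk AE_lborel_singleton[of b]
    proof eventually_elim
      case (elim x)
      have "(w b - e) * ?k (x - b) \<le> U x * ?k (x - b)"
      proof (cases "norm (x - b) < r")
        case True
        then have x: "x \<in> ball b s3" using r by (simp add: dist_norm norm_minus_commute)
        then have "x \<in> D" "x \<noteq> a" using s3(2) by auto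
        then have "w b - e \<le> U x" using s3(3)[OF x] Uw[of x] by simp
        moreover have "0 \<le> ?k (x - b)" using elim r by (intro log_defect_nonneg) auto
        ultimately show ?thesis by (rule mult_right_mono)
      next
        case False
        then show ?thesis using log_defect_eq_0[OF r(1), of "x - b"] by simp
      qed
      then show ?case using elim by simp
    qed
    have "(w b - e) * (LINT x|lborel. ?k x) = (LINT x|lborel. (w b - e) * ?k (x - b))"
      by (simp add: kint)
    also have "\<dots> \<le> (LINT x|lborel. U x * v x - U x * avg r ?v x)"
      by (rule integral_mono_AE[OF _ _ lower]) (use kia Uvi i1 in auto)
    also have "\<dots> = (LINT y|lborel. U y * v y - v y * avg r U y)"
      using Uvi i1 i2 fub by simp
    also have "\<dots> \<le> (LINT y|lborel. (?v a + e) * ?k (y - a))"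
      by (rule integral_mono_AE[OF _ _ upper]) (use kia Uvi i2 in auto)
    also have "\<dots> = (?v a + e) * (LINT x|lborel. ?k x)" by (simp add: kint)
    finally have "w b - e \<le> ?v a + e"
      using integral_log_defect_pos[OF r(1) ki] by simp
    moreover have "e * P b \<le> e * C" using P(3) e by simp
    ultimately show ?thesis by (simp add: w_def)
  qed
  show ?thesis
  proof (rule field_le_epsilon)
    fix c :: real assume c: "c > 0"
    define e where "e = c / (3 + \<bar>C\<bar>)"
    have e: "e > 0" using c by (simp add: e_def add_pos_nonneg)
    have "e * (3 + C) \<le> e * (3 + \<bar>C\<bar>)" using e by (intro mult_left_mono) auto
    also have "\<dots> = c" unfolding e_def by (simp add: add_pos_nonneg less_imp_neq[symmetric])
    finally show "G b a \<le> G a b + c" using main[OF e] by (simp add: algebra_simps)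
  qed
qed

theorem green_symmetric: "a \<in> D \<Longrightarrow> b \<in> D \<Longrightarrow> a \<noteq> b \<Longrightarrow> G a b = G b a"
  using green_symmetric_le[of a b] green_symmetric_le[of b a] by simp

text \<open>
  \<open>ln d / (2 * pi)\<close> bounds the boundary values of the regular part.
\<close>

lemma green_le_ln_diameter:
  assumes d: "\<And>x y. x \<in> D \<Longrightarrow> y \<in> D \<Longrightarrow> norm (x - y) \<le> d" and M: "\<And>x. x \<in> D \<Longrightarrow> norm x \<le> M"
    and xy: "x \<in> D" "y \<in> D" "x \<noteq> y"
  shows "G x y \<le> (ln d - ln (norm (x - y))) / (2 * pi)"
proof -
  obtain B where B: "\<And>x. x \<in> D \<Longrightarrow> x \<noteq> y \<Longrightarrow> norm x \<le> M \<Longrightarrow> \<bar>G x y + ln (norm (x - y)) / (2 * pi)\<bar> \<le> B"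
    by (rule regular_part_bounded[OF xy(2)]) blast
  have "G x y + 1 / (2 * pi) * ln (norm (x - y)) \<le> ln d / (2 * pi)"
  proof (rule max_principle[OF open_D bounded_frontier q_ext, where F = "{y}" and E = "irregular y" and B = B and f = "\<lambda>x. G x y + 1 / (2 * pi) * ln (norm (x - y))"])
    show "subharmonic (D - {y}) (\<lambda>x. G x y + 1 / (2 * pi) * ln (norm (x - y)))"
      by (intro harmonic_imp_subharmonic harmonic_add harmonic_cmult harmonic_off_pole harmonic_ln_norm xy) auto
    show "polar (irregular y)" by (rule polar_irregular[OF xy(2)])
    fix w assume w: "w \<in> D - {y}"
    then show "G w y + 1 / (2 * pi) * ln (norm (w - y)) \<le> B" using B[of w] M[of w] by (simp add: abs_le_iff)
  next
    fix z c assume z: "z \<in> frontier D - irregular y" and c: "ln d / (2 * pi) < c"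
    have lim: "((\<lambda>x. G x y) \<longlongrightarrow> 0) (at z within D - {y})"
      by (rule tendsto_within_subset[OF green_tendsto_0[OF z]]) auto
    have "\<forall>\<^sub>F x in at z within D - {y}. x \<in> D - {y}" by (simp add: eventually_at_filter)
    moreover have "\<forall>\<^sub>F x in at z within D - {y}. G x y < c - ln d / (2 * pi)"
      using c by (intro order_tendstoD[OF lim]) simp
    ultimately show "\<forall>\<^sub>F x in at z within D - {y}. G x y + 1 / (2 * pi) * ln (norm (x - y)) < c"
    proof eventually_elim
      case (elim x)
      then have "ln (norm (x - y)) \<le> ln d" using d[of x y] xy by (intro ln_mono) auto
      then have "ln (norm (x - y)) / (2 * pi) \<le> ln d / (2 * pi)" by (simp add: divide_right_mono)
      then show ?case using elim by simp
    qed
  qed (use xy in auto)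
  then show ?thesis by (simp add: diff_divide_distrib)
qed

end



section \<open>Exterior domains\<close>

lemma abs_ln_norm_diff_le:
  fixes w p :: complex
  assumes "p \<noteq> 0" "2 * norm w \<le> norm p"
  shows "\<bar>ln (norm (w - p)) - ln (norm p)\<bar> \<le> 2 * norm w / norm p"
proof -
  define t where "t = norm (w - p) / norm p"
  define s where "s = norm w / norm p"
  have p: "norm p > 0" using assms by simp
  have s: "0 \<le> s" "s \<le> 1 / 2" using assms p by (auto simp: s_def field_simps)
  have "\<bar>norm (w - p) - norm p\<bar> \<le> norm w"
    using norm_triangle_ineq3[of "p - w" p] by (simp add: norm_minus_commute)
  then have "\<bar>norm (w - p) - norm p\<bar> / norm p \<le> s" unfolding s_def using p by (rule divide_right_mono[OF _ less_imp_le])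
  moreover have "t - 1 = (norm (w - p) - norm p) / norm p"
    using p by (simp add: t_def diff_divide_distrib)
  then have "\<bar>t - 1\<bar> = \<bar>norm (w - p) - norm p\<bar> / norm p" by simp
  ultimately have t: "\<bar>t - 1\<bar> \<le> s" by simp
  then have t2: "t \<ge> 1 / 2" using s by linarith
  then have "w \<noteq> p" by (auto simp: t_def)
  then have e: "ln (norm (w - p)) - ln (norm p) = ln t" using p by (simp add: t_def ln_div)
  have "ln t \<le> t - 1" using t2 by (intro ln_le_minus_one) auto
  then have 1: "ln t \<le> 2 * s" using t s by linarith
  have "- ln t = ln (1 / t)" using t2 by (simp add: ln_div)
  also have "\<dots> \<le> 1 / t - 1" using t2 by (intro ln_le_minus_one) auto
  also have "\<dots> = (1 - t) / t" using t2 by (simp add: diff_divide_distrib)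
  also have "\<dots> \<le> s / (1 / 2)" using t t2 s by (intro frac_le) auto
  finally have "- ln t \<le> 2 * s" by simp
  with 1 show ?thesis unfolding e s_def by (simp add: abs_le_iff)
qed

text \<open>
  A Cauchy criterion at infinity that also keeps the rate.
\<close>

lemma limit_at_infinity:
  fixes f :: "complex \<Rightarrow> real"
  assumes R: "R > 0" and f: "\<And>p p'. R \<le> norm p \<Longrightarrow> R \<le> norm p' \<Longrightarrow> p \<noteq> p' \<Longrightarrow> \<bar>f p - f p'\<bar> \<le> 1 / norm p + 1 / norm p'"
  obtains l where "(f \<longlongrightarrow> l) at_infinity" "\<And>p. R \<le> norm p \<Longrightarrow> \<bar>f p - l\<bar> \<le> 1 / norm p"
proof -
  have f': "\<bar>f p - f p'\<bar> \<le> 1 / norm p + 1 / norm p'" if "R \<le> norm p" "R \<le> norm p'" for p p'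
    using f[OF that] by (cases "p = p'") auto
  define x where "x n = complex_of_real (R + real n)" for n
  have nx: "norm (x n) = R + real n" for n using R unfolding x_def norm_of_real by simp
  have x0: "(\<lambda>n. 1 / norm (x n)) \<longlonglongrightarrow> 0"
  proof -
    have "filterlim (\<lambda>n. R + real n) at_top sequentially"
      by (rule filterlim_tendsto_add_at_top[OF tendsto_const filterlim_real_sequentially])
    then have "(\<lambda>n. inverse (R + real n)) \<longlonglongrightarrow> 0"
      by (rule tendsto_inverse_0_at_top)
    then show ?thesis by (simp add: nx inverse_eq_divide)
  qed
  have "Cauchy (\<lambda>n. f (x n))"
  proof (rule metric_CauchyI)
    fix e :: real assume "e > 0"
    then have "eventually (\<lambda>n. 1 / norm (x n) < e / 2) sequentially"
      by (intro order_tendstoD[OF x0]) simp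
    then obtain N where N: "\<And>n. n \<ge> N \<Longrightarrow> 1 / norm (x n) < e / 2" by (auto simp: eventually_sequentially)
    have "dist (f (x m)) (f (x n)) < e" if "m \<ge> N" "n \<ge> N" for m n
      using f'[of "x m" "x n"] N[OF that(1)] N[OF that(2)] by (simp add: nx dist_real_def)
    then show "\<exists>M. \<forall>m\<ge>M. \<forall>n\<ge>M. dist (f (x m)) (f (x n)) < e" by blast
  qed
  then obtain l where l: "(\<lambda>n. f (x n)) \<longlonglongrightarrow> l" using Cauchy_convergent_iff convergent_def by blast
  have bnd: "\<bar>f p - l\<bar> \<le> 1 / norm p" if p: "R \<le> norm p" for p
  proof (rule tendsto_le[OF trivial_limit_sequentially])
    show "(\<lambda>n. \<bar>f p - f (x n)\<bar>) \<longlonglongrightarrow> \<bar>f p - l\<bar>" by (intro tendsto_intros l)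
    show "(\<lambda>n. 1 / norm p + 1 / norm (x n)) \<longlonglongrightarrow> 1 / norm p"
      using tendsto_add[OF tendsto_const x0, of "1 / norm p"] by simp
    show "\<forall>\<^sub>F n in sequentially. \<bar>f p - f (x n)\<bar> \<le> 1 / norm p + 1 / norm (x n)"
      using p by (intro always_eventually allI f') (auto simp: nx)
  qed
  have "(f \<longlongrightarrow> l) at_infinity"
  proof (rule tendstoI)
    fix e :: real assume e: "e > 0"
    show "\<forall>\<^sub>F p in at_infinity. dist (f p) l < e"
      unfolding eventually_at_infinity
    proof (intro exI allI impI)
      fix p :: complex assume p: "max R (2 / e) \<le> norm p"
      have "R \<le> norm p" using p by simp
      then have "norm p > 0" using R by linarith
      have "2 / e \<le> norm p" using p by simp
      then have "1 / norm p \<le> e / 2" using e \<open>norm p > 0\<close> by (simp add: field_simps)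
      then show "dist (f p) l < e" using bnd[of p] p e by (simp add: dist_real_def)
    qed
  qed
  then show ?thesis using bnd by (rule that)
qed

lemma max_principle_abs:
  assumes D: "open D" "bounded (frontier D)" "q \<notin> closure D" "finite F"
    and f: "harmonic (D - F) f" and B: "\<And>x. x \<in> D - F \<Longrightarrow> \<bar>f x\<bar> \<le> B" and E: "polar E"
    and lim: "\<And>z c. z \<in> frontier D - E \<Longrightarrow> b < c \<Longrightarrow> \<forall>\<^sub>F x in at z within D - F. \<bar>f x\<bar> < c"
    and x: "x \<in> D - F"
  shows "\<bar>f x\<bar> \<le> b"
proof -
  have "f x \<le> b"
  proof (rule max_principle[OF D, where f = f and B = B])
    fix z c assume "z \<in> frontier D - E" "b < c"
    from lim[OF this] show "\<forall>\<^sub>F x in at z within D - F. f x < c" by eventually_elim simp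
  qed (use B f E x harmonic_imp_subharmonic in \<open>force simp: abs_le_iff\<close>)+
  moreover have "- f x \<le> b"
  proof (rule max_principle[OF D, where f = "\<lambda>x. - f x" and B = B])
    fix z c assume "z \<in> frontier D - E" "b < c"
    from lim[OF this] show "\<forall>\<^sub>F x in at z within D - F. - f x < c" by eventually_elim simp
  qed (use B f E x harmonic_imp_subharmonic harmonic_minus in \<open>force simp: abs_le_iff\<close>)+
  ultimately show ?thesis by simp
qed

locale exterior_green = green_domain U 0 GG for U :: "complex set" and GG +
  assumes outside: "- cball 0 1 \<subseteq> U"
begin

lemma frontier_unit: "z \<in> frontier U \<Longrightarrow> norm z \<le> 1"
proof -
  assume "z \<in> frontier U"
  then have "z \<notin> U" using open_D by (simp add: frontier_def interior_open)
  then show ?thesis using outside by auto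
qed

lemma in_U: "1 < norm p \<Longrightarrow> p \<in> U"
  using outside by auto

text \<open>
  Green's function with pole \<open>p\<close> after cancelling the pole, normalised so that its values at the
  boundary, which lies in the unit disc, are of order $1/|p|$.
\<close>

definition pole_free :: "complex \<Rightarrow> complex \<Rightarrow> real" where
  "pole_free p x = GG x p + (ln (norm (x - p)) - ln (norm p)) / (2 * pi)"

definition zeta :: "complex \<Rightarrow> real" where
  "zeta x = Lim at_infinity (\<lambda>p. GG p x)"

definition zeta_inf :: real where
  "zeta_inf = Lim at_infinity (\<lambda>x. zeta x - 1 / (2 * pi) * ln (norm x))"

text \<open>
  The difference extends harmonically across both poles and is bounded at infinity, since the two
  logarithms cancel there.  Its boundary values are estimated in \<open>abs_ln_norm_diff_le\<close>.
\<close>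

lemma pole_free_diff:
  assumes p: "2 \<le> norm p" "2 \<le> norm p'" and x: "x \<in> U" "x \<noteq> p" "x \<noteq> p'"
  shows "\<bar>pole_free p x - pole_free p' x\<bar> \<le> 1 / norm p + 1 / norm p'"
proof -
  have pU: "p \<in> U" "p' \<in> U" using p by (auto intro!: in_U)
  define M where "M = 2 * (norm p + norm p')"
  obtain B1 where B1: "\<And>x. x \<in> U \<Longrightarrow> x \<noteq> p \<Longrightarrow> norm x \<le> M \<Longrightarrow> \<bar>GG x p + ln (norm (x - p)) / (2 * pi)\<bar> \<le> B1"
    by (rule regular_part_bounded[OF pU(1)]) blast
  obtain B2 where B2: "\<And>x. x \<in> U \<Longrightarrow> x \<noteq> p' \<Longrightarrow> norm x \<le> M \<Longrightarrow> \<bar>GG x p' + ln (norm (x - p')) / (2 * pi)\<bar> \<le> B2"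
    by (rule regular_part_bounded[OF pU(2)]) blast
  obtain B3 where B3: "\<And>x. x \<in> U \<Longrightarrow> 1 \<le> dist p x \<Longrightarrow> \<bar>GG x p\<bar> \<le> B3"
    by (rule bounded_off_pole[OF pU(1), of 1]) auto
  obtain B4 where B4: "\<And>x. x \<in> U \<Longrightarrow> 1 \<le> dist p' x \<Longrightarrow> \<bar>GG x p'\<bar> \<le> B4"
    by (rule bounded_off_pole[OF pU(2), of 1]) auto
  define k where "k = (ln (norm p') - ln (norm p)) / (2 * pi)"
  define f where "f x = ((GG x p + 1 / (2 * pi) * ln (norm (x - p))) - (GG x p' + 1 / (2 * pi) * ln (norm (x - p')))) + k" for x
  have pf: "pole_free p x - pole_free p' x = f x" for x by (simp add: pole_free_def f_def k_def diff_divide_distrib)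
  have "\<bar>f x\<bar> \<le> 1 / norm p + 1 / norm p'"
  proof (rule max_principle_abs[OF open_D bounded_frontier q_ext, where F = "{p, p'}" and E = "irregular p \<union> irregular p'"
      and B = "max (\<bar>B1\<bar> + \<bar>B2\<bar> + \<bar>k\<bar>) (\<bar>B3\<bar> + \<bar>B4\<bar> + 2 / pi + \<bar>k\<bar>)"])
    show "finite {p, p'}" by simp
    show "harmonic (U - {p, p'}) f"
      unfolding f_def
      by (intro harmonic_add harmonic_diff harmonic_cmult harmonic_const harmonic_ln_norm
          harmonic_subset[OF harmonic_off_pole[OF pU(1)]] harmonic_subset[OF harmonic_off_pole[OF pU(2)]]) auto
    show "polar (irregular p \<union> irregular p')" by (intro polar_Un polar_irregular pU)
    show "x \<in> U - {p, p'}" using x by simp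
  next
    fix y assume y: "y \<in> U - {p, p'}"
    show "\<bar>f y\<bar> \<le> max (\<bar>B1\<bar> + \<bar>B2\<bar> + \<bar>k\<bar>) (\<bar>B3\<bar> + \<bar>B4\<bar> + 2 / pi + \<bar>k\<bar>)"
    proof (cases "norm y \<le> M")
      case True
      then have "\<bar>f y\<bar> \<le> \<bar>B1\<bar> + \<bar>B2\<bar> + \<bar>k\<bar>" using B1[of y] B2[of y] y by (simp add: f_def)
      then show ?thesis by (rule max.coboundedI1)
    next
      case False
      have y0: "y \<noteq> 0" using False p by (auto simp: M_def)
      have b: "\<bar>ln (norm (y - o')) - ln (norm y)\<bar> \<le> 1" if "o' \<in> {p, p'}" for o'
      proof -
        have "norm o' \<le> norm p + norm p'" using that by auto
        then have h: "2 * norm o' \<le> norm y" using False by (simp add: M_def)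
        have "\<bar>ln (norm (o' - y)) - ln (norm y)\<bar> \<le> 2 * norm o' / norm y"
          by (rule abs_ln_norm_diff_le[OF y0 h])
        also have "\<dots> \<le> 1" using h y0 by simp
        finally show ?thesis by (simp add: norm_minus_commute)
      qed
      have d: "1 \<le> dist o' y" if "o' \<in> {p, p'}" for o'
        using False that p norm_triangle_ineq2[of y o'] by (auto simp: M_def dist_norm norm_minus_commute)
      have "\<bar>ln (norm (y - p)) - ln (norm (y - p'))\<bar> \<le> 2" using b[of p] b[of p'] by simp
      then have "\<bar>ln (norm (y - p)) - ln (norm (y - p'))\<bar> / (2 * pi) \<le> 2 / (2 * pi)"
        by (intro divide_right_mono) auto
      then have "\<bar>ln (norm (y - p)) / (2 * pi) - ln (norm (y - p')) / (2 * pi)\<bar> \<le> 1 / pi"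
        by (simp add: field_simps flip: diff_divide_distrib)
      moreover have "1 / pi \<le> 2 / pi" by (simp add: divide_right_mono)
      moreover have "\<bar>GG y p\<bar> \<le> B3" "\<bar>GG y p'\<bar> \<le> B4" using B3[of y] B4[of y] d y by auto
      ultimately have "\<bar>f y\<bar> \<le> \<bar>B3\<bar> + \<bar>B4\<bar> + 2 / pi + \<bar>k\<bar>" unfolding f_def by simp
      then show ?thesis by (rule max.coboundedI2)
    qed
  next
    fix z c assume z: "z \<in> frontier U - (irregular p \<union> irregular p')" and c: "1 / norm p + 1 / norm p' < c"
    have nz: "norm z \<le> 1" using z frontier_unit by simp
    then have zp: "z \<noteq> p" "z \<noteq> p'" using p by auto
    have lim: "(f \<longlongrightarrow> ((0 + 1 / (2 * pi) * ln (norm (z - p))) - (0 + 1 / (2 * pi) * ln (norm (z - p')))) + k) (at z within U - {p, p'})"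
      unfolding f_def using z zp
      by (intro tendsto_intros tendsto_within_subset[OF green_tendsto_0]) auto
    have e: "\<bar>ln (norm (z - o')) - ln (norm o')\<bar> / (2 * pi) \<le> 1 / norm o'" if "o' \<in> {p, p'}" for o'
    proof -
      have o2: "2 \<le> norm o'" using that p by auto
      have "\<bar>ln (norm (z - o')) - ln (norm o')\<bar> \<le> 2 * norm z / norm o'"
        using o2 nz by (intro abs_ln_norm_diff_le) auto
      also have "\<dots> \<le> 2 * 1 / norm o'" using nz by (intro divide_right_mono mult_left_mono) auto
      finally have "\<bar>ln (norm (z - o')) - ln (norm o')\<bar> / (2 * pi) \<le> (2 * 1 / norm o') / (2 * pi)"
        by (intro divide_right_mono) auto
      also have "\<dots> = (1 / norm o') / pi" by simp
      also have "\<dots> \<le> (1 / norm o') / 1" using pi_gt3 by (intro divide_left_mono) auto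
      finally show ?thesis by simp
    qed
    have e': "\<bar>(ln (norm (z - o')) - ln (norm o')) / (2 * pi)\<bar> \<le> 1 / norm o'" if "o' \<in> {p, p'}" for o'
      using e[OF that] by simp
    have "((0 + 1 / (2 * pi) * ln (norm (z - p))) - (0 + 1 / (2 * pi) * ln (norm (z - p')))) + k
       = (ln (norm (z - p)) - ln (norm p)) / (2 * pi) - (ln (norm (z - p')) - ln (norm p')) / (2 * pi)"
      by (simp add: k_def diff_divide_distrib)
    then have "\<bar>((0 + 1 / (2 * pi) * ln (norm (z - p))) - (0 + 1 / (2 * pi) * ln (norm (z - p')))) + k\<bar> < c"
      using e'[OF insertI1] e'[OF insertI2[OF singletonI]] c by linarith
    then show "\<forall>\<^sub>F x in at z within U - {p, p'}. \<bar>f x\<bar> < c"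
      by (rule order_tendstoD(2)[OF tendsto_rabs[OF lim]])
  qed
  then show ?thesis by (simp add: pf)
qed

text \<open>
  By the preceding estimate \<open>pole_free p x\<close> converges as \<open>p\<close> tends to infinity.  By symmetry its
  limit is that of \<open>GG p x\<close>, which is \<open>zeta x\<close>.
\<close>

lemma zeta_limit:
  assumes x: "x \<in> U"
  shows "((\<lambda>p. GG p x) \<longlongrightarrow> zeta x) at_infinity"
    and pole_free_zeta: "\<And>p. 2 \<le> norm p \<Longrightarrow> p \<noteq> x \<Longrightarrow> \<bar>pole_free p x - zeta x\<bar> \<le> 1 / norm p"
proof -
  define R where "R = 2 + norm x"
  have neq: "p \<noteq> x" if "R \<le> norm p" for p using that by (auto simp: R_def)
  have R2: "2 \<le> R" by (simp add: R_def)
  obtain l where l: "((\<lambda>p. pole_free p x) \<longlongrightarrow> l) at_infinity" "\<And>p. R \<le> norm p \<Longrightarrow> \<bar>pole_free p x - l\<bar> \<le> 1 / norm p"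
  proof (rule limit_at_infinity[of R "\<lambda>p. pole_free p x"])
    fix p p' :: complex assume "R \<le> norm p" "R \<le> norm p'"
    then show "\<bar>pole_free p x - pole_free p' x\<bar> \<le> 1 / norm p + 1 / norm p'"
      using R2 by (intro pole_free_diff x) (auto dest: neq)
  qed (use R2 in auto)
  have ln0: "((\<lambda>p. (ln (norm (x - p)) - ln (norm p)) / (2 * pi)) \<longlongrightarrow> 0) at_infinity"
  proof (rule Lim_null_comparison)
    show "((\<lambda>p. norm x * inverse (norm p)) \<longlongrightarrow> 0) at_infinity"
      by (intro tendsto_mult_right_zero tendsto_inverse_0_at_top filterlim_norm_at_top)
    show "\<forall>\<^sub>F p in at_infinity. norm ((ln (norm (x - p)) - ln (norm p)) / (2 * pi)) \<le> norm x * inverse (norm p)"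
      unfolding eventually_at_infinity
    proof (intro exI allI impI)
      fix p :: complex assume p: "1 + 2 * norm x \<le> norm p"
      have p0: "p \<noteq> 0" using p norm_ge_zero[of x] by force
      have "\<bar>ln (norm (x - p)) - ln (norm p)\<bar> \<le> 2 * norm x / norm p"
        using p by (intro abs_ln_norm_diff_le p0) simp
      then have "\<bar>ln (norm (x - p)) - ln (norm p)\<bar> / (2 * pi) \<le> (2 * norm x / norm p) / (2 * pi)"
        by (intro divide_right_mono) auto
      also have "\<dots> = (norm x / norm p) / pi" by simp
      also have "\<dots> \<le> (norm x / norm p) / 1" using pi_gt3 by (intro divide_left_mono) auto
      finally have "\<bar>ln (norm (x - p)) - ln (norm p)\<bar> / (2 * pi) \<le> norm x / norm p" by simp
      then show "norm ((ln (norm (x - p)) - ln (norm p)) / (2 * pi)) \<le> norm x * inverse (norm p)"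
        unfolding real_norm_def abs_divide by (simp only: divide_inverse[of "norm x"]) simp
    qed
  qed
  have "((\<lambda>p. pole_free p x - (ln (norm (x - p)) - ln (norm p)) / (2 * pi)) \<longlongrightarrow> l - 0) at_infinity"
    by (intro tendsto_diff l ln0)
  moreover have "\<forall>\<^sub>F p in at_infinity. pole_free p x - (ln (norm (x - p)) - ln (norm p)) / (2 * pi) = GG p x"
    unfolding eventually_at_infinity
  proof (intro exI allI impI)
    fix p :: complex assume p: "R \<le> norm p"
    then have "p \<in> U" using R2 by (intro in_U) simp
    then have "GG p x = GG x p" using neq[OF p] by (intro green_symmetric x) auto
    then show "pole_free p x - (ln (norm (x - p)) - ln (norm p)) / (2 * pi) = GG p x" by (simp add: pole_free_def)
  qed
  ultimately have lim: "((\<lambda>p. GG p x) \<longlongrightarrow> l) at_infinity"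
    by (auto intro: Lim_transform_eventually)
  then have zl: "zeta x = l"
    unfolding zeta_def by (intro tendsto_Lim) (auto simp: trivial_limit_at_infinity)
  then show "((\<lambda>p. GG p x) \<longlongrightarrow> zeta x) at_infinity" using lim by simp
  fix p assume p: "2 \<le> norm p" "p \<noteq> x"
  show "\<bar>pole_free p x - zeta x\<bar> \<le> 1 / norm p"
  proof (rule field_le_epsilon)
    fix e :: real assume e: "e > 0"
    define p' where "p' = complex_of_real (R + 2 / e)"
    have np: "norm p' = R + 2 / e" using R2 e unfolding p'_def norm_of_real by simp
    then have "R \<le> norm p'" using e by simp
    have "2 / e \<le> norm p'" using np R2 by simp
    then have "1 / norm p' \<le> 1 / (2 / e)" using e by (intro frac_le) auto
    then have "1 / norm p' \<le> e / 2" by simp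
    moreover have "\<bar>pole_free p x - pole_free p' x\<bar> \<le> 1 / norm p + 1 / norm p'"
      using p R2 \<open>R \<le> norm p'\<close> neq[OF \<open>R \<le> norm p'\<close>] by (intro pole_free_diff x) auto
    moreover have "\<bar>pole_free p' x - zeta x\<bar> \<le> 1 / norm p'" unfolding zl by (rule l(2)[OF \<open>R \<le> norm p'\<close>])
    ultimately show "\<bar>pole_free p x - zeta x\<bar> \<le> 1 / norm p + e" by linarith
  qed
qed

text \<open>
  \<open>pole_free p x + ln (norm p) / (2 * pi)\<close> is symmetric in its two points, and it differs from
  \<open>zeta x + ln (norm p) / (2 * pi)\<close> by at most $1/|p|$.  Comparing this with the same statement for
  the interchanged points shows that $\zeta - \ln|\cdot|/(2\pi)$ is Cauchy at infinity.
\<close>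

lemma zeta_inf_limit: "2 \<le> norm x \<Longrightarrow> \<bar>zeta x - ln (norm x) / (2 * pi) - zeta_inf\<bar> \<le> 1 / norm x"
proof -
  assume x2: "2 \<le> norm x"
  define g where "g x = zeta x - 1 / (2 * pi) * ln (norm x)" for x
  obtain l where l: "(g \<longlongrightarrow> l) at_infinity" "\<And>p. 2 \<le> norm p \<Longrightarrow> \<bar>g p - l\<bar> \<le> 1 / norm p"
  proof (rule limit_at_infinity[of 2 g])
    fix p p' :: complex assume p: "2 \<le> norm p" "2 \<le> norm p'" "p \<noteq> p'"
    have pU: "p \<in> U" "p' \<in> U" using p by (auto intro!: in_U)
    have "pole_free p p' + ln (norm p) / (2 * pi) = pole_free p' p + ln (norm p') / (2 * pi)"
      using green_symmetric[OF pU p(3)] by (simp add: pole_free_def norm_minus_commute diff_divide_distrib)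
    moreover have "\<bar>pole_free p p' - zeta p'\<bar> \<le> 1 / norm p" "\<bar>pole_free p' p - zeta p\<bar> \<le> 1 / norm p'"
      using p pU by (auto intro!: pole_free_zeta)
    ultimately show "\<bar>g p - g p'\<bar> \<le> 1 / norm p + 1 / norm p'" by (simp add: g_def abs_le_iff)
  qed auto
  have "zeta_inf = Lim at_infinity g" by (simp add: zeta_inf_def g_def[abs_def])
  also have "\<dots> = l" by (rule tendsto_Lim[OF _ l(1)]) (simp add: trivial_limit_at_infinity)
  finally have "zeta_inf = l" .
  then show ?thesis using l(2)[OF x2] by (simp add: g_def)
qed

text \<open>
  The expansion for one distant point, uniform in the other one.
\<close>

lemma regular_part_far:
  assumes p: "2 \<le> norm p" and x: "x \<in> U" "p \<noteq> x"
  shows "\<bar>GG p x + ln (norm (p - x)) / (2 * pi) - zeta p - zeta x + zeta_inf\<bar> \<le> 2 / norm p"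
proof -
  have "p \<in> U" using p by (intro in_U) simp
  then have "GG p x + ln (norm (p - x)) / (2 * pi) = pole_free p x + ln (norm p) / (2 * pi)"
    using green_symmetric[of p x] x by (simp add: pole_free_def norm_minus_commute diff_divide_distrib)
  moreover have "\<bar>pole_free p x - zeta x\<bar> \<le> 1 / norm p" by (rule pole_free_zeta[OF x(1) p x(2)])
  moreover note zeta_inf_limit[OF p]
  moreover have "2 / norm p = 1 / norm p + 1 / norm p" by simp
  ultimately show ?thesis by linarith
qed

text \<open>
  A concrete far pole gives a harmonic substitute for \<open>zeta\<close> whose boundary behaviour is that of a
  Green's function; it is used in the comparison argument below.
\<close>

lemma green_near_zeta:
  assumes p: "2 \<le> norm p" "2 * norm x \<le> norm p" and x: "x \<in> U"
  shows "\<bar>GG x p - zeta x\<bar> \<le> (1 + norm x) / norm p"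
proof -
  have ne: "p \<noteq> x" "p \<noteq> 0" using p by auto
  have "\<bar>ln (norm (x - p)) - ln (norm p)\<bar> / (2 * pi) \<le> (2 * norm x / norm p) / (2 * pi)"
    using abs_ln_norm_diff_le[OF ne(2) p(2)] by (intro divide_right_mono) auto
  also have "\<dots> = (norm x / norm p) / pi" by simp
  also have "\<dots> \<le> (norm x / norm p) / 1" using pi_gt3 by (intro divide_left_mono) auto
  finally have "\<bar>(ln (norm (x - p)) - ln (norm p)) / (2 * pi)\<bar> \<le> norm x / norm p" by simp
  moreover have "\<bar>pole_free p x - zeta x\<bar> \<le> 1 / norm p" by (rule pole_free_zeta[OF x p(1) ne(1)])
  ultimately show ?thesis unfolding pole_free_def add_divide_distrib by linarith
qed

lemma zeta_nonneg: "x \<in> U \<Longrightarrow> 0 \<le> zeta x"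
proof (rule tendsto_lowerbound[OF zeta_limit(1)])
  assume x: "x \<in> U"
  show "\<forall>\<^sub>F p in at_infinity. 0 \<le> GG p x"
    unfolding eventually_at_infinity
  proof (intro exI allI impI)
    fix p :: complex assume "2 + norm x \<le> norm p"
    then have "1 < norm p" "p \<noteq> x" using norm_ge_zero[of x] by (linarith, auto)
    then show "0 \<le> GG p x" by (intro green_nonneg x in_U)
  qed
qed (auto simp: trivial_limit_at_infinity)

lemma zeta_upper:
  obtains C where "\<And>x. x \<in> U \<Longrightarrow> zeta x \<le> C + max 0 (ln (norm x)) / (2 * pi)"
proof -
  define p where "p = (3 :: complex)"
  have np: "norm p = 3" by (simp add: p_def)
  have pU: "p \<in> U" by (rule in_U) (simp add: np)
  obtain B where B: "\<And>x. x \<in> U \<Longrightarrow> 1 \<le> dist p x \<Longrightarrow> \<bar>GG x p\<bar> \<le> B"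
    by (rule bounded_off_pole[OF pU, of 1]) auto
  show ?thesis
  proof (rule that[of "max (zeta_inf + 1) (B + ln 5 / (2 * pi) + 1)"])
    fix x assume x: "x \<in> U"
    show "zeta x \<le> max (zeta_inf + 1) (B + ln 5 / (2 * pi) + 1) + max 0 (ln (norm x)) / (2 * pi)"
    proof (cases "2 \<le> norm x")
      case True
      have "1 / norm x \<le> 1 / 1" using True by (intro frac_le) auto
      then have "1 / norm x \<le> 1" by simp
      moreover have "max 0 (ln (norm x)) = ln (norm x)" using True by simp
      moreover have "zeta_inf + 1 \<le> max (zeta_inf + 1) (B + ln 5 / (2 * pi) + 1)" by simp
      moreover note zeta_inf_limit[OF True]
      ultimately show ?thesis by linarith
    next
      case False
      have d: "1 \<le> norm (p - x)" "norm (x - p) \<le> 5"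
        using False norm_triangle_ineq2[of p x] norm_triangle_ineq4[of x p] np by auto
      then have "p \<noteq> x" by auto
      then have z: "\<bar>pole_free p x - zeta x\<bar> \<le> 1 / norm p" by (intro pole_free_zeta x) (auto simp: np)
      have "ln (norm (x - p)) - ln (norm p) \<le> ln 5"
      proof -
        have "ln (norm (x - p)) \<le> ln 5" using d \<open>p \<noteq> x\<close> by (intro ln_mono) auto
        moreover have "0 \<le> ln (norm p)" by (simp add: np)
        ultimately show ?thesis by simp
      qed
      then have "(ln (norm (x - p)) - ln (norm p)) / (2 * pi) \<le> ln 5 / (2 * pi)" by (intro divide_right_mono) auto
      moreover have "GG x p \<le> B" using B[OF x] d by (simp add: dist_norm abs_le_iff)
      moreover have "0 \<le> max 0 (ln (norm x)) / (2 * pi)" by simp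
      moreover have "zeta x \<le> pole_free p x + 1 / 3" using z unfolding np by linarith
      moreover have "B + ln 5 / (2 * pi) + 1 \<le> max (zeta_inf + 1) (B + ln 5 / (2 * pi) + 1)" by simp
      ultimately show ?thesis unfolding pole_free_def by linarith
    qed
  qed
qed

end



section \<open>Bounded domains containing the unit disc\<close>

lemma integral_scale:
  fixes h :: "complex \<Rightarrow> real"
  assumes "e > 0" "h \<in> borel_measurable borel"
  shows "(LINT x|lborel. h (x /\<^sub>R e)) = e\<^sup>2 * (LINT x|lborel. h x)"
proof -
  have "(LINT x|lborel. h x) = (LINT x|density (distr lborel borel (\<lambda>x. 0 + (1 / e) *\<^sub>R x)) (\<lambda>_. \<bar>1 / e\<bar> ^ DIM(complex)). h x)"
    using assms(1) by (subst lborel_affine[of "1 / e" "0 :: complex"]) auto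
  also have "\<dots> = (LINT x|distr lborel borel (\<lambda>x::complex. 0 + (1 / e) *\<^sub>R x). (1 / e)\<^sup>2 * h x)"
    using assms by (subst integral_real_density) auto
  also have "\<dots> = (LINT x|lborel. (1 / e)\<^sup>2 * h ((1 / e) *\<^sub>R x))"
    using assms by (subst integral_distr) auto
  also have "\<dots> = (1 / e)\<^sup>2 * (LINT x|lborel. h (x /\<^sub>R e))"
    by (simp add: divide_inverse)
  finally show ?thesis using assms(1) by (simp add: field_simps)
qed

text \<open>
  The change of variables maps bumps to bumps.
\<close>

lemma harmonic_scale:
  assumes g: "harmonic D g" and e: "e > 0"
  shows "harmonic {x. x /\<^sub>R e \<in> D} (\<lambda>x. g (x /\<^sub>R e))"
  unfolding harmonic_def
proof (intro conjI allI impI)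
  have gc: "continuous_on D g" using g by (simp add: harmonic_def)
  show "continuous_on {x. x /\<^sub>R e \<in> D} (\<lambda>x. g (x /\<^sub>R e))"
    by (rule continuous_on_compose2[OF gc]) (auto intro!: continuous_intros)
  fix z r assume r: "0 < r" "cball z r \<subseteq> {x. x /\<^sub>R e \<in> D}"
  have r': "0 < r / e" using r e by simp
  have sub: "cball (z /\<^sub>R e) (r / e) \<subseteq> D"
  proof
    fix p assume "p \<in> cball (z /\<^sub>R e) (r / e)"
    then have "norm (z /\<^sub>R e - p) * e \<le> r / e * e" using e by (intro mult_right_mono) (auto simp: dist_norm)
    moreover have "norm (z - e *\<^sub>R p) = norm (z /\<^sub>R e - p) * e"
    proof -
      have "z - e *\<^sub>R p = e *\<^sub>R (z /\<^sub>R e - p)" using e by (simp add: scaleR_diff_right)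
      then show ?thesis using e by (simp add: mult.commute)
    qed
    ultimately have "e *\<^sub>R p \<in> cball z r" using e by (simp add: dist_norm)
    then have "(e *\<^sub>R p) /\<^sub>R e \<in> D" using r by blast
    then show "p \<in> D" using e by simp
  qed
  define h where "h x = bump (r / e) (x - z /\<^sub>R e) * g x" for x
  have hi: "integrable lborel h" unfolding h_def
    by (intro integrable_bump_mult r' continuous_on_subset[OF gc sub])
  have b: "bump r (x - z) = bump (r / e) (x /\<^sub>R e - z /\<^sub>R e) / e\<^sup>2" for x
  proof -
    have "norm (x /\<^sub>R e - z /\<^sub>R e) = norm (x - z) / e"
      using e by (simp add: divide_inverse mult.commute flip: scaleR_diff_right)
    then show ?thesis using e by (simp add: bump_def power_divide)
  qed
  have "avg r (\<lambda>x. g (x /\<^sub>R e)) z = (LINT x|lborel. h (x /\<^sub>R e) / e\<^sup>2)"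
    by (simp add: avg_def b h_def)
  also have "\<dots> = (LINT x|lborel. h x)"
    using integral_scale[OF e, of h] borel_measurable_integrable[OF hi] e by simp
  also have "\<dots> = avg (r / e) g (z /\<^sub>R e)" by (simp add: avg_def h_def)
  also have "\<dots> = g (z /\<^sub>R e)" using g r' sub by (simp add: harmonic_def)
  finally show "avg r (\<lambda>x. g (x /\<^sub>R e)) z = g (z /\<^sub>R e)" .
qed

lemma regular_part_eq:
  "x \<noteq> y \<Longrightarrow> regular_part G x y = - (G x y + ln (norm (x - y)) / (2 * pi))"
  by (simp add: regular_part_def Let_def dist_norm ln_div)

locale interior_green = green_domain \<Omega> q G for \<Omega> q G +
  assumes unit_ball: "ball 0 1 \<subseteq> \<Omega>" and bounded_\<Omega>: "bounded \<Omega>"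
begin

abbreviation "H \<equiv> regular_part G"

lemma zero_in: "0 \<in> \<Omega>" using unit_ball by auto

lemma diameter:
  obtains d where "d \<ge> 1" "\<And>x. x \<in> \<Omega> \<Longrightarrow> norm x \<le> d" "\<And>x y. x \<in> \<Omega> \<Longrightarrow> y \<in> \<Omega> \<Longrightarrow> norm (x - y) \<le> d"
proof -
  obtain M where M: "\<And>x. x \<in> \<Omega> \<Longrightarrow> norm x \<le> M" using bounded_\<Omega> by (auto simp: bounded_iff)
  show ?thesis
  proof (rule that[of "max 1 (2 * M)"])
    fix x assume x: "x \<in> \<Omega>"
    show "norm x \<le> max 1 (2 * M)" using M[OF x] norm_ge_zero[of x] by linarith
    fix y assume "y \<in> \<Omega>"
    then show "norm (x - y) \<le> max 1 (2 * M)" using M[OF x] M[of y] norm_triangle_ineq4[of x y] by linarith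
  qed simp
qed

lemma H_zero_bounds:
  obtains C where "\<And>y. y \<in> \<Omega> \<Longrightarrow> y \<noteq> 0 \<Longrightarrow> - C \<le> H 0 y \<and> H 0 y \<le> - ln (norm y) / (2 * pi)"
proof -
  obtain d where d: "d \<ge> 1" "\<And>x. x \<in> \<Omega> \<Longrightarrow> norm x \<le> d" "\<And>x y. x \<in> \<Omega> \<Longrightarrow> y \<in> \<Omega> \<Longrightarrow> norm (x - y) \<le> d"
    by (rule diameter) blast
  show ?thesis
  proof (rule that[of "ln d / (2 * pi)"])
    fix y assume y: "y \<in> \<Omega>" "y \<noteq> 0"
    have "G 0 y \<le> (ln d - ln (norm (0 - y))) / (2 * pi)"
      using green_le_ln_diameter[OF d(3,2) zero_in y(1)] y(2) by auto
    moreover have "0 \<le> G 0 y" using green_nonneg[OF zero_in y(1)] y(2) by simp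
    moreover have "H 0 y = - (G 0 y + ln (norm (0 - y)) / (2 * pi))"
      using y by (intro regular_part_eq) auto
    ultimately show "- (ln d / (2 * pi)) \<le> H 0 y \<and> H 0 y \<le> - ln (norm y) / (2 * pi)"
      by (simp add: diff_divide_distrib)
  qed
qed

lemma cball_quarter: "x \<in> cball 0 (1/4) \<Longrightarrow> cball x (1/4) \<subseteq> \<Omega>"
proof
  fix p :: complex assume "x \<in> cball 0 (1/4)" "p \<in> cball x (1/4)"
  then have "p \<in> ball 0 1" using dist_triangle[of 0 p x] by simp
  then show "p \<in> \<Omega>" using unit_ball by blast
qed

text \<open>
  The continuous extension, near the origin, of $G(z,y) + \ln|z-y|/(2\pi)$ across the pole.
\<close>

definition extended_part :: "complex \<Rightarrow> complex \<Rightarrow> real" where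
  "extended_part y z = avg (1/4) (\<lambda>x. G x y) z + smooth_log (1/4) (z - y) / (2 * pi)"

lemma H_eq_extended_part: "y \<in> \<Omega> \<Longrightarrow> x \<in> cball 0 (1/4) \<Longrightarrow> x \<noteq> y \<Longrightarrow> H x y = - extended_part y x"
  using green_eq_avg[of y "1/4" x] cball_quarter[of x] by (simp add: regular_part_eq extended_part_def diff_divide_distrib)

lemma extended_part_lipschitz:
  assumes "y \<in> \<Omega>" "x \<in> cball 0 (1/4)"
  shows "\<bar>extended_part y x - extended_part y 0\<bar> \<le> (256 / pi * (LINT x:cball 0 (1/2)|lborel. \<bar>G x y\<bar>) + 4 / pi) * norm x"
proof -
  have sub: "cball 0 (1/2) \<subseteq> \<Omega>" using unit_ball by (force simp: subset_eq)
  show ?thesis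
    using regular_part_lipschitz[OF assms(1), of "1/4" 0 x 0] assms(2) sub
    by (simp add: extended_part_def power_divide)
qed

text \<open>
  Here \<open>H 0 0\<close> is the value of the continuous extension.
\<close>

lemma H_lipschitz_pole_zero:
  obtains C where "C \<ge> 0" "\<And>x. x \<noteq> 0 \<Longrightarrow> norm x \<le> 1/4 \<Longrightarrow> \<bar>H x 0 - H 0 0\<bar> \<le> C * norm x"
proof -
  define C where "C = 256 / pi * (LINT x:cball 0 (1/2)|lborel. \<bar>G x 0\<bar>) + 4 / pi"
  have C: "C \<ge> 0" unfolding C_def set_lebesgue_integral_def
    by (intro add_nonneg_nonneg mult_nonneg_nonneg Bochner_Integration.integral_nonneg) auto
  have lip: "\<bar>extended_part 0 x - extended_part 0 0\<bar> \<le> C * norm x" if "norm x \<le> 1/4" for x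
    unfolding C_def using that by (intro extended_part_lipschitz zero_in) simp
  have "((\<lambda>x. extended_part 0 x - extended_part 0 0) \<longlongrightarrow> 0) (at 0)"
  proof (rule Lim_null_comparison)
    have "((\<lambda>x::complex. C * norm x) \<longlongrightarrow> C * norm (0::complex)) (at 0)" by (intro tendsto_intros)
    then show "((\<lambda>x::complex. C * norm x) \<longlongrightarrow> 0) (at 0)" by simp
    show "\<forall>\<^sub>F x in at 0. norm (extended_part 0 x - extended_part 0 0) \<le> C * norm x"
      unfolding eventually_at using lip by (intro exI[of _ "1/4"]) auto
  qed
  then have "((\<lambda>x. - extended_part 0 x) \<longlongrightarrow> - extended_part 0 0) (at 0)"
    by (intro tendsto_minus) (simp add: LIM_zero_iff)
  moreover have "\<forall>\<^sub>F z in at 0. - extended_part 0 z = 1 / (2 * pi) * ln (1 / dist z 0) - G z 0"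
    unfolding eventually_at
  proof (intro exI[of _ "1/4"] conjI ballI impI)
    fix z :: complex assume z: "z \<noteq> 0 \<and> dist z 0 < 1/4"
    then have "H z 0 = - extended_part 0 z" by (intro H_eq_extended_part zero_in) auto
    then show "- extended_part 0 z = 1 / (2 * pi) * ln (1 / dist z 0) - G z 0"
      using z by (simp add: regular_part_def)
  qed simp
  ultimately have "((\<lambda>z. 1 / (2 * pi) * ln (1 / dist z 0) - G z 0) \<longlongrightarrow> - extended_part 0 0) (at 0)"
    by (rule Lim_transform_eventually)
  then have "Lim (at 0) (\<lambda>z. 1 / (2 * pi) * ln (1 / dist z 0) - G z 0) = - extended_part 0 0"
    by (intro tendsto_Lim) auto
  then have H0: "H 0 0 = - extended_part 0 0" by (simp add: regular_part_def Let_def)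
  show ?thesis
  proof (rule that[OF C])
    fix x :: complex assume x: "x \<noteq> 0" "norm x \<le> 1/4"
    then have "H x 0 = - extended_part 0 x" by (intro H_eq_extended_part zero_in) auto
    then show "\<bar>H x 0 - H 0 0\<bar> \<le> C * norm x" using lip[OF x(2)] H0 by simp
  qed
qed

text \<open>
  The average of $G(\cdot,y)$ about the origin is controlled by \<open>green_eq_avg\<close>: the logarithmic
  singularity of $G(0,y)$ as \<open>y\<close> approaches the origin cancels.  On the disc of radius 1/2 the
  bump of radius 3/4 is bounded below.
\<close>

lemma integral_G_bounded:
  obtains C where "\<And>y. y \<in> \<Omega> \<Longrightarrow> y \<noteq> 0 \<Longrightarrow> (LINT x:cball 0 (1/2)|lborel. \<bar>G x y\<bar>) \<le> C"
proof -
  obtain d where d: "d \<ge> 1" "\<And>x. x \<in> \<Omega> \<Longrightarrow> norm x \<le> d" "\<And>x y. x \<in> \<Omega> \<Longrightarrow> y \<in> \<Omega> \<Longrightarrow> norm (x - y) \<le> d"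
    by (rule diameter) blast
  have sub: "cball 0 (1/2) \<subseteq> \<Omega>" "cball 0 (3/4) \<subseteq> \<Omega>" using unit_ball by (force simp: subset_eq)+
  define b where "b = 2 / (pi * (3/4)\<^sup>2) * (5 / 9)"
  have b: "b > 0" by (simp add: b_def)
  show ?thesis
  proof (rule that[of "(ln d - ln (3/4) + 1) / (2 * pi) / b"])
    fix y assume y: "y \<in> \<Omega>" "y \<noteq> 0"
    have i1: "integrable lborel (\<lambda>x. indicator (cball 0 (1/2)) x *\<^sub>R \<bar>G x y\<bar>)"
      using set_integrable_abs[OF integrable_compact[OF y(1) _ sub(1)]] by (simp add: set_integrable_def)
    have i2: "integrable lborel (\<lambda>x. bump (3/4) (x - 0) * G x y)"
      by (rule integrable_bump_mult'[OF _ integrable_compact[OF y(1) _ sub(2)]]) auto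
    have "b * (LINT x:cball 0 (1/2)|lborel. \<bar>G x y\<bar>) = (LINT x|lborel. b * (indicator (cball 0 (1/2)) x *\<^sub>R \<bar>G x y\<bar>))"
      by (simp add: set_lebesgue_integral_def)
    also have "\<dots> \<le> (LINT x|lborel. bump (3/4) (x - 0) * G x y)"
    proof (rule integral_mono_AE[OF integrable_mult_right[OF i1] i2])
      show "AE x in lborel. b * (indicator (cball 0 (1/2)) x *\<^sub>R \<bar>G x y\<bar>) \<le> bump (3/4) (x - 0) * G x y"
        using AE_lborel_singleton[of y]
      proof eventually_elim
        case (elim x)
        show ?case
        proof (cases "x \<in> cball 0 (3/4)")
          case False
          then have "bump (3/4) x = 0" by (intro bump_eq_0) auto
          then show ?thesis using False by (simp add: indicator_def)
        next
          case True
          then have g: "0 \<le> G x y" using sub(2) green_nonneg[OF _ y(1) elim] by auto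
          have "b * indicator (cball 0 (1/2)) x \<le> bump (3/4) x"
          proof (cases "norm x \<le> 1/2")
            case True
            then have "(norm x)\<^sup>2 \<le> (1/2)\<^sup>2" by (intro power_mono) auto
            then have "5 / 9 \<le> 1 - (norm x)\<^sup>2 / (3/4)\<^sup>2" by (simp add: power2_eq_square)
            then have "5 / 9 \<le> max 0 (1 - (norm x)\<^sup>2 / (3/4)\<^sup>2)" by (rule max.coboundedI2)
            then have "2 / (pi * (3/4)\<^sup>2) * (5 / 9) \<le> bump (3/4) x"
              unfolding bump_def by (rule mult_left_mono) simp
            then show ?thesis using True by (simp add: b_def)
          qed (use bump_nonneg[of "3/4" x] in simp)
          then have "b * indicator (cball 0 (1/2)) x * G x y \<le> bump (3/4) x * G x y"
            using g by (rule mult_right_mono)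
          then show ?thesis using g by (simp add: mult.assoc)
        qed
      qed
    qed
    also have "\<dots> = avg (3/4) (\<lambda>x. G x y) 0" by (simp add: avg_def)
    also have "\<dots> = G 0 y - (smooth_log (3/4) (0 - y) - ln (norm (0 - y))) / (2 * pi)"
      using green_eq_avg[OF y(1) _ sub(2)] y(2) by auto
    also have "\<dots> \<le> (ln d - ln (norm (0 - y))) / (2 * pi) - (smooth_log (3/4) (0 - y) - ln (norm (0 - y))) / (2 * pi)"
      using green_le_ln_diameter[OF d(3,2) zero_in y(1)] y(2) by auto
    also have "\<dots> = (ln d - smooth_log (3/4) (0 - y)) / (2 * pi)" by (simp add: diff_divide_distrib)
    also have "\<dots> \<le> (ln d - ln (3/4) + 1) / (2 * pi)"
      using smooth_log_ge[of "3/4" "0 - y"] by (intro divide_right_mono) auto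
    finally show "(LINT x:cball 0 (1/2)|lborel. \<bar>G x y\<bar>) \<le> (ln d - ln (3/4) + 1) / (2 * pi) / b"
      using b by (simp add: field_simps)
  qed
qed

lemma H_lipschitz:
  obtains C where "C \<ge> 0" "\<And>x y. y \<in> \<Omega> \<Longrightarrow> y \<noteq> 0 \<Longrightarrow> x \<noteq> y \<Longrightarrow> norm x \<le> 1/4 \<Longrightarrow> \<bar>H x y - H 0 y\<bar> \<le> C * norm x"
proof -
  obtain C where C: "\<And>y. y \<in> \<Omega> \<Longrightarrow> y \<noteq> 0 \<Longrightarrow> (LINT x:cball 0 (1/2)|lborel. \<bar>G x y\<bar>) \<le> C"
    by (rule integral_G_bounded) blast
  show ?thesis
  proof (rule that[of "256 / pi * \<bar>C\<bar> + 4 / pi"])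
    fix x y :: complex assume y: "y \<in> \<Omega>" "y \<noteq> 0" and x: "x \<noteq> y" "norm x \<le> 1/4"
    have "H x y = - extended_part y x" "H 0 y = - extended_part y 0" using x y by (auto intro!: H_eq_extended_part)
    then have "\<bar>H x y - H 0 y\<bar> = \<bar>extended_part y x - extended_part y 0\<bar>" by simp
    also have "\<dots> \<le> (256 / pi * (LINT x:cball 0 (1/2)|lborel. \<bar>G x y\<bar>) + 4 / pi) * norm x"
      using x by (intro extended_part_lipschitz y) simp
    also have "\<dots> \<le> (256 / pi * \<bar>C\<bar> + 4 / pi) * norm x"
      using C[OF y] by (intro mult_right_mono add_mono mult_left_mono) auto
    finally show "\<bar>H x y - H 0 y\<bar> \<le> (256 / pi * \<bar>C\<bar> + 4 / pi) * norm x" .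
  qed simp
qed

end



section \<open>The approximation in perforated domains\<close>

lemma norm_scaled: "e > 0 \<Longrightarrow> norm ((x::complex) /\<^sub>R e) = norm x / e"
  by (simp add: divide_inverse mult.commute)

text \<open>
  The hole is described by the unscaled exterior domain \<open>U\<close>, whose points keep a distance
  \<open>\<rho>\<close> from the origin.
\<close>

locale two_scale = interior_green \<Omega> q G + outer: exterior_green U GG
  for \<Omega> q G U GG +
  fixes \<rho> :: real
  assumes rho: "\<rho> > 0" "\<And>x. x \<in> U \<Longrightarrow> \<rho> \<le> norm x"
begin

definition perf :: "real \<Rightarrow> complex set" where
  "perf e = {x \<in> \<Omega>. x /\<^sub>R e \<in> U}"

lemma norm_perf: "0 < e \<Longrightarrow> x \<in> perf e \<Longrightarrow> e * \<rho> \<le> norm x"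
  using rho(2)[of "x /\<^sub>R e"] by (simp add: perf_def field_simps)

lemma perf_nonzero: "0 < e \<Longrightarrow> x \<in> perf e \<Longrightarrow> x \<noteq> 0"
  using norm_perf[of e x] mult_pos_pos[OF _ rho(1), of e] by auto

lemma frontier_perf:
  assumes e: "0 < e" "e < 1" and z: "z \<in> frontier (perf e)"
  shows "(z \<in> frontier \<Omega> \<and> 1 \<le> norm z) \<or> (z /\<^sub>R e \<in> frontier U \<and> norm z \<le> e)"
proof -
  have opre: "open {x :: complex. x /\<^sub>R e \<in> V}" if "open V" for V
    using continuous_open_vimage[OF that, of "\<lambda>x. x /\<^sub>R e"] by (simp add: vimage_def continuous_intros)
  have "open (perf e)" unfolding perf_def Collect_conj_eq using open_D opre[OF outer.open_D] by (simp add: open_Int)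
  then have zn: "z \<in> closure (perf e)" "z \<notin> perf e" using z by (auto simp: frontier_def interior_open)
  have zc: "z \<in> closure \<Omega>" using zn closure_mono[of "perf e" \<Omega>] by (auto simp: perf_def)
  have "open {x :: complex. x /\<^sub>R e \<in> - closure U}" by (intro opre open_Compl closed_closure)
  moreover have "{x :: complex. x /\<^sub>R e \<in> - closure U} = - {x. x /\<^sub>R e \<in> closure U}" by auto
  ultimately have "closed {x :: complex. x /\<^sub>R e \<in> closure U}" by (simp only: closed_def)
  then have "closure (perf e) \<subseteq> {x. x /\<^sub>R e \<in> closure U}"
    using closure_subset[of U] by (intro closure_minimal) (auto simp: perf_def)
  then have zcU: "z /\<^sub>R e \<in> closure U" using zn by blast
  show ?thesis
  proof (cases "z \<in> \<Omega>")
    case False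
    then have "1 \<le> norm z" using unit_ball by (force simp: not_less[symmetric])
    then show ?thesis using False zc open_D by (simp add: frontier_def interior_open)
  next
    case True
    then have "z /\<^sub>R e \<notin> U" using zn by (simp add: perf_def)
    then have f: "z /\<^sub>R e \<in> frontier U" using zcU outer.open_D by (simp add: frontier_def interior_open)
    from outer.frontier_unit[OF this] have "norm z \<le> e" using e by (simp add: field_simps)
    then show ?thesis using f by simp
  qed
qed

lemma tendsto_scaled:
  assumes "0 < e" "z /\<^sub>R e \<in> frontier U - outer.irregular p"
  shows "((\<lambda>x. GG (x /\<^sub>R e) p) \<longlongrightarrow> 0) (at z within perf e - F)"
proof -
  have "filterlim (\<lambda>x. x /\<^sub>R e) (at (z /\<^sub>R e) within U) (at z within perf e - F)"
    unfolding filterlim_at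
  proof
    show "\<forall>\<^sub>F x in at z within perf e - F. x /\<^sub>R e \<in> U \<and> x /\<^sub>R e \<noteq> z /\<^sub>R e"
      using assms(1) by (auto simp: eventually_at_filter perf_def)
    show "((\<lambda>x. x /\<^sub>R e) \<longlongrightarrow> z /\<^sub>R e) (at z within perf e - F)" by (intro tendsto_intros)
  qed
  from filterlim_compose[OF outer.green_tendsto_0[OF assms(2)] this] show ?thesis .
qed

definition approximation :: "real \<Rightarrow> complex \<Rightarrow> complex \<Rightarrow> real" where
  "approximation e x y =
     G x y + GG (x /\<^sub>R e) (y /\<^sub>R e) + 1 / (2 * pi) * ln (dist x y / e)
     + (1 / (2 * pi) * ln e + outer.zeta (x /\<^sub>R e) - outer.zeta_inf + H x 0)
       * (1 / (2 * pi) * ln e + outer.zeta (y /\<^sub>R e) - outer.zeta_inf + H 0 y)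
       / (1 / (2 * pi) * ln e + H 0 0 - outer.zeta_inf)
     - outer.zeta (x /\<^sub>R e) - outer.zeta (y /\<^sub>R e) + outer.zeta_inf"

text \<open>
  The error of the approximation as a function of \<open>x\<close> for fixed \<open>y\<close>, with two changes:
  \<open>zeta (x /\<^sub>R e)\<close> is replaced by \<open>GG (x /\<^sub>R e) p\<close> for a remote \<open>p\<close>, and \<open>Q\<close> stands for the
  factor depending on \<open>y\<close> alone, divided by the denominator.
\<close>

definition harmonic_remainder ::
    "(complex \<Rightarrow> complex \<Rightarrow> real) \<Rightarrow> real \<Rightarrow> complex \<Rightarrow> real \<Rightarrow> complex \<Rightarrow> complex \<Rightarrow> real" where
  "harmonic_remainder Ge e p Q y x =
     Ge x y - G x y - GG (x /\<^sub>R e) (y /\<^sub>R e) - ln (norm (x - y)) / (2 * pi) + ln e / (2 * pi)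
     - (ln e / (2 * pi) + GG (x /\<^sub>R e) p - outer.zeta_inf - ln (norm x) / (2 * pi) - G x 0) * Q
     + GG (x /\<^sub>R e) p + outer.zeta (y /\<^sub>R e) - outer.zeta_inf"

text \<open>
  The remainder is harmonic and bounded off \<open>y\<close>, so only its boundary values matter.  At the outer
  boundary the three Green's functions of \<open>x\<close> that live on the large scale vanish, and the expansions
  of \<open>GG\<close> and \<open>zeta\<close> at infinity leave terms of order \<open>e\<close>.  At the boundary of the hole
  \<open>Ge\<close> and the two terms with \<open>GG\<close> vanish.  There \<open>H x y\<close> and \<open>H x 0\<close> may be replaced by \<open>H 0 y\<close> and
  \<open>H 0 0\<close> up to terms of order \<open>e\<close>, and what remains cancels by the equation assumed for \<open>Q\<close>.
\<close>

lemma remainder_fixed: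
  assumes e: "0 < e" "e < 1 / 8" and Ge: "green_domain (perf e) 0 Ge" and y: "y \<in> perf e"
    and d: "d \<ge> 1" "\<And>x. x \<in> \<Omega> \<Longrightarrow> norm x \<le> d"
    and p: "2 \<le> norm p" "2 * (d / e) \<le> norm p" "(1 + d / e) / norm p \<le> e"
    and C1: "C1 \<ge> 0" "\<And>x y. y \<in> \<Omega> \<Longrightarrow> y \<noteq> 0 \<Longrightarrow> x \<noteq> y \<Longrightarrow> norm x \<le> 1/4 \<Longrightarrow> \<bar>H x y - H 0 y\<bar> \<le> C1 * norm x"
    and C2: "C2 \<ge> 0" "\<And>x. x \<noteq> 0 \<Longrightarrow> norm x \<le> 1/4 \<Longrightarrow> \<bar>H x 0 - H 0 0\<bar> \<le> C2 * norm x"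
    and Q: "\<bar>Q\<bar> \<le> K" "Q * (ln e / (2 * pi) - outer.zeta_inf + H 0 0) = ln e / (2 * pi) + outer.zeta (y /\<^sub>R e) - outer.zeta_inf + H 0 y"
    and x: "x \<in> perf e" "x \<noteq> y"
  shows "\<bar>harmonic_remainder Ge e p Q y x\<bar> \<le> (5 + 3 * K + 2 * C1 + 2 * C2 * K) * e"
proof -
  interpret g: green_domain "perf e" 0 Ge by fact
  define c where "c = 1 / (2 * pi)"
  define L where "L = c * ln e"
  define zi where "zi = outer.zeta_inf"
  define zy where "zy = outer.zeta (y /\<^sub>R e)"
  define D where "D = perf e - {y}"
  have yO: "y \<in> \<Omega>" and yU: "y /\<^sub>R e \<in> U" using y by (auto simp: perf_def)
  have y0: "y \<noteq> 0" by (rule perf_nonzero[OF e(1) y])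
  have pU: "p \<in> U" using p by (intro outer.in_U) simp
  have K: "K \<ge> 0" using Q(1) by linarith
  have DO: "x \<in> \<Omega>" "x /\<^sub>R e \<in> U" "x \<noteq> 0" "norm x \<le> d" "norm (x /\<^sub>R e) \<le> d / e" if "x \<in> perf e" for x
  proof -
    show "x \<in> \<Omega>" "x /\<^sub>R e \<in> U" using that by (auto simp: perf_def)
    then show "norm x \<le> d" by (intro d(2))
    then have "norm x / e \<le> d / e" using e by (intro divide_right_mono) auto
    then show "norm (x /\<^sub>R e) \<le> d / e" unfolding norm_scaled[OF e(1)] .
  qed (rule perf_nonzero[OF e(1) that])
  have xp: "2 * norm (x /\<^sub>R e) \<le> norm p" if "x \<in> perf e" for x
    using DO(5)[OF that] p(2) by linarith
  (* The effect of the substitute for zeta. *)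
  define de where "de x = GG (x /\<^sub>R e) p - outer.zeta (x /\<^sub>R e)" for x
  have de: "\<bar>de x\<bar> \<le> e" if "x \<in> perf e" for x
  proof -
    have "\<bar>de x\<bar> \<le> (1 + norm (x /\<^sub>R e)) / norm p"
      unfolding de_def by (rule outer.green_near_zeta[OF p(1) xp[OF that] DO(2)[OF that]])
    also have "\<dots> \<le> (1 + d / e) / norm p" using DO(5)[OF that] by (intro divide_right_mono) auto
    finally show ?thesis using p(3) by linarith
  qed
  define f where "f x = (Ge x y - G x y - GG (x /\<^sub>R e) (y /\<^sub>R e) - c * ln (norm (x - y)) + L)
     - Q * (L + GG (x /\<^sub>R e) p - zi - c * ln (norm (x - 0)) - G x 0) + (GG (x /\<^sub>R e) p + (zy - zi))" for x
  have lns: "ln (norm (x /\<^sub>R e - y /\<^sub>R e)) = ln (norm (x - y)) - ln e" if "x \<noteq> y" for x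
  proof -
    have "x /\<^sub>R e - y /\<^sub>R e = (x - y) /\<^sub>R e" by (rule scaleR_diff_right[symmetric])
    then have n: "norm (x /\<^sub>R e - y /\<^sub>R e) = norm (x - y) / e" by (simp only: norm_scaled[OF e(1)])
    show ?thesis unfolding n using that e(1) by (simp add: ln_div)
  qed
  have lns0: "ln (norm (x /\<^sub>R e)) = ln (norm x) - ln e" if "x \<noteq> 0" for x :: complex
    unfolding norm_scaled[OF e(1)] using that e(1) by (simp add: ln_div)
  have "\<bar>f x\<bar> \<le> (5 + 3 * K + 2 * C1 + 2 * C2 * K) * e"
  proof -
    obtain B1 where B1: "\<And>x. x \<in> perf e \<Longrightarrow> x \<noteq> y \<Longrightarrow> norm x \<le> d \<Longrightarrow> \<bar>Ge x y + ln (norm (x - y)) / (2 * pi)\<bar> \<le> B1"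
      by (rule g.regular_part_bounded[OF y]) blast
    obtain B2 where B2: "\<And>x. x \<in> \<Omega> \<Longrightarrow> x \<noteq> y \<Longrightarrow> norm x \<le> d \<Longrightarrow> \<bar>G x y + ln (norm (x - y)) / (2 * pi)\<bar> \<le> B2"
      by (rule regular_part_bounded[OF yO]) blast
    obtain B3 where B3: "\<And>x. x \<in> \<Omega> \<Longrightarrow> x \<noteq> 0 \<Longrightarrow> norm x \<le> d \<Longrightarrow> \<bar>G x 0 + ln (norm (x - 0)) / (2 * pi)\<bar> \<le> B3"
      by (rule regular_part_bounded[OF zero_in]) blast
    obtain B4 where B4: "\<And>x. x \<in> U \<Longrightarrow> x \<noteq> y /\<^sub>R e \<Longrightarrow> norm x \<le> d / e \<Longrightarrow> \<bar>GG x (y /\<^sub>R e) + ln (norm (x - y /\<^sub>R e)) / (2 * pi)\<bar> \<le> B4"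
      by (rule outer.regular_part_bounded[OF yU]) blast
    obtain B5 where B5: "\<And>x. x \<in> U \<Longrightarrow> 1 \<le> dist p x \<Longrightarrow> \<bar>GG x p\<bar> \<le> B5"
      by (rule outer.bounded_off_pole[OF pU, of 1]) auto
    define E where "E = ((g.irregular y \<union> irregular y) \<union> irregular 0) \<union>
       ((\<lambda>x. e *\<^sub>R x) ` outer.irregular (y /\<^sub>R e) \<union> (\<lambda>x. e *\<^sub>R x) ` outer.irregular p)"
    show ?thesis
    proof (rule max_principle_abs[OF g.open_D g.bounded_frontier g.q_ext, where F = "{y}" and E = E and
          B = "B1 + B2 + B4 + K * (\<bar>L\<bar> + B5 + \<bar>zi\<bar> + B3) + (B5 + \<bar>zy\<bar> + \<bar>zi\<bar>)"])
      show "finite {y}" by simp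
      show "x \<in> perf e - {y}" using x by simp
      show "polar E" unfolding E_def
        by (intro polar_Un polar_shrink g.polar_irregular polar_irregular outer.polar_irregular y yO yU pU zero_in)
           (use e in auto)
      have s1: "perf e - {y} \<subseteq> {x. x /\<^sub>R e \<in> U - {y /\<^sub>R e}}" using e by (auto simp: perf_def)
      have s2: "perf e - {y} \<subseteq> {x. x /\<^sub>R e \<in> U - {p}}"
      proof
        fix w assume w: "w \<in> perf e - {y}"
        have "w /\<^sub>R e \<noteq> p"
        proof
          assume "w /\<^sub>R e = p"
          then show False using xp[of w] w p(1) by auto
        qed
        then show "w \<in> {x. x /\<^sub>R e \<in> U - {p}}" using w by (simp add: perf_def)
      qed
      have s3: "perf e - {y} \<subseteq> \<Omega> - {y}" "perf e - {y} \<subseteq> \<Omega> - {0}" using perf_nonzero[OF e(1)] by (auto simp: perf_def)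
      have h1: "harmonic (perf e - {y}) (\<lambda>x. GG (x /\<^sub>R e) (y /\<^sub>R e))"
        by (rule harmonic_subset[OF harmonic_scale[OF outer.harmonic_off_pole[OF yU] e(1)] s1])
      have h2: "harmonic (perf e - {y}) (\<lambda>x. GG (x /\<^sub>R e) p)"
        by (rule harmonic_subset[OF harmonic_scale[OF outer.harmonic_off_pole[OF pU] e(1)] s2])
      show "harmonic (perf e - {y}) f"
        unfolding f_def using perf_nonzero[OF e(1)]
        by (intro harmonic_add harmonic_diff harmonic_cmult harmonic_const harmonic_ln_norm
          g.harmonic_off_pole[OF y] harmonic_subset[OF harmonic_off_pole[OF yO] s3(1)] h1 h2
          harmonic_subset[OF harmonic_off_pole[OF zero_in] s3(2)]) auto
    next
      fix w assume w: "w \<in> perf e - {y}"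
      then have wD: "w \<in> perf e" "w \<noteq> y" by auto
      note W = DO[OF wD(1)]
      have ne: "w /\<^sub>R e \<noteq> y /\<^sub>R e" using wD e by simp
      (* Regrouped so that every logarithmic pole is paired with its Green's function. *)
      have fa: "f w = (Ge w y + ln (norm (w - y)) / (2 * pi)) - (G w y + ln (norm (w - y)) / (2 * pi))
         - (GG (w /\<^sub>R e) (y /\<^sub>R e) + ln (norm (w /\<^sub>R e - y /\<^sub>R e)) / (2 * pi))
         - Q * (L + GG (w /\<^sub>R e) p - zi - (G w 0 + ln (norm (w - 0)) / (2 * pi))) + (GG (w /\<^sub>R e) p + (zy - zi))"
        unfolding f_def lns[OF wD(2)] L_def c_def by (simp add: diff_divide_distrib algebra_simps)
      have dp: "1 \<le> dist p (w /\<^sub>R e)"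
        using xp[OF wD(1)] p(1) norm_triangle_ineq2[of p "w /\<^sub>R e"] by (simp add: dist_norm)
      have b5: "\<bar>GG (w /\<^sub>R e) p\<bar> \<le> B5" by (rule B5[OF W(2) dp])
      have triangle3: "\<bar>GG (w /\<^sub>R e) p + (zy - zi)\<bar> \<le> B5 + \<bar>zy\<bar> + \<bar>zi\<bar>"
        using b5 by linarith
      have "\<bar>L + GG (w /\<^sub>R e) p - zi - (G w 0 + ln (norm (w - 0)) / (2 * pi))\<bar> \<le> \<bar>L\<bar> + B5 + \<bar>zi\<bar> + B3"
        using b5 B3[OF W(1,3,4)] by linarith
      then have "\<bar>Q\<bar> * \<bar>L + GG (w /\<^sub>R e) p - zi - (G w 0 + ln (norm (w - 0)) / (2 * pi))\<bar> \<le> K * (\<bar>L\<bar> + B5 + \<bar>zi\<bar> + B3)"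
        using Q(1) K by (intro mult_mono) auto
      then have "\<bar>Q * (L + GG (w /\<^sub>R e) p - zi - (G w 0 + ln (norm (w - 0)) / (2 * pi)))\<bar> \<le> K * (\<bar>L\<bar> + B5 + \<bar>zi\<bar> + B3)"
        by (simp only: abs_mult)
      then show "\<bar>f w\<bar> \<le> B1 + B2 + B4 + K * (\<bar>L\<bar> + B5 + \<bar>zi\<bar> + B3) + (B5 + \<bar>zy\<bar> + \<bar>zi\<bar>)"
        unfolding fa
        by (intro abs_triangle_ineq[THEN order_trans] abs_triangle_ineq4[THEN order_trans] add_mono
            B1[OF wD W(4)] B2[OF W(1) wD(2) W(4)] B4[OF W(2) ne W(5)] triangle3 b5)
    next
      fix z t assume z: "z \<in> frontier (perf e) - E" and t: "(5 + 3 * K + 2 * C1 + 2 * C2 * K) * e < t"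
      define s where "s = t - (5 + 3 * K + 2 * C1 + 2 * C2 * K) * e"
      have s: "s > 0" using t by (simp add: s_def)
      let ?F = "at z within perf e - {y}"
      have inD: "\<forall>\<^sub>F x in ?F. x \<in> perf e \<and> x \<noteq> y" by (simp add: eventually_at_filter)
      have lge: "((\<lambda>x. Ge x y) \<longlongrightarrow> 0) ?F"
        using z by (intro tendsto_within_subset[OF g.green_tendsto_0]) (auto simp: E_def)
      have nz: "(norm \<longlongrightarrow> norm z) ?F" by (intro tendsto_intros)
      have sub: "perf e - {y} \<subseteq> \<Omega>" by (auto simp: perf_def)
      from frontier_perf[OF e(1) _, of z] z e consider
        (out) "z \<in> frontier \<Omega>" "1 \<le> norm z" | (inn) "z /\<^sub>R e \<in> frontier U" "norm z \<le> e" by force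
      then show "\<forall>\<^sub>F x in ?F. \<bar>f x\<bar> < t"
      proof cases
        case out
        have lg: "((\<lambda>x. G x y) \<longlongrightarrow> 0) ?F" "((\<lambda>x. G x 0) \<longlongrightarrow> 0) ?F"
          using z out by (auto intro!: tendsto_within_subset[OF green_tendsto_0 sub] simp: E_def)
        have "((\<lambda>x. Ge x y - G x y + Q * G x 0) \<longlongrightarrow> 0 - 0 + Q * 0) ?F"
          by (intro tendsto_intros lge lg)
        then have "\<forall>\<^sub>F x in ?F. \<bar>Ge x y - G x y + Q * G x 0\<bar> < s"
          using s by (intro order_tendstoD(2)[OF tendsto_rabs_zero]) auto
        moreover have "\<forall>\<^sub>F x in ?F. 1 / 2 < norm x"
          using out by (intro order_tendstoD(1)[OF nz]) simp
        ultimately show ?thesis using inD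
        proof eventually_elim
          case (elim x)
          then have xD: "x \<in> perf e" "x \<noteq> y" by auto
          note X = DO[OF xD(1)]
          define v where "v = x /\<^sub>R e"
          have "norm v = norm x / e" unfolding v_def by (rule norm_scaled[OF e(1)])
          moreover have "(1 / 2) / e \<le> norm x / e" using elim e by (intro divide_right_mono) auto
          ultimately have nv: "1 / (2 * e) \<le> norm v" by simp
          have "4 \<le> 1 / (2 * e)" using e by (simp add: field_simps)
          then have nv2: "2 \<le> norm v" using nv by linarith
          have "1 / norm v \<le> 1 / (1 / (2 * e))" using e nv by (intro frac_le) auto
          then have inv: "1 / norm v \<le> 2 * e" by simp
          have vne: "v \<noteq> y /\<^sub>R e" using xD e by (simp add: v_def)
          define r1 where "r1 = GG v (y /\<^sub>R e) + ln (norm (v - y /\<^sub>R e)) / (2 * pi) - outer.zeta v - zy + zi"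
          define r2 where "r2 = outer.zeta v - ln (norm v) / (2 * pi) - zi"
          have "\<bar>r1\<bar> \<le> 2 / norm v" unfolding r1_def zy_def zi_def
            by (rule outer.regular_part_far[OF nv2 yU vne])
          then have r1: "\<bar>r1\<bar> \<le> 4 * e" using inv by simp
          have "\<bar>r2\<bar> \<le> 1 / norm v" unfolding r2_def zi_def by (rule outer.zeta_inf_limit[OF nv2])
          then have r2: "\<bar>r2\<bar> \<le> 2 * e" using inv by simp
          (* All terms but the first group are of order e. *)
          have fx: "f x = (Ge x y - G x y + Q * G x 0) - r1 - Q * r2 + (1 - Q) * de x"
            unfolding f_def r1_def r2_def de_def v_def lns[OF xD(2)] lns0[OF X(3)] L_def c_def
            by (simp add: diff_divide_distrib algebra_simps)
          have "\<bar>Q * r2\<bar> \<le> K * (2 * e)" unfolding abs_mult using Q(1) r2 K by (intro mult_mono) auto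
          moreover have "\<bar>(1 - Q) * de x\<bar> \<le> (1 + K) * e"
            unfolding abs_mult using Q(1) de[OF xD(1)] K by (intro mult_mono) auto
          ultimately have "\<bar>f x\<bar> < s + 4 * e + K * (2 * e) + (1 + K) * e"
            unfolding fx using elim(1) r1 by linarith
          moreover have "0 \<le> 2 * C1 * e" "0 \<le> 2 * C2 * K * e" using C1(1) C2(1) K e by auto
          ultimately show "\<bar>f x\<bar> < t" unfolding s_def by (simp add: algebra_simps)
        qed
      next
        case inn
        have nin: "z /\<^sub>R e \<notin> outer.irregular o'" if "o' \<in> {y /\<^sub>R e, p}" for o'
        proof
          assume "z /\<^sub>R e \<in> outer.irregular o'"
          then have "e *\<^sub>R (z /\<^sub>R e) \<in> E" using that unfolding E_def by blast
          then show False using z e by simp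
        qed
        have lgg: "((\<lambda>x. GG (x /\<^sub>R e) (y /\<^sub>R e)) \<longlongrightarrow> 0) ?F" "((\<lambda>x. GG (x /\<^sub>R e) p) \<longlongrightarrow> 0) ?F"
          using inn nin by (auto intro!: tendsto_scaled[OF e(1)])
        have "((\<lambda>x. Ge x y - GG (x /\<^sub>R e) (y /\<^sub>R e) + (1 - Q) * GG (x /\<^sub>R e) p) \<longlongrightarrow> 0 - 0 + (1 - Q) * 0) ?F"
          by (intro tendsto_intros lge lgg)
        then have "\<forall>\<^sub>F x in ?F. \<bar>Ge x y - GG (x /\<^sub>R e) (y /\<^sub>R e) + (1 - Q) * GG (x /\<^sub>R e) p\<bar> < s"
          using s by (intro order_tendstoD(2)[OF tendsto_rabs_zero]) auto
        moreover have "\<forall>\<^sub>F x in ?F. norm x < 2 * e"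
          using inn e by (intro order_tendstoD(2)[OF nz]) simp
        ultimately show ?thesis using inD
        proof eventually_elim
          case (elim x)
          then have xD: "x \<in> perf e" "x \<noteq> y" by auto
          note X = DO[OF xD(1)]
          have n4: "norm x \<le> 1 / 4" using elim e by simp
          have h1: "\<bar>H x y - H 0 y\<bar> \<le> C1 * norm x" by (rule C1(2)[OF yO y0 xD(2) n4])
          have h2: "\<bar>H x 0 - H 0 0\<bar> \<le> C2 * norm x" by (rule C2(2)[OF X(3) n4])
          have "C1 * norm x \<le> C1 * (2 * e)" "C2 * norm x \<le> C2 * (2 * e)"
            using C1(1) C2(1) elim by (auto intro!: mult_left_mono)
          then have h: "\<bar>H x y - H 0 y\<bar> \<le> C1 * (2 * e)" "\<bar>H x 0 - H 0 0\<bar> \<le> C2 * (2 * e)" using h1 h2 by linarith+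
          have Hx: "H x y = - (G x y + c * ln (norm (x - y)))" "H x 0 = - (G x 0 + c * ln (norm (x - 0)))"
            using regular_part_eq[OF xD(2), of G] regular_part_eq[OF X(3), of G] by (simp_all add: c_def)
          have q: "Q * (L - zi + H 0 0) = L + zy - zi + H 0 y"
            using Q(2) by (simp add: L_def c_def zi_def zy_def)
          (* The terms without x cancel by q. *)
          have "f x = (Ge x y - GG (x /\<^sub>R e) (y /\<^sub>R e) + (1 - Q) * GG (x /\<^sub>R e) p) + H x y
              + (L + zy - zi) - Q * (L - zi + H x 0)"
            unfolding Hx f_def by (simp add: algebra_simps)
          also have "\<dots> = (Ge x y - GG (x /\<^sub>R e) (y /\<^sub>R e) + (1 - Q) * GG (x /\<^sub>R e) p) + H x y
              + (L + zy - zi) - Q * (L - zi + H 0 0) - Q * (H x 0 - H 0 0)"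
            by (simp add: algebra_simps)
          also have "\<dots> = (Ge x y - GG (x /\<^sub>R e) (y /\<^sub>R e) + (1 - Q) * GG (x /\<^sub>R e) p) + (H x y - H 0 y) - Q * (H x 0 - H 0 0)"
            unfolding q by simp
          finally have fx: "f x = (Ge x y - GG (x /\<^sub>R e) (y /\<^sub>R e) + (1 - Q) * GG (x /\<^sub>R e) p) + (H x y - H 0 y) - Q * (H x 0 - H 0 0)" .
          have "\<bar>Q * (H x 0 - H 0 0)\<bar> \<le> K * (C2 * (2 * e))"
            unfolding abs_mult using Q(1) h(2) K by (intro mult_mono) auto
          then have "\<bar>f x\<bar> < s + C1 * (2 * e) + K * (C2 * (2 * e))"
            unfolding fx using elim(1) h(1) by linarith
          moreover have "0 \<le> K * e" using K e by simp
          ultimately show "\<bar>f x\<bar> < t" using e unfolding s_def by (simp add: algebra_simps)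
        qed
      qed
    qed
  qed
  moreover have "f x = harmonic_remainder Ge e p Q y x"
    by (simp add: harmonic_remainder_def f_def L_def c_def zi_def zy_def algebra_simps)
  ultimately show ?thesis by simp
qed

text \<open>
  The quotient \<open>Q\<close> is bounded uniformly: its numerator grows at most like $|\ln e|$, and its
  denominator is at least of that order for small \<open>e\<close>.
\<close>

theorem uniform_remainder:
  obtains C e0 where "e0 > 0"
    "\<And>e Ge x y. 0 < e \<Longrightarrow> e < e0 \<Longrightarrow> green_domain (perf e) 0 Ge \<Longrightarrow> x \<in> perf e \<Longrightarrow> y \<in> perf e \<Longrightarrow> x \<noteq> y \<Longrightarrow>
      \<bar>Ge x y - approximation e x y\<bar> \<le> C * e"
proof -
  obtain C1 where C1: "C1 \<ge> 0" "\<And>x y. y \<in> \<Omega> \<Longrightarrow> y \<noteq> 0 \<Longrightarrow> x \<noteq> y \<Longrightarrow> norm x \<le> 1/4 \<Longrightarrow> \<bar>H x y - H 0 y\<bar> \<le> C1 * norm x"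
    by (rule H_lipschitz) blast
  obtain C2 where C2: "C2 \<ge> 0" "\<And>x. x \<noteq> 0 \<Longrightarrow> norm x \<le> 1/4 \<Longrightarrow> \<bar>H x 0 - H 0 0\<bar> \<le> C2 * norm x"
    by (rule H_lipschitz_pole_zero) blast
  obtain C3 where C3: "\<And>y. y \<in> \<Omega> \<Longrightarrow> y \<noteq> 0 \<Longrightarrow> - C3 \<le> H 0 y \<and> H 0 y \<le> - ln (norm y) / (2 * pi)"
    by (rule H_zero_bounds) blast
  obtain C4 where C4: "\<And>x. x \<in> U \<Longrightarrow> outer.zeta x \<le> C4 + max 0 (ln (norm x)) / (2 * pi)"
    by (rule outer.zeta_upper) blast
  obtain d where d: "d \<ge> 1" "\<And>x. x \<in> \<Omega> \<Longrightarrow> norm x \<le> d" "\<And>x y. x \<in> \<Omega> \<Longrightarrow> y \<in> \<Omega> \<Longrightarrow> norm (x - y) \<le> d"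
    by (rule diameter) blast
  define zi where "zi = outer.zeta_inf"
  define C' where "C' = \<bar>C4\<bar> + ln d / (2 * pi) + \<bar>zi\<bar> + \<bar>ln \<rho>\<bar> / (2 * pi) + \<bar>C3\<bar>"
  have C'0: "C' \<ge> 0" using d(1) by (simp add: C'_def)
  define K where "K = 2 * (1 + C')"
  (* For e < e0 the logarithm dominates the other terms of the denominator: L < - T. *)
  define T where "T = 1 + 2 * \<bar>H 0 0 - zi\<bar>"
  define e0 where "e0 = min (1 / 8) (exp (- (2 * pi * T)))"
  define C where "C = (5 + 3 * K + 2 * C1 + 2 * C2 * K) + (1 + K)"
  show ?thesis
  proof (rule that[of e0 C])
    show "e0 > 0" by (simp add: e0_def)
    fix e Ge x y
    assume e: "0 < e" "e < e0" and Ge: "green_domain (perf e) 0 Ge" and x: "x \<in> perf e" and y: "y \<in> perf e" and xy: "x \<noteq> y"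
    define L where "L = ln e / (2 * pi)"
    have e8: "e < 1 / 8" using e by (simp add: e0_def)
    have "ln e < ln (exp (- (2 * pi * T)))" using e by (subst ln_less_cancel_iff) (auto simp: e0_def)
    then have "ln e / (2 * pi) < (- (2 * pi * T)) / (2 * pi)" by (intro divide_strict_right_mono) auto
    then have LT: "L < - T" by (simp add: L_def)
    define den where "den = L + H 0 0 - zi"
    define a where "a = \<bar>H 0 0 - zi\<bar>"
    have "0 \<le> a" "L < - (1 + 2 * a)" using LT by (auto simp: T_def a_def)
    then have "L < -1" "2 * a \<le> - L" by linarith+
    then have L1: "L < -1" and "2 * a \<le> - L" .
    moreover have "H 0 0 - zi \<le> a" unfolding a_def by (rule abs_ge_self)
    ultimately have den: "den \<le> L / 2" unfolding den_def by linarith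
    have xO: "x \<in> \<Omega>" "x /\<^sub>R e \<in> U" "x \<noteq> 0" and yO: "y \<in> \<Omega>" "y /\<^sub>R e \<in> U" "y \<noteq> 0"
      using x y perf_nonzero[OF e(1)] by (auto simp: perf_def)
    define zx where "zx = outer.zeta (x /\<^sub>R e)"
    define zy where "zy = outer.zeta (y /\<^sub>R e)"
    define Fy where "Fy = L + zy - zi + H 0 y"
    have Fy: "\<bar>Fy\<bar> \<le> (1 + C') * (- L)"
    proof -
      have "0 \<le> zy" unfolding zy_def by (rule outer.zeta_nonneg[OF yO(2)])
      have "ln (norm (y /\<^sub>R e)) = ln (norm y) - ln e"
        unfolding norm_scaled[OF e(1)] using yO(3) e(1) by (simp add: ln_div)
      moreover have "ln (norm y) \<le> ln d" using d(2)[OF yO(1)] yO by (intro ln_mono) auto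
      moreover have "0 \<le> ln d" "ln e < 0" using d(1) e e8 by auto
      ultimately have "max 0 (ln (norm (y /\<^sub>R e))) \<le> ln d - ln e" by simp
      then have "max 0 (ln (norm (y /\<^sub>R e))) / (2 * pi) \<le> (ln d - ln e) / (2 * pi)" by (intro divide_right_mono) auto
      then have zyu: "zy \<le> C4 + ln d / (2 * pi) - L" using C4[OF yO(2)] by (simp add: zy_def L_def diff_divide_distrib)
      have "ln (e * \<rho>) \<le> ln (norm y)" using norm_perf[OF e(1) y] e rho by (intro ln_mono) auto
      then have "ln e + ln \<rho> \<le> ln (norm y)" using e rho by (simp add: ln_mult)
      then have "(ln e + ln \<rho>) / (2 * pi) \<le> ln (norm y) / (2 * pi)" by (intro divide_right_mono) auto
      then have Hu: "H 0 y \<le> - L - ln \<rho> / (2 * pi)" using C3[OF yO(1,3)] by (simp add: L_def add_divide_distrib)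
      have Hl: "- C3 \<le> H 0 y" using C3[OF yO(1,3)] by simp
      have rr: "- ln \<rho> / (2 * pi) \<le> \<bar>ln \<rho>\<bar> / (2 * pi)" by (intro divide_right_mono) auto
      have dd: "0 \<le> ln d / (2 * pi)" "0 \<le> \<bar>ln \<rho>\<bar> / (2 * pi)" using d(1) by auto
      have "Fy \<le> - L + C'" unfolding Fy_def C'_def using zyu Hu rr by linarith
      moreover have "L - C' \<le> Fy" unfolding Fy_def C'_def using \<open>0 \<le> zy\<close> Hl dd by linarith
      moreover have "C' * 1 \<le> C' * (- L)" using C'0 L1 by (intro mult_left_mono) auto
      ultimately show ?thesis by (simp add: abs_le_iff distrib_right algebra_simps)
    qed
    define Q where "Q = Fy / den"
    have Q: "\<bar>Q\<bar> \<le> K"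
    proof -
      have "\<bar>Fy\<bar> / \<bar>den\<bar> \<le> ((1 + C') * (- L)) / (- L / 2)"
        using Fy den L1 C'0 by (intro frac_le) auto
      also have "\<dots> = K" using L1 by (simp add: K_def field_simps)
      finally show ?thesis by (simp add: Q_def)
    qed
    have dn: "den \<noteq> 0" using den L1 by linarith
    (* The three summands give the three properties of p demanded by remainder_fixed. *)
    define X where "X = 2 + 2 * (d / e) + (1 + d / e) / e"
    define p where "p = complex_of_real X"
    have X0: "0 \<le> d / e" "0 \<le> (1 + d / e) / e" using d(1) e by auto
    then have np: "norm p = X" unfolding p_def norm_of_real X_def by simp
    have Xpos: "X > 0" using X0 unfolding X_def by linarith
    have p3: "(1 + d / e) / norm p \<le> e"
    proof -
      have "(1 + d / e) / e \<le> X" using X0 by (simp add: X_def)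
      then have "1 + d / e \<le> X * e" using e by (simp add: pos_divide_le_eq)
      then show ?thesis using Xpos by (simp add: np pos_divide_le_eq mult.commute)
    qed
    have p12: "2 \<le> norm p" "2 * (d / e) \<le> norm p" using X0 by (auto simp: np X_def)
    define f where "f = harmonic_remainder Ge e p Q y x"
    have f: "\<bar>f\<bar> \<le> (5 + 3 * K + 2 * C1 + 2 * C2 * K) * e"
      unfolding f_def
    proof (rule remainder_fixed[OF e(1) e8 Ge y d(1,2) p12 p3 C1 C2 Q _ x xy])
      have "Q * den = Fy" using dn by (simp add: Q_def)
      then show "Q * (ln e / (2 * pi) - outer.zeta_inf + H 0 0) = ln e / (2 * pi) + outer.zeta (y /\<^sub>R e) - outer.zeta_inf + H 0 y"
        by (simp add: den_def Fy_def L_def zi_def zy_def algebra_simps)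
    qed
    define R where "R = Ge x y - approximation e x y"
    define de where "de = GG (x /\<^sub>R e) p - outer.zeta (x /\<^sub>R e)"
    have nx: "norm (x /\<^sub>R e) \<le> d / e"
      unfolding norm_scaled[OF e(1)] using d(2)[OF xO(1)] e(1) by (intro divide_right_mono) auto
    have "\<bar>de\<bar> \<le> (1 + norm (x /\<^sub>R e)) / norm p"
      unfolding de_def using nx p12 by (intro outer.green_near_zeta xO(2)) auto
    also have "\<dots> \<le> (1 + d / e) / norm p" using nx by (intro divide_right_mono) auto
    finally have de: "\<bar>de\<bar> \<le> e" using p3 by linarith
    have H0: "H x 0 = - (G x 0 + ln (norm x) / (2 * pi))" using regular_part_eq[OF xO(3), of G] by simp
    have lnd: "1 / (2 * pi) * ln (dist x y / e) = ln (norm (x - y)) / (2 * pi) - L"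
      using xy e by (simp add: dist_norm ln_div L_def diff_divide_distrib)
    have "R = Ge x y - (G x y + GG (x /\<^sub>R e) (y /\<^sub>R e) + (ln (norm (x - y)) / (2 * pi) - L) + (L + zx - zi + H x 0) * Q - zx - zy + zi)"
      unfolding R_def approximation_def lnd Q_def Fy_def den_def by (simp add: L_def zx_def zy_def zi_def)
    also have "\<dots> = f - (1 - Q) * de"
      unfolding f_def harmonic_remainder_def H0 de_def by (simp add: L_def zx_def zy_def zi_def algebra_simps)
    finally have R: "R = f - (1 - Q) * de" .
    have "\<bar>(1 - Q) * de\<bar> \<le> (1 + K) * e"
      unfolding abs_mult using Q de by (intro mult_mono) auto
    then have "\<bar>R\<bar> \<le> C * e" unfolding R C_def distrib_right using f by (simp add: distrib_right)
    then show "\<bar>Ge x y - approximation e x y\<bar> \<le> C * e"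
      unfolding R_def .
  qed
qed

end



section \<open>The uniform asymptotic formula\<close>

text \<open>
  A connected set that meets \<open>S\<close> but not its frontier lies in \<open>S\<close>.
\<close>

lemma ball_subset_of_frontier:
  fixes S :: "complex set"
  assumes "x \<in> S" "\<And>z. z \<in> frontier S \<Longrightarrow> r \<le> dist x z"
  shows "ball x r \<subseteq> S"
proof (rule ccontr)
  assume n: "\<not> ball x r \<subseteq> S"
  then have "ball x r \<inter> S \<noteq> {}" using assms(1) by (metis IntI centre_in_ball empty_iff ball_empty empty_subsetI not_le)
  then have "ball x r \<inter> frontier S \<noteq> {}"
    using n by (intro connected_Int_frontier connected_ball) auto
  then show False using assms(2) by (auto simp: not_less[symmetric])
qed

lemma bounded_subset_cball_of_frontier:
  fixes S :: "complex set"
  assumes "bounded S" "frontier S \<subseteq> cball 0 r" "r > 0"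
  shows "S \<subseteq> cball 0 r"
proof (rule ccontr)
  assume "\<not> S \<subseteq> cball 0 r"
  then have i: "- cball 0 r \<inter> S \<noteq> {}" by auto
  have c: "connected (- cball (0::complex) r)"
    by (rule connected_complement_bounded_convex) auto
  have "\<not> bounded (- cball (0::complex) r)" by (simp add: cobounded_imp_unbounded)
  then have "\<not> - cball 0 r \<subseteq> S" using assms(1) bounded_subset by blast
  then have "- cball 0 r \<inter> frontier S \<noteq> {}"
    using i by (intro connected_Int_frontier[OF c]) auto
  then show False using assms(2) by auto
qed

lemma closure_scaled_set:
  assumes "e > 0"
  shows "closure (scaled_set e \<omega>) = {x. x /\<^sub>R e \<in> closure \<omega>}"
proof -
  have im: "{x. x /\<^sub>R e \<in> S} = (*\<^sub>R) e ` S" for S :: "complex set"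
  proof
    show "{x. x /\<^sub>R e \<in> S} \<subseteq> (*\<^sub>R) e ` S"
    proof
      fix x assume "x \<in> {x. x /\<^sub>R e \<in> S}"
      then have "x /\<^sub>R e \<in> S" "x = e *\<^sub>R (x /\<^sub>R e)" using assms by auto
      then show "x \<in> (*\<^sub>R) e ` S" by blast
    qed
  qed (use assms in auto)
  show ?thesis unfolding scaled_set_def im by (rule closure_scaleR[symmetric])
qed

theorem theorem3:
  fixes \<Omega> \<omega> :: "complex set"
    and G \<GG> :: "complex \<Rightarrow> complex \<Rightarrow> real"
    and G\<^sub>\<epsilon> :: "real \<Rightarrow> complex \<Rightarrow> complex \<Rightarrow> real"
    and H :: "complex \<Rightarrow> complex \<Rightarrow> real"
    and \<zeta> :: "complex \<Rightarrow> real"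
    and \<zeta>inf :: real
  assumes "open \<Omega>" "connected \<Omega>" "bounded \<Omega>" "0 \<in> \<Omega>"
    and "open \<omega>" "connected \<omega>" "bounded \<omega>" "0 \<in> \<omega>"
    and "(INF z\<in>frontier \<Omega>. dist 0 z) = 1"
    and "(SUP z\<in>frontier \<omega>. dist 0 z) = 1"
    and "\<forall>\<^sub>F \<epsilon> in at_right 0. green_function (perforated \<Omega> \<omega> \<epsilon>) (G\<^sub>\<epsilon> \<epsilon>)"
    and "green_function \<Omega> G"
    and "green_function (- closure \<omega>) \<GG>"
    and "H = regular_part G"
    and "\<zeta> = (\<lambda>\<eta>. Lim at_infinity (\<lambda>\<xi>. \<GG> \<xi> \<eta>))"
    and "\<zeta>inf = Lim at_infinity (\<lambda>\<eta>. \<zeta> \<eta> - 1 / (2 * pi) * ln (norm \<eta>))"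
  shows "\<exists>C. \<forall>\<^sub>F \<epsilon> in at_right 0.
           \<forall>x \<in> perforated \<Omega> \<omega> \<epsilon>. \<forall>y \<in> perforated \<Omega> \<omega> \<epsilon>. x \<noteq> y \<longrightarrow>
             \<bar>G\<^sub>\<epsilon> \<epsilon> x y -
               (G x y + \<GG> (x /\<^sub>R \<epsilon>) (y /\<^sub>R \<epsilon>) + 1 / (2 * pi) * ln (dist x y / \<epsilon>)
                + (1 / (2 * pi) * ln \<epsilon> + \<zeta> (x /\<^sub>R \<epsilon>) - \<zeta>inf + H x 0)
                  * (1 / (2 * pi) * ln \<epsilon> + \<zeta> (y /\<^sub>R \<epsilon>) - \<zeta>inf + H 0 y)
                  / (1 / (2 * pi) * ln \<epsilon> + H 0 0 - \<zeta>inf)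
                - \<zeta> (x /\<^sub>R \<epsilon>) - \<zeta> (y /\<^sub>R \<epsilon>) + \<zeta>inf)\<bar> \<le> C * \<epsilon>"
proof -
  have bdd_fr: "bounded (frontier S)" if "bounded S" for S :: "complex set"
    by (rule compact_imp_bounded[OF compact_frontier_bounded[OF that]])
  note \<Omega> = assms(1-4) and \<omega> = assms(5-8)
  have fr\<Omega>: "1 \<le> dist 0 z" if "z \<in> frontier \<Omega>" for z
  proof -
    have "(INF z\<in>frontier \<Omega>. dist 0 z) \<le> dist 0 z"
      by (rule cINF_lower[OF _ that]) (auto intro!: bdd_belowI[of _ 0])
    then show ?thesis using assms(9) by simp
  qed
  have ball\<Omega>: "ball 0 1 \<subseteq> \<Omega>" by (rule ball_subset_of_frontier[OF \<Omega>(4) fr\<Omega>])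
  have fr\<omega>: "frontier \<omega> \<subseteq> cball 0 1"
  proof
    fix z assume z: "z \<in> frontier \<omega>"
    have "bounded (frontier \<omega>)" by (rule bdd_fr[OF \<omega>(3)])
    then have "bdd_above (dist 0 ` frontier \<omega>)"
      by (auto simp: bounded_iff bdd_above_def)
    then have "dist 0 z \<le> (SUP z\<in>frontier \<omega>. dist 0 z)" by (intro cSUP_upper z)
    then show "z \<in> cball 0 1" using assms(10) by simp
  qed
  have "\<omega> \<subseteq> cball 0 1" by (rule bounded_subset_cball_of_frontier[OF \<omega>(3) fr\<omega>]) simp
  then have cl\<omega>: "closure \<omega> \<subseteq> cball 0 1" by (rule closure_minimal) simp
  obtain \<rho> where \<rho>: "\<rho> > 0" "ball 0 \<rho> \<subseteq> \<omega>" using \<omega>(1,4) open_contains_ball by blast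
  define U where "U = - closure \<omega>"
  have U: "open U" by (simp add: U_def open_Compl)
  have U\<rho>: "\<rho> \<le> norm x" if "x \<in> U" for x
    using that \<rho>(2) closure_subset[of \<omega>] by (force simp: U_def not_less[symmetric])
  have clU: "0 \<notin> closure V" if "\<And>x. x \<in> V \<Longrightarrow> r \<le> norm x" "r > 0" for V :: "complex set" and r
  proof -
    have "closure V \<subseteq> {x. r \<le> norm x}"
      using that by (intro closure_minimal closed_Collect_le continuous_intros) auto
    then show ?thesis using that by auto
  qed
  have frU: "bounded (frontier U)"
    using \<omega>(3) by (simp add: U_def frontier_complement bdd_fr bounded_closure)
  obtain q where q: "q \<notin> closure \<Omega>"
  proof -
    have "bounded (closure \<Omega>)" by (rule bounded_closure[OF \<Omega>(3)])
    then have "closure \<Omega> \<noteq> UNIV" using not_bounded_UNIV by metis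
    then show ?thesis using that by blast
  qed
  interpret two_scale \<Omega> q G U \<GG> \<rho>
  proof
    show "bounded (frontier \<Omega>)" by (rule bdd_fr[OF \<Omega>(3)])
    show "green_function U \<GG>" using assms(13) by (simp add: U_def)
    show "0 \<notin> closure U" by (rule clU[OF U\<rho> \<rho>(1)])
    show "- cball 0 1 \<subseteq> U" using cl\<omega> by (auto simp: U_def)
  qed (use \<Omega> q assms(12) U frU ball\<Omega> \<rho> U\<rho> in auto)
  have zeta: "\<zeta> = outer.zeta" using assms(15) by (simp add: outer.zeta_def fun_eq_iff)
  then have zi: "\<zeta>inf = outer.zeta_inf" using assms(16) by (simp add: outer.zeta_inf_def)
  have perf: "perforated \<Omega> \<omega> e = perf e" if "e > 0" for e
    unfolding perforated_def perf_def closure_scaled_set[OF that] by (auto simp: U_def)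
  obtain C e0 where e0: "e0 > 0" and main: "\<And>e Ge x y. 0 < e \<Longrightarrow> e < e0 \<Longrightarrow> green_domain (perf e) 0 Ge \<Longrightarrow> x \<in> perf e \<Longrightarrow> y \<in> perf e \<Longrightarrow> x \<noteq> y \<Longrightarrow>
      \<bar>Ge x y - approximation e x y\<bar> \<le> C * e"
    by (rule uniform_remainder) blast
  have green: "green_domain (perf e) 0 (G\<^sub>\<epsilon> e)" if e: "0 < e" and g: "green_function (perforated \<Omega> \<omega> e) (G\<^sub>\<epsilon> e)" for e
  proof
    show "open (perf e)" unfolding perf[OF e, symmetric] perforated_def using \<Omega>(1) by (intro open_Diff) auto
    show "bounded (frontier (perf e))"
      by (rule bdd_fr[OF bounded_subset[OF \<Omega>(3)]]) (auto simp: perf_def)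
    show "0 \<notin> closure (perf e)"
      by (rule clU[of _ "e * \<rho>"]) (use norm_perf[OF e] e \<rho>(1) in auto)
    show "green_function (perf e) (G\<^sub>\<epsilon> e)" using g perf[OF e] by simp
  qed
  have pos: "\<forall>\<^sub>F e in at_right 0. 0 < (e :: real)" by (simp add: eventually_at_filter)
  have small: "\<forall>\<^sub>F e in at_right 0. e < e0"
    using e0 by (auto simp: eventually_at_right)
  show ?thesis
  proof (rule exI[of _ C])
    show "\<forall>\<^sub>F \<epsilon> in at_right 0.
           \<forall>x \<in> perforated \<Omega> \<omega> \<epsilon>. \<forall>y \<in> perforated \<Omega> \<omega> \<epsilon>. x \<noteq> y \<longrightarrow>
             \<bar>G\<^sub>\<epsilon> \<epsilon> x y -
               (G x y + \<GG> (x /\<^sub>R \<epsilon>) (y /\<^sub>R \<epsilon>) + 1 / (2 * pi) * ln (dist x y / \<epsilon>)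
                + (1 / (2 * pi) * ln \<epsilon> + \<zeta> (x /\<^sub>R \<epsilon>) - \<zeta>inf + H x 0)
                  * (1 / (2 * pi) * ln \<epsilon> + \<zeta> (y /\<^sub>R \<epsilon>) - \<zeta>inf + H 0 y)
                  / (1 / (2 * pi) * ln \<epsilon> + H 0 0 - \<zeta>inf)
                - \<zeta> (x /\<^sub>R \<epsilon>) - \<zeta> (y /\<^sub>R \<epsilon>) + \<zeta>inf)\<bar> \<le> C * \<epsilon>"
      using pos small assms(11)
    proof eventually_elim
      case (elim e)
      show ?case
        unfolding perf[OF elim(1)] zeta zi assms(14)
        using main[OF elim(1,2) green[OF elim(1,3)]] unfolding approximation_def by blast
    qed
  qed
qed


end
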